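(* Let $H:\mathbb{R}\to\mathbb{R}$ be a twice differentiable function with bounded derivatives and $H'(0)\ne0$, let $\bar X=\frac{X_1+\cdots+X_n}{n}$, $F_n:=\sqrt n\,\big(H(\bar X)-\mathbb{E}[H(\bar X)]\big)$ and $\sigma_n^2:=\mathrm{Var}(F_n)$, $n\ge1$. Assume that $$\beta:=\max\Big\{\sup_{k\ge1}\mathbb{E}|X_k|^8,\ \sup_{k\ge1}\mathbb{E}|\tau_k(X_k)|^8,\ \sup_{k\ge1}\mathbb{E}|\tau_k'(X_k)|^8\Big\}<\infty,$$ that $\inf_{x\in\mathbb{R}}|H'(x)|>0$, and that $$\mathbb{E}|\tau_1(X_1)+\cdots+\tau_{n_0}(X_{n_0})|^{-8}<\infty\quad\text{for some }n_0\ge1.$$ Then $\gamma:=\sup_{n\ge n_0}n^8\,\mathbb{E}|\tau_1(X_1)+\cdots+\tau_n(X_n)|^{-8}$ is a finite constant and $$I(\sigma_n^{-1}F_n\|Z)\le\frac{C_{H,\beta}\,\gamma^{1/2}}{n\sigma_n^2}\qquad\forall\,n\ge n_0,$$ where $C_{H,\beta}$ is a positive constant depending only on $\beta$, $\|H'\|_\infty$ and $\|H''\|_\infty$.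
   Context: Setting. $(X_k)_{k\ge1}$ is a sequence of independent real-valued random variables (not necessarily identically distributed) with $\mathbb{E}[X_k]=0$ and $\mathrm{Var}(X_k)=1$ for all $k\ge1$. For each $k$, the distribution of $X_k$ has a differentiable density $p_k$ supported on some connected interval of $\mathbb{R}$. The Stein kernel of $X_k$ is $\tau_k(x)=\frac{1}{p_k(x)}\int_x^\infty y\,p_k(y)\,dy$ for $x$ in the support of $p_k$, and $\tau_k'$ is its derivative. $\|\cdot\|_\infty$ is the supremum norm on $\mathbb{R}$. Fisher information distance. $Z\sim N(0,1)$. For a random variable $F$ with $\mathbb{E}[F]=0$, $\mathrm{Var}(F)=1$ and an absolutely continuous density $p_F$, with score function $\rho_F=p_F'/p_F$ (where $p_F'$ is a Radon-Nikodym derivative of $p_F$), $I(F\|Z)=\mathbb{E}[(\rho_F(F)+F)^2]$.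
   Formalization: The constant C may depend on inf|H'| as well as on β, ‖H'‖∞ and ‖H''‖∞ (without this the claim is false: X_k standard normal, H' nearly vanishing at a point); one C for all probability spaces follows by passing to the law of the sequence on ℝ^ℕ. *)

theory Defs
  imports "HOL-Probability.Probability"
begin

text \<open>The support is read as the set where \<open>p\<close> does not vanish (this is where \<open>1 / p\<close> makes
  sense). Differentiability is relative to this interval, so that a jump of \<open>p\<close> at an endpoint,
  as for the uniform distribution, is allowed.\<close>

definition differentiable_density_on_interval ::
    "'a measure \<Rightarrow> ('a \<Rightarrow> real) \<Rightarrow> (real \<Rightarrow> real) \<Rightarrow> bool" where
  "differentiable_density_on_interval M X p \<longleftrightarrow>
     (\<forall>x. 0 \<le> p x) \<and>
     distributed M lborel X (\<lambda>x. ennreal (p x)) \<and>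
     is_interval {x. p x \<noteq> 0} \<and>
     p differentiable_on {x. p x \<noteq> 0}"

text \<open>Outside the support this is \<open>0\<close> by the convention \<open>x / 0 = 0\<close>. The kernel and its
  derivative are only evaluated at a random variable with density \<open>p\<close>, so neither that value nor
  the value of \<open>deriv\<close> at the endpoints of the support matters.\<close>

definition stein_kernel :: "(real \<Rightarrow> real) \<Rightarrow> real \<Rightarrow> real" where
  "stein_kernel p x = (LINT y:{x..}|lborel. y * p y) / p x"

text \<open>\<open>p\<close> is absolutely continuous (on every compact interval) and \<open>p'\<close> is a Radon-Nikodym
  derivative of it.\<close>

definition abs_continuous_with_deriv :: "(real \<Rightarrow> real) \<Rightarrow> (real \<Rightarrow> real) \<Rightarrow> bool" where
  "abs_continuous_with_deriv p p' \<longleftrightarrow>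
     (\<forall>a b. a \<le> b \<longrightarrow> set_integrable lborel {a..b} p' \<and> p b - p a = (LINT x:{a..b}|lborel. p' x))"

text \<open>An absolutely continuous density is unique and its derivative is unique up to a null set, so
  the infimum runs over equal values. It is \<open>\<infinity>\<close> (infimum of the empty set) if there is no
  absolutely continuous density; hence a finite upper bound includes the existence of one.\<close>

definition fisher_information_distance :: "'a measure \<Rightarrow> ('a \<Rightarrow> real) \<Rightarrow> ennreal" where
  "fisher_information_distance M F =
     (INF (p, p') \<in> {(p, p'). (\<forall>x. 0 \<le> p x) \<and> distributed M lborel F (\<lambda>x. ennreal (p x)) \<and>
                              p' \<in> borel_measurable borel \<and> abs_continuous_with_deriv p p'}.
        \<integral>\<^sup>+\<omega>. ennreal ((p' (F \<omega>) / p (F \<omega>) + F \<omega>)\<^sup>2) \<partial>M)"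

definition sup_norm :: "(real \<Rightarrow> real) \<Rightarrow> real" where
  "sup_norm f = (SUP x. \<bar>f x\<bar>)"

definition twice_diff_bounded_derivs :: "(real \<Rightarrow> real) \<Rightarrow> bool" where
  "twice_diff_bounded_derivs H \<longleftrightarrow>
     (\<forall>x. H differentiable (at x)) \<and> (\<forall>x. deriv H differentiable (at x)) \<and>
     bounded (range (deriv H)) \<and> bounded (range (deriv (deriv H)))"

definition eighth_moment :: "'a measure \<Rightarrow> ('a \<Rightarrow> real) \<Rightarrow> ennreal" where
  "eighth_moment M Y = (\<integral>\<^sup>+\<omega>. ennreal (\<bar>Y \<omega>\<bar> ^ 8) \<partial>M)"

text \<open>Here \<open>inverse\<close> is taken in \<^typ>\<open>ennreal\<close>, so that \<open>0\<close> to the power \<open>-8\<close> is \<open>\<infinity>\<close>.\<close>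

definition neg_eighth_moment :: "'a measure \<Rightarrow> ('a \<Rightarrow> real) \<Rightarrow> ennreal" where
  "neg_eighth_moment M Y = (\<integral>\<^sup>+\<omega>. inverse (ennreal (\<bar>Y \<omega>\<bar> ^ 8)) \<partial>M)"

definition moment_bound ::
    "'a measure \<Rightarrow> (nat \<Rightarrow> 'a \<Rightarrow> real) \<Rightarrow> (nat \<Rightarrow> real \<Rightarrow> real) \<Rightarrow> ennreal" where
  "moment_bound M X p =
     Max {SUP k\<in>{1..}. eighth_moment M (X k),
          SUP k\<in>{1..}. eighth_moment M (\<lambda>\<omega>. stein_kernel (p k) (X k \<omega>)),
          SUP k\<in>{1..}. eighth_moment M (\<lambda>\<omega>. deriv (stein_kernel (p k)) (X k \<omega>))}"

definition stein_kernel_sum ::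
    "(nat \<Rightarrow> 'a \<Rightarrow> real) \<Rightarrow> (nat \<Rightarrow> real \<Rightarrow> real) \<Rightarrow> nat \<Rightarrow> 'a \<Rightarrow> real" where
  "stein_kernel_sum X p n \<omega> = (\<Sum>k=1..n. stein_kernel (p k) (X k \<omega>))"

definition neg_moment_bound ::
    "'a measure \<Rightarrow> (nat \<Rightarrow> 'a \<Rightarrow> real) \<Rightarrow> (nat \<Rightarrow> real \<Rightarrow> real) \<Rightarrow> nat \<Rightarrow> ennreal" where
  "neg_moment_bound M X p n\<^sub>0 =
     (SUP n\<in>{n\<^sub>0..}. of_nat n ^ 8 * neg_eighth_moment M (stein_kernel_sum X p n))"

definition sample_mean :: "(nat \<Rightarrow> 'a \<Rightarrow> real) \<Rightarrow> nat \<Rightarrow> 'a \<Rightarrow> real" where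
  "sample_mean X n \<omega> = (\<Sum>k=1..n. X k \<omega>) / real n"

definition delta_statistic ::
    "'a measure \<Rightarrow> (real \<Rightarrow> real) \<Rightarrow> (nat \<Rightarrow> 'a \<Rightarrow> real) \<Rightarrow> nat \<Rightarrow> 'a \<Rightarrow> real" where
  "delta_statistic M H X n \<omega> =
     sqrt (real n) * (H (sample_mean X n \<omega>) - prob_space.expectation M (\<lambda>\<eta>. H (sample_mean X n \<eta>)))"

definition delta_variance ::
    "'a measure \<Rightarrow> (real \<Rightarrow> real) \<Rightarrow> (nat \<Rightarrow> 'a \<Rightarrow> real) \<Rightarrow> nat \<Rightarrow> real" where
  "delta_variance M H X n = prob_space.variance M (delta_statistic M H X n)"

end

theory Submission
  imports Defs
begin

text \<open>
  Write \<open>S = X\<^sub>1 + \<dots> + X\<^sub>n\<close>, \<open>T = \<Sum> \<tau>\<^sub>k(X\<^sub>k)\<close>, \<open>Q = \<Sum> \<tau>\<^sub>k(X\<^sub>k) \<tau>\<^sub>k'(X\<^sub>k)\<close>, \<open>F = F\<^sub>n\<close> and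
  \<open>\<sigma>\<^sup>2 = \<sigma>\<^sub>n\<^sup>2\<close>.

  The Stein kernel is the weight that makes integration by parts work in one coordinate:
  \<open>E[X\<^sub>k g(X\<^sub>k)] = E[\<tau>\<^sub>k(X\<^sub>k) g'(X\<^sub>k)]\<close>. Freezing the other coordinates and applying this to
  \<open>a(S) / T\<close>, then summing over \<open>k\<close>, produces \<open>S a(S) / T\<close> on the left and \<open>a'(S) - Q a(S) / T\<^sup>2\<close> on
  the right, because \<open>\<Sum> \<tau>\<^sub>k\<close> cancels the denominator (\<open>score_of_sum\<close>). The choice
  \<open>a(x) = \<surd>n \<phi>(F(x)) / H'(x/n)\<close> removes the chain rule factor and gives
  \<open>E \<phi>'(F) = E[\<phi>(F) U]\<close> with the explicit variable
  \<open>U = \<surd>n (S/T + Q/T\<^sup>2) / H'(S/n) + H''(S/n) / (\<surd>n H'(S/n)\<^sup>2)\<close> (\<open>score_of_F\<close>).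

  Any such identity determines the score: it forces \<open>F\<close> to have an absolutely continuous density,
  and minus the score is the conditional expectation of \<open>U\<close> given \<open>F\<close>. Conditioning contracts
  mean squares, so the Fisher information distance of \<open>F\<close> is at most \<open>E (F - U)\<^sup>2\<close>
  (\<open>fisher_information_distance_le\<close>). After rescaling by \<open>\<sigma>\<close> the quantity to estimate is
  \<open>E (F - \<sigma>\<^sup>2 U)\<^sup>2 / \<sigma>\<^sup>2\<close>.

  To leading order \<open>F = H'(0) S/\<surd>n\<close>, \<open>T = n\<close>, \<open>H'(S/n) = H'(0)\<close> and \<open>\<sigma>\<^sup>2 = H'(0)\<^sup>2\<close>, and then
  \<open>F - \<sigma>\<^sup>2 U\<close> cancels. Each of these approximations has relative error of order \<open>1/\<surd>n\<close>, so that
  \<open>\<surd>n \<bar>F - \<sigma>\<^sup>2 U\<bar>\<close> is bounded by a polynomial in the quantities \<open>\<bar>S\<bar>/\<surd>n\<close>, \<open>\<bar>T - n\<bar>/\<surd>n\<close>, \<open>\<bar>Q\<bar>/n\<close>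
  of order one, times \<open>1 + (n/T)\<^sup>2\<close> (\<open>discrepancy_bound\<close>). The first factor is controlled by the
  eighth moments of sums of independent centred variables (\<open>even_moment_bound\<close>), the second by
  \<open>\<gamma>\<close>; the inequality between arithmetic and geometric mean with weight \<open>\<surd>\<gamma>\<close> yields the power
  \<open>\<gamma>\<^bsup>1/2\<^esup>\<close>.

  Finiteness of \<open>\<gamma>\<close> needs only the negative moment of the first \<open>n\<^sub>0\<close> kernels: the other kernels
  are nonnegative with mean \<open>1\<close> and bounded second moment, so the probability that \<open>k\<close> of them add
  up to less than \<open>k/4\<close> is exponentially small (\<open>negative_moment_step\<close>).
\<close>

section \<open>The Stein identity for one density\<close>

text \<open>Neither \<open>H''\<close> nor the derivatives of the kernels are assumed continuous, so their
  measurability has to come from difference quotients.\<close>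

lemma borel_measurable_deriv_off_finite:
  fixes f :: "real \<Rightarrow> real"
  assumes f [measurable]: "f \<in> borel_measurable borel" and "finite E"
    and diff: "\<And>x. x \<notin> E \<Longrightarrow> f differentiable (at x)"
  shows "deriv f \<in> borel_measurable borel"
proof (rule measurable_discrete_difference)
  let ?q = "\<lambda>x n. (f (x + 1 / real (Suc n)) - f x) / (1 / real (Suc n))"
  show "(\<lambda>x. lim (\<lambda>n. ?q x n)) \<in> borel_measurable borel"
    by (intro borel_measurable_lim_metric) measurable
  show "countable E" using \<open>finite E\<close> by (rule countable_finite)
  fix x assume "x \<notin> E"
  then have "(f has_real_derivative deriv f x) (at x)"
    using diff DERIV_deriv_iff_real_differentiable by blast
  then have "((\<lambda>h. (f (x + h) - f x) / h) \<longlongrightarrow> deriv f x) (at 0)"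
    by (simp add: DERIV_def)
  moreover have "filterlim (\<lambda>n. 1 / real (Suc n)) (at 0) sequentially"
    unfolding filterlim_at using LIMSEQ_inverse_real_of_nat by (auto simp: inverse_eq_divide)
  ultimately have "(\<lambda>n. ?q x n) \<longlonglongrightarrow> deriv f x"
    by (rule filterlim_compose)
  then show "lim (\<lambda>n. ?q x n) = deriv f x" by (rule limI)
qed auto

text \<open>Of three frontier points the middle one lies strictly between two points of the interval, hence
  in its interior. The frontier is where the fundamental theorem of calculus will be allowed to fail.\<close>

lemma finite_frontier_interval:
  fixes I :: "real set"
  assumes I: "is_interval I"
  shows "finite (frontier I)"
proof (rule ccontr)
  assume "infinite (frontier I)"
  then obtain T where T: "T \<subseteq> frontier I" "card T = 3"
    by (meson infinite_arbitrarily_large)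
  then have "finite T" using card.infinite by force
  define u v where "u = Min T" and "v = Max T"
  have uv: "u \<in> T" "v \<in> T" using T \<open>finite T\<close>
    by (auto simp: u_def v_def intro!: Min_in Max_in)
  have "card (T - {u, v}) \<ge> 1"
  proof -
    have "card {u, v} \<le> 2" by (cases "u = v") auto
    then show ?thesis
      using T uv \<open>finite T\<close> by (subst card_Diff_subset) auto
  qed
  then obtain y where y: "y \<in> T" "y \<noteq> u" "y \<noteq> v"
    by (metis DiffE card.empty insertI1 insert_commute not_one_le_zero ex_in_conv insertCI)
  have "u < y" "y < v"
    using y uv \<open>finite T\<close> Min_le[of T y] Max_ge[of T y] by (auto simp: u_def v_def less_le)
  have cl: "u \<in> closure I" "v \<in> closure I" "y \<notin> interior I"
    using T uv y by (auto simp: frontier_def)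
  obtain a where a: "a \<in> I" "a < y"
  proof -
    obtain a where "a \<in> I" "dist a u < y - u" using cl(1) \<open>u < y\<close>
      by (meson closure_approachable diff_gt_0_iff_gt)
    then show ?thesis by (intro that[of a]) (auto simp: dist_real_def)
  qed
  obtain b where b: "b \<in> I" "y < b"
  proof -
    obtain b where "b \<in> I" "dist b v < v - y" using cl(2) \<open>y < v\<close>
      by (meson closure_approachable diff_gt_0_iff_gt)
    then show ?thesis by (intro that[of b]) (auto simp: dist_real_def)
  qed
  have "{a<..<b} \<subseteq> I"
    using mem_is_interval_1_I[OF I a(1) b(1)] by auto
  then have "y \<in> interior I" using a b
    by (intro interiorI[of "{a<..<b}"]) auto
  with cl show False by simp
qed

locale stein_density = prob_space M for M :: "'a measure" +
  fixes X :: "'a \<Rightarrow> real" and p :: "real \<Rightarrow> real"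
  assumes density: "differentiable_density_on_interval M X p"
    and integrable_X: "integrable M X" and mean_X: "expectation X = 0"
begin

text \<open>At an endpoint of the support the density may jump; only on this open interval are the density
  and the kernel differentiable in the two-sided sense.\<close>

definition supp_int :: "real set" where "supp_int = interior {x. p x \<noteq> 0}"

definition tail :: "real \<Rightarrow> real" where "tail x = (LINT y:{x..}|lborel. y * p y)"

lemma p_nonneg [simp]: "0 \<le> p x"
  and distr_X: "distributed M lborel X (\<lambda>x. ennreal (p x))"
  and support_interval: "is_interval {x. p x \<noteq> 0}"
  and p_differentiable_on: "p differentiable_on {x. p x \<noteq> 0}"
  using density by (auto simp: differentiable_density_on_interval_def)

lemma p_borel [measurable]: "p \<in> borel_measurable borel"
proof -
  have "(\<lambda>x. ennreal (p x)) \<in> borel_measurable borel"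
    using distributed_borel_measurable[OF distr_X] by simp
  then have "(\<lambda>x. enn2real (ennreal (p x))) \<in> borel_measurable borel" by measurable
  then show ?thesis by simp
qed

lemma X_borel [measurable]: "X \<in> borel_measurable M"
  using distributed_measurable[OF distr_X] by simp

lemma expectation_density:
  assumes "g \<in> borel_measurable borel"
  shows "(LINT x|lborel. p x * g x) = expectation (\<lambda>\<omega>. g (X \<omega>))"
  using distributed_integral[OF distr_X, of g] assms by simp

lemma integrable_density:
  assumes "g \<in> borel_measurable borel"
  shows "integrable lborel (\<lambda>x. p x * g x) \<longleftrightarrow> integrable M (\<lambda>\<omega>. g (X \<omega>))"
  using distributed_integrable[OF distr_X, of g] assms by simp

lemma integrable_yp: "integrable lborel (\<lambda>y. y * p y)"
  using integrable_density[of "\<lambda>x. x"] integrable_X by (simp add: mult.commute)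

lemma integral_yp: "(LINT y|lborel. y * p y) = 0"
  using expectation_density[of "\<lambda>x. x"] mean_X by (simp add: mult.commute)

lemma set_integrable_yp: "A \<in> sets borel \<Longrightarrow> set_integrable lborel A (\<lambda>y. y * p y)"
  unfolding set_integrable_def by (intro integrable_mult_indicator integrable_yp) auto

text \<open>The variable is centred, so the upper and the lower tail integral cancel.\<close>

lemma tail_eq_minus_lower_tail: "tail x = - (LINT y:{..<x}|lborel. y * p y)"
proof -
  have "(LINT y:{..<x} \<union> {x..}|lborel. y * p y)
      = (LINT y:{..<x}|lborel. y * p y) + (LINT y:{x..}|lborel. y * p y)"
    by (intro set_integral_Un set_integrable_yp) auto
  moreover have "{..<x} \<union> {x..} = UNIV" by auto
  ultimately show ?thesis
    using integral_yp by (simp add: tail_def set_lebesgue_integral_def)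
qed

lemma tail_nonneg: "0 \<le> tail x"
proof (cases "0 \<le> x")
  case True
  then show ?thesis unfolding tail_def set_lebesgue_integral_def
    by (intro integral_nonneg_AE AE_I2) (auto simp: indicator_def)
next
  case False
  have "0 \<le> (LINT y|lborel. - (indicator {..<x} y *\<^sub>R (y * p y)))"
    using False
    by (intro integral_nonneg_AE AE_I2) (auto simp: indicator_def mult_nonpos_nonneg)
  then show ?thesis
    unfolding tail_eq_minus_lower_tail set_lebesgue_integral_def by simp
qed

lemma stein_kernel_nonneg: "0 \<le> stein_kernel p x"
  using tail_nonneg[of x] by (simp add: stein_kernel_def tail_def)

lemma isCont_tail: "isCont tail x"
  unfolding continuous_at_sequentially
proof (safe)
  fix u :: "nat \<Rightarrow> real" assume u: "u \<longlonglongrightarrow> x"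
  have "(\<lambda>n. LINT y|lborel. indicator {u n..} y *\<^sub>R (y * p y))
         \<longlonglongrightarrow> (LINT y|lborel. indicator {x..} y *\<^sub>R (y * p y))"
  proof (rule integral_dominated_convergence)
    show "integrable lborel (\<lambda>y. \<bar>y * p y\<bar>)" using integrable_yp by simp
    have "AE y in lborel. y \<noteq> x" by (rule AE_lborel_singleton)
    then show "AE y in lborel. (\<lambda>n. indicator {u n..} y *\<^sub>R (y * p y))
        \<longlonglongrightarrow> indicator {x..} y *\<^sub>R (y * p y)"
    proof eventually_elim
      case (elim y)
      have "eventually (\<lambda>n. indicator {u n..} y = (indicator {x..} y :: real)) sequentially"
      proof (cases "y < x")
        case True
        then show ?thesis using order_tendstoD(1)[OF u True]
          by (auto elim!: eventually_mono simp: indicator_def)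
      next
        case False
        then have "x < y" using elim by simp
        then show ?thesis using order_tendstoD(2)[OF u \<open>x < y\<close>]
          by (auto elim!: eventually_mono simp: indicator_def)
      qed
      then show ?case by (intro tendsto_eventually) (auto elim: eventually_mono)
    qed
    show "AE y in lborel. norm (indicator {u n..} y *\<^sub>R (y * p y)) \<le> \<bar>y * p y\<bar>" for n
      by (auto simp: indicator_def)
  qed auto
  then show "(tail \<circ> u) \<longlonglongrightarrow> tail x"
    by (simp add: tail_def[abs_def] set_lebesgue_integral_def comp_def)
qed

lemma tail_borel [measurable]: "tail \<in> borel_measurable borel"
  by (intro borel_measurable_continuous_onI continuous_at_imp_continuous_on ballI isCont_tail)

lemma stein_kernel_eq: "stein_kernel p x = tail x / p x"
  by (simp add: stein_kernel_def tail_def)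

lemma stein_kernel_borel [measurable]: "stein_kernel p \<in> borel_measurable borel"
  unfolding stein_kernel_eq[abs_def] by measurable

text \<open>To the left of the support the tail integral is the whole mean, which is \<open>0\<close>. Together with the
  continuity of \<^term>\<open>tail\<close> this removes the boundary terms at the endpoints of the support, where the
  density itself need not vanish.\<close>

lemma tail_outside: assumes "x \<notin> supp_int" shows "tail x = 0"
proof -
  have "{y. p y \<noteq> 0} \<subseteq> {..x} \<or> {y. p y \<noteq> 0} \<subseteq> {x..}"
  proof (rule ccontr)
    assume "\<not> ?thesis"
    then obtain u v where uv: "p u \<noteq> 0" "p v \<noteq> 0" "x < u" "v < x"
      unfolding subset_iff mem_Collect_eq atMost_iff atLeast_iff not_le de_Morgan_disj by (metis linorder_not_le)
    have "{v<..<u} \<subseteq> {y. p y \<noteq> 0}"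
      using mem_is_interval_1_I[OF support_interval, of v u] uv by auto
    then have "x \<in> supp_int" unfolding supp_int_def using uv by (intro interiorI[of "{v<..<u}"]) auto
    with assms show False by simp
  qed
  then show ?thesis
  proof
    assume *: "{y. p y \<noteq> 0} \<subseteq> {..x}"
    have "AE y in lborel. indicator {x..} y *\<^sub>R (y * p y) = 0"
      using AE_lborel_singleton[of x] by eventually_elim (use * in \<open>auto simp: indicator_def\<close>)
    then have "tail x = (LINT y::real|lborel. 0)"
      unfolding tail_def set_lebesgue_integral_def by (intro integral_cong_AE) auto
    then show ?thesis by simp
  next
    assume *: "{y. p y \<noteq> 0} \<subseteq> {x..}"
    have "(\<lambda>y. indicator {..<x} y *\<^sub>R (y * p y)) = (\<lambda>y. 0)"
      using * by (force simp: indicator_def)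
    then show ?thesis
      unfolding tail_eq_minus_lower_tail set_lebesgue_integral_def by simp
  qed
qed

lemma supp_int_nonzero: "x \<in> supp_int \<Longrightarrow> p x \<noteq> 0"
  unfolding supp_int_def using interior_subset by blast

text \<open>The kernel turns expectations into integrals against \<^term>\<open>tail\<close>, in which the division by
  the density has disappeared.\<close>

lemma p_stein_kernel: "p x * stein_kernel p x = tail x"
  using tail_outside[of x] supp_int_nonzero[of x] by (auto simp: stein_kernel_eq)

lemma open_supp_int: "open supp_int"
  by (simp add: supp_int_def)

lemma p_differentiable: "x \<in> supp_int \<Longrightarrow> p differentiable (at x)"
  using p_differentiable_on at_within_interior[of x "{x. p x \<noteq> 0}"] supp_int_nonzero[of x]
  unfolding differentiable_on_def supp_int_def by fastforce

lemma tail_deriv: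
  assumes "x \<in> supp_int"
  shows "(tail has_real_derivative - (x * p x)) (at x)"
proof -
  obtain e where e: "e > 0" "cball x e \<subseteq> supp_int"
    using open_supp_int assms open_contains_cball by blast
  define c d where "c = x - e" and "d = x + e"
  have cd: "{c..d} \<subseteq> supp_int" "c < x" "x < d"
    using e by (auto simp: c_def d_def cball_eq_atLeastAtMost)
  have cont: "continuous_on {c..d} (\<lambda>y. y * p y)"
    using cd p_differentiable
    by (intro continuous_at_imp_continuous_on ballI isCont_mult)
      (auto intro!: differentiable_imp_continuous_within)
  have eq: "tail c - integral {c..z} (\<lambda>y. y * p y) = tail z" if "z \<in> {c..d}" for z
  proof -
    have "(LINT y:{c..<z} \<union> {z..}|lborel. y * p y)
        = (LINT y:{c..<z}|lborel. y * p y) + (LINT y:{z..}|lborel. y * p y)"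
      by (intro set_integral_Un set_integrable_yp) auto
    moreover have "{c..<z} \<union> {z..} = {c..}" using that by auto
    moreover have "(LINT y:{c..<z}|lborel. y * p y) = (LINT y:{c..z}|lborel. y * p y)"
    proof -
      have "AE y in lborel. y \<noteq> z" by (rule AE_lborel_singleton)
      then show ?thesis unfolding set_lebesgue_integral_def
        by (intro integral_cong_AE) (auto simp: indicator_def)
    qed
    moreover have "(LINT y:{c..z}|lborel. y * p y) = integral {c..z} (\<lambda>y. y * p y)"
      by (intro set_borel_integral_eq_integral set_integrable_yp) auto
    ultimately show ?thesis by (simp add: tail_def)
  qed
  have "((\<lambda>z. integral {c..z} (\<lambda>y. y * p y)) has_real_derivative x * p x) (at x within {c..d})"
    using cd by (intro integral_has_real_derivative cont) auto
  then have "((\<lambda>z. tail c - integral {c..z} (\<lambda>y. y * p y)) has_real_derivative 0 - x * p x)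
      (at x within {c..d})"
    by (intro derivative_intros)
  then have "(tail has_real_derivative 0 - x * p x) (at x within {c..d})"
    by (rule has_field_derivative_transform_within[of _ _ _ _ 1]) (use cd eq in auto)
  moreover have "at x within {c..d} = at x"
    using cd by (intro at_within_interior) auto
  ultimately show ?thesis by simp
qed

lemma stein_kernel_deriv:
  assumes "x \<in> supp_int"
  shows "(stein_kernel p has_real_derivative deriv (stein_kernel p) x) (at x)"
proof -
  obtain D where "(p has_real_derivative D) (at x)"
    using p_differentiable[OF assms] real_differentiable_def by blast
  then have "((\<lambda>z. tail z / p z) has_real_derivative
      ((- (x * p x)) * p x - tail x * D) / (p x * p x)) (at x)"
    by (intro DERIV_divide tail_deriv assms supp_int_nonzero)
  then have "stein_kernel p differentiable (at x)"
    unfolding stein_kernel_eq[abs_def] real_differentiable_def by blast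
  then show ?thesis using DERIV_deriv_iff_real_differentiable by blast
qed

definition supp_frontier :: "real set" where "supp_frontier = frontier {x. p x \<noteq> 0}"

lemma finite_supp_frontier: "finite supp_frontier"
  unfolding supp_frontier_def by (intro finite_frontier_interval support_interval)

lemma exterior_cases:
  assumes "x \<notin> supp_frontier" "x \<notin> supp_int"
  obtains S where "open S" "x \<in> S" "\<And>z. z \<in> S \<Longrightarrow> p z = 0" "S \<inter> supp_int = {}"
proof
  show "open (- closure {x. p x \<noteq> 0})" by auto
  show "x \<in> - closure {x. p x \<noteq> 0}" using assms by (auto simp: supp_frontier_def supp_int_def frontier_def)
  show "p z = 0" if "z \<in> - closure {x. p x \<noteq> 0}" for z
    using that closure_subset[of "{x. p x \<noteq> 0}"] by auto
  show "- closure {x. p x \<noteq> 0} \<inter> supp_int = {}"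
    using closure_subset[of "{x. p x \<noteq> 0}"] supp_int_nonzero by auto
qed

lemma deriv_stein_kernel_borel [measurable]:
  "deriv (stein_kernel p) \<in> borel_measurable borel"
proof (rule borel_measurable_deriv_off_finite[OF _ finite_supp_frontier])
  fix x assume x: "x \<notin> supp_frontier"
  show "stein_kernel p differentiable (at x)"
  proof (cases "x \<in> supp_int")
    case True
    then show ?thesis using stein_kernel_deriv real_differentiable_def by blast
  next
    case False
    obtain S where S: "open S" "x \<in> S" "\<And>z. z \<in> S \<Longrightarrow> p z = 0"
      using exterior_cases[OF x False] by metis
    have "((\<lambda>z. 0) has_real_derivative 0) (at x)" by simp
    then have "(stein_kernel p has_real_derivative 0) (at x)"
      by (rule has_field_derivative_transform_within_open[OF _ S(1,2)])
        (simp add: stein_kernel_eq S(3))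
    then show ?thesis using real_differentiable_def by blast
  qed
qed measurable

lemma AE_in_supp_int: "AE x in lborel. p x = 0 \<or> x \<in> supp_int"
proof -
  have "AE x in lborel. x \<notin> supp_frontier"
    using finite_supp_frontier by (intro AE_not_in countable_imp_null_set_lborel countable_finite)
  then show ?thesis
  proof eventually_elim
    case (elim x)
    then show ?case
      using closure_subset[of "{x. p x \<noteq> 0}"] by (auto simp: supp_frontier_def supp_int_def frontier_def)
  qed
qed

text \<open>Integration by parts: on the support \<open>(tail \<cdot> g)' = tail \<cdot> g' - x p g\<close>, and both terms on the
  right are integrable. The derivative of \<open>g\<close> need not be continuous, so this rests on
  the fundamental theorem for everywhere differentiable functions. Linear growth of \<open>g\<close> instead of
  boundedness admits \<open>g x = x\<close>, which identifies the mean of the kernel with the variance.\<close>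

lemma stein_identity:
  assumes [measurable]: "g \<in> borel_measurable borel" "g' \<in> borel_measurable borel"
    and deriv: "\<And>x. x \<in> supp_int \<Longrightarrow> (g has_real_derivative g' x) (at x)"
    and bound: "\<And>x. x \<in> supp_int \<Longrightarrow> \<bar>g x\<bar> \<le> C * (1 + \<bar>x\<bar>)"
    and sq: "integrable M (\<lambda>\<omega>. (X \<omega>)\<^sup>2)"
    and int': "integrable M (\<lambda>\<omega>. stein_kernel p (X \<omega>) * g' (X \<omega>))"
  shows "expectation (\<lambda>\<omega>. X \<omega> * g (X \<omega>)) = expectation (\<lambda>\<omega>. stein_kernel p (X \<omega>) * g' (X \<omega>))"
proof -
  have supp_int_borel [measurable]: "supp_int \<in> sets borel" using open_supp_int by auto
  define u v where "u = (\<lambda>x. indicator supp_int x * (x * p x * g x))"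
    and "v = (\<lambda>x. indicator supp_int x * (tail x * g' x))"
  \<comment> \<open>Extended by 0, the product tail * g is continuous on the whole line and differentiable off the frontier.\<close>
  define \<Psi> where "\<Psi> = (\<lambda>x. indicator supp_int x * (tail x * g x))"
  define w where "w = (\<lambda>y. p y * (\<bar>C\<bar> * (\<bar>y\<bar> + y\<^sup>2)))"
  have int_w: "integrable lborel w"
  proof -
    have "integrable M (\<lambda>\<omega>. \<bar>C\<bar> * (\<bar>X \<omega>\<bar> + (X \<omega>)\<^sup>2))"
      using sq integrable_X by auto
    then show ?thesis unfolding w_def
      by (subst integrable_density) auto
  qed
  have v_AE: "AE x in lborel. v x = p x * (stein_kernel p x * g' x)"
    using AE_in_supp_int
  proof eventually_elim
    case (elim x)
    then show ?case using p_stein_kernel[of x] tail_outside[of x]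
      by (auto simp: v_def indicator_def)
  qed
  have u_AE: "AE x in lborel. u x = p x * (x * g x)"
    using AE_in_supp_int by eventually_elim (auto simp: u_def indicator_def)
  have [measurable]: "u \<in> borel_measurable borel" "v \<in> borel_measurable borel"
    unfolding u_def v_def by measurable
  have int_v: "integrable lborel v"
  proof -
    have "integrable lborel (\<lambda>x. p x * (stein_kernel p x * g' x))"
      using int' by (subst integrable_density) auto
    then show ?thesis
      using v_AE by (subst integrable_cong_AE[where g = "\<lambda>x. p x * (stein_kernel p x * g' x)"]) auto
  qed
  have int_u: "integrable lborel u"
  proof (rule Bochner_Integration.integrable_bound[OF int_w])
    show "AE x in lborel. norm (u x) \<le> norm (w x)"
    proof (rule AE_I2)
      fix x
      show "norm (u x) \<le> norm (w x)"
      proof (cases "x \<in> supp_int")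
        case True
        have "\<bar>x\<bar> * \<bar>g x\<bar> \<le> \<bar>x\<bar> * (C * (1 + \<bar>x\<bar>))"
          by (intro mult_left_mono bound True) auto
        also have "\<dots> \<le> \<bar>x\<bar> * (\<bar>C\<bar> * (1 + \<bar>x\<bar>))"
          by (intro mult_left_mono mult_right_mono) auto
        also have "\<dots> = \<bar>C\<bar> * (\<bar>x\<bar> + x\<^sup>2)"
          by (simp add: algebra_simps power2_eq_square)
        finally have "p x * (\<bar>x\<bar> * \<bar>g x\<bar>) \<le> p x * (\<bar>C\<bar> * (\<bar>x\<bar> + x\<^sup>2))"
          by (intro mult_left_mono) auto
        then show ?thesis using True by (simp add: u_def w_def abs_mult mult_ac)
      qed (auto simp: u_def)
    qed
  qed auto
  have cont: "isCont \<Psi> x" for x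
  proof (cases "x \<in> supp_int")
    case True
    have "isCont (\<lambda>x. tail x * g x) x"
      using DERIV_isCont[OF deriv[OF True]] isCont_tail by (intro isCont_mult)
    moreover have "eventually (\<lambda>z. \<Psi> z = tail z * g z) (nhds x)"
      using eventually_nhds_in_open[OF open_supp_int True] by eventually_elim (simp add: \<Psi>_def)
    ultimately show ?thesis by (simp add: isCont_cong)
  next
    case False
    have "((\<lambda>z. tail z * (\<bar>C\<bar> * (1 + \<bar>z\<bar>))) \<longlongrightarrow> tail x * (\<bar>C\<bar> * (1 + \<bar>x\<bar>))) (at x)"
      using isCont_tail[of x] unfolding isCont_def by (intro tendsto_intros)
    then have "((\<lambda>z. tail z * (\<bar>C\<bar> * (1 + \<bar>z\<bar>))) \<longlongrightarrow> 0) (at x)"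
      by (simp add: tail_outside[OF False])
    moreover have "\<bar>\<Psi> z\<bar> \<le> tail z * (\<bar>C\<bar> * (1 + \<bar>z\<bar>))" for z
    proof (cases "z \<in> supp_int")
      case True
      have "\<bar>g z\<bar> \<le> \<bar>C\<bar> * (1 + \<bar>z\<bar>)"
        using bound[OF True] by (rule order_trans) (intro mult_right_mono, auto)
      then show ?thesis
        using True tail_nonneg[of z] by (auto simp: \<Psi>_def abs_mult intro: mult_left_mono)
    qed (use tail_nonneg[of z] in \<open>auto simp: \<Psi>_def\<close>)
    ultimately have "(\<Psi> \<longlongrightarrow> 0) (at x)"
      by (intro Lim_null_comparison[of \<Psi>]) auto
    then show ?thesis by (simp add: isCont_def \<Psi>_def False)
  qed
  have der: "(\<Psi> has_vector_derivative (v x - u x)) (at x)" if x: "x \<notin> supp_frontier" for x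
  proof (cases "x \<in> supp_int")
    case True
    have "((\<lambda>z. tail z * g z) has_real_derivative - (x * p x) * g x + g' x * tail x) (at x)"
      by (intro DERIV_mult tail_deriv deriv True)
    then have "(\<Psi> has_real_derivative - (x * p x) * g x + g' x * tail x) (at x)"
      by (rule has_field_derivative_transform_within_open[OF _ open_supp_int True]) (simp add: \<Psi>_def)
    then show ?thesis
      using True by (simp add: has_real_derivative_iff_has_vector_derivative u_def v_def mult_ac)
  next
    case False
    obtain S where S: "open S" "x \<in> S" "S \<inter> supp_int = {}"
      using exterior_cases[OF x False] by metis
    have "((\<lambda>z. 0) has_real_derivative 0) (at x)" by simp
    then have "(\<Psi> has_real_derivative 0) (at x)"
      by (rule has_field_derivative_transform_within_open[OF _ S(1,2)])
        (use S(3) in \<open>auto simp: \<Psi>_def indicator_def\<close>)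
    then show ?thesis
      using False by (simp add: has_real_derivative_iff_has_vector_derivative u_def v_def)
  qed
  have ftc: "(LINT x|lborel. indicator {-real n..real n} x *\<^sub>R (v x - u x))
      = \<Psi> (real n) - \<Psi> (- real n)" for n
  proof -
    have "((\<lambda>x. v x - u x) has_integral \<Psi> (real n) - \<Psi> (- real n)) {-real n..real n}"
      by (rule fundamental_theorem_of_calculus_strong[OF finite_supp_frontier])
        (auto intro!: der continuous_at_imp_continuous_on cont)
    moreover have "set_integrable lborel {-real n..real n} (\<lambda>x. v x - u x)"
      unfolding set_integrable_def using int_u int_v by (intro integrable_mult_indicator) auto
    then have "(LINT x:{-real n..real n}|lborel. v x - u x) = integral {-real n..real n} (\<lambda>x. v x - u x)"
      by (rule set_borel_integral_eq_integral)
    ultimately show ?thesis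
      by (simp add: set_lebesgue_integral_def integral_unique)
  qed
  have lim1: "(\<lambda>n. LINT x|lborel. indicator {-real n..real n} x *\<^sub>R (v x - u x))
      \<longlonglongrightarrow> (LINT x|lborel. v x - u x)"
  proof (rule integral_dominated_convergence)
    show "integrable lborel (\<lambda>x. \<bar>v x - u x\<bar>)" using int_u int_v by auto
    have "(\<lambda>n. indicator {-real n..real n} x *\<^sub>R (v x - u x)) \<longlonglongrightarrow> v x - u x" for x
    proof (rule tendsto_eventually)
      have "eventually (\<lambda>n. \<bar>x\<bar> \<le> real n) sequentially"
        by (meson eventually_sequentiallyI le_trans nat_ceiling_le_eq)
      then show "eventually (\<lambda>n. indicator {-real n..real n} x *\<^sub>R (v x - u x) = v x - u x) sequentially"
        by eventually_elim (auto simp: indicator_def)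
    qed
    then show "AE x in lborel. (\<lambda>n. indicator {-real n..real n} x *\<^sub>R (v x - u x)) \<longlonglongrightarrow> v x - u x"
      by simp
    show "AE x in lborel. norm (indicator {-real n..real n} x *\<^sub>R (v x - u x)) \<le> \<bar>v x - u x\<bar>" for n
      by (auto simp: indicator_def)
  qed auto
  \<comment> \<open>The boundary terms at n and -n: on the range of integration in tail, 1 + |n| is at most 1 + |y|.\<close>
  define r where "r = (\<lambda>n. LINT y|lborel. indicator (- {-real n<..<real n}) y *\<^sub>R w y)"
  have r_lim: "r \<longlonglongrightarrow> 0"
  proof -
    have "r \<longlonglongrightarrow> (LINT y::real|lborel. 0)"
      unfolding r_def
    proof (rule integral_dominated_convergence)
      show "integrable lborel (\<lambda>x. \<bar>w x\<bar>)" using int_w by auto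
      show "(\<lambda>y. indicator (- {-real n<..<real n}) y *\<^sub>R w y) \<in> borel_measurable lborel" for n
        by (simp add: w_def)
      have "(\<lambda>n. indicator (- {-real n<..<real n}) x *\<^sub>R w x) \<longlonglongrightarrow> 0" for x
      proof (rule tendsto_eventually)
        have "eventually (\<lambda>n. \<bar>x\<bar> < real n) sequentially"
          by (metis eventually_sequentiallyI less_le_trans reals_Archimedean2 of_nat_le_iff)
        then show "eventually (\<lambda>n. indicator (- {-real n<..<real n}) x *\<^sub>R w x = 0) sequentially"
          by eventually_elim (auto simp: indicator_def)
      qed
      then show "AE x in lborel. (\<lambda>n. indicator (- {-real n<..<real n}) x *\<^sub>R w x) \<longlonglongrightarrow> 0"
        by simp
      show "AE x in lborel. norm (indicator (- {-real n<..<real n}) x *\<^sub>R w x) \<le> \<bar>w x\<bar>" for n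
        by (auto simp: indicator_def)
    qed auto
    then show ?thesis by simp
  qed
  have core: "tail z * (\<bar>C\<bar> * (1 + \<bar>z\<bar>)) \<le> r n" if "z = real n \<or> z = - real n" for z n
  proof -
    define A where "A = (if z = real n then {z..} else {..<z})"
    have A: "A \<in> sets borel" by (simp add: A_def)
    have "tail z \<le> \<bar>LINT y|lborel. indicator A y *\<^sub>R (y * p y)\<bar>"
      using tail_eq_minus_lower_tail[of z] tail_def[of z]
      by (auto simp: A_def set_lebesgue_integral_def)
    also have "\<dots> \<le> (LINT y|lborel. indicator A y *\<^sub>R (\<bar>y\<bar> * p y))"
      using integral_norm_bound[of lborel "\<lambda>y. indicator A y *\<^sub>R (y * p y)"]
      by (simp add: abs_mult)
    finally have "tail z * (\<bar>C\<bar> * (1 + \<bar>z\<bar>)) \<le> (LINT y|lborel. indicator A y *\<^sub>R (\<bar>y\<bar> * p y)) * (\<bar>C\<bar> * (1 + \<bar>z\<bar>))"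
      by (intro mult_right_mono) auto
    also have "\<dots> = (LINT y|lborel. (indicator A y *\<^sub>R (\<bar>y\<bar> * p y)) * (\<bar>C\<bar> * (1 + \<bar>z\<bar>)))"
      by simp
    also have "\<dots> \<le> r n"
      unfolding r_def
    proof (rule integral_mono)
      have "integrable lborel (\<lambda>y. norm (y * p y))" using integrable_yp by (rule integrable_norm)
      then show "integrable lborel (\<lambda>y. (indicator A y *\<^sub>R (\<bar>y\<bar> * p y)) * (\<bar>C\<bar> * (1 + \<bar>z\<bar>)))"
        using A by (intro integrable_mult_left integrable_mult_indicator) (auto simp: abs_mult)
      show "integrable lborel (\<lambda>y. indicator (- {-real n<..<real n}) y *\<^sub>R w y)"
        using int_w by (intro integrable_mult_indicator) auto
      fix y
      show "(indicator A y *\<^sub>R (\<bar>y\<bar> * p y)) * (\<bar>C\<bar> * (1 + \<bar>z\<bar>)) \<le> indicator (- {-real n<..<real n}) y *\<^sub>R w y"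
      proof (cases "y \<in> A")
        case True
        then have y: "\<bar>z\<bar> \<le> \<bar>y\<bar>" "y \<notin> {-real n<..<real n}"
          using that by (auto simp: A_def split: if_splits)
        have "(\<bar>y\<bar> * p y) * (\<bar>C\<bar> * (1 + \<bar>z\<bar>)) \<le> (\<bar>y\<bar> * p y) * (\<bar>C\<bar> * (1 + \<bar>y\<bar>))"
          using y by (intro mult_left_mono) auto
        also have "\<dots> = w y" by (simp add: w_def algebra_simps power2_eq_square)
        finally show ?thesis using True y by simp
      qed (auto simp: w_def)
    qed
    finally show ?thesis .
  qed
  have \<Psi>_bound: "\<bar>\<Psi> z\<bar> \<le> tail z * (\<bar>C\<bar> * (1 + \<bar>z\<bar>))" for z
  proof (cases "z \<in> supp_int")
    case True
    have "\<bar>g z\<bar> \<le> \<bar>C\<bar> * (1 + \<bar>z\<bar>)"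
      using bound[OF True] by (rule order_trans) (intro mult_right_mono, auto)
    then show ?thesis
      using True tail_nonneg[of z] by (auto simp: \<Psi>_def abs_mult intro: mult_left_mono)
  qed (use tail_nonneg[of z] in \<open>auto simp: \<Psi>_def\<close>)
  have "(\<lambda>n. \<Psi> (real n)) \<longlonglongrightarrow> 0" "(\<lambda>n. \<Psi> (- real n)) \<longlonglongrightarrow> 0"
    using order_trans[OF \<Psi>_bound core] by (auto intro!: Lim_null_comparison[OF _ r_lim])
  then have "(\<lambda>n. \<Psi> (real n) - \<Psi> (- real n)) \<longlonglongrightarrow> 0 - 0"
    by (rule tendsto_diff)
  with lim1 have "(LINT x|lborel. v x - u x) = 0"
    unfolding ftc using LIMSEQ_unique by fastforce
  then have "(LINT x|lborel. v x) = (LINT x|lborel. u x)"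
    using int_u int_v by simp
  moreover have "(LINT x|lborel. v x) = (LINT x|lborel. p x * (stein_kernel p x * g' x))"
    using v_AE by (intro integral_cong_AE) auto
  moreover have "(LINT x|lborel. u x) = (LINT x|lborel. p x * (x * g x))"
    using u_AE by (intro integral_cong_AE) auto
  ultimately show ?thesis
    by (simp add: expectation_density)
qed

end

section \<open>From an integration by parts formula to Fisher information\<close>

lemma (in prob_space) indicator_tail_borel [measurable]:
  fixes F U :: "'a \<Rightarrow> real"
  assumes [measurable]: "F \<in> borel_measurable M" "U \<in> borel_measurable M"
  shows "(\<lambda>t. expectation (\<lambda>\<omega>. U \<omega> * indicator {..F \<omega>} t)) \<in> borel_measurable borel"
proof -
  have "(\<lambda>(t, \<omega>). U \<omega> * indicator {..F \<omega>} t) = (\<lambda>(t, \<omega>). if t \<le> F \<omega> then U \<omega> else 0)"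
    by (auto simp: fun_eq_iff)
  then have "(\<lambda>(t, \<omega>). U \<omega> * indicator {..F \<omega>} t) \<in> borel_measurable (borel \<Otimes>\<^sub>M M)"
    by simp
  then show ?thesis by (rule borel_measurable_lebesgue_integral)
qed

text \<open>\<open>U\<close> stands in for minus the score of \<open>F\<close>: if \<open>F\<close> has density \<open>p\<close>, partial integration gives the
  identity with \<open>U = - p'(F) / p(F)\<close>. The converse is proved here.\<close>

locale score_identity = prob_space M for M :: "'a measure" +
  fixes F U :: "'a \<Rightarrow> real"
  assumes F_borel [measurable]: "F \<in> borel_measurable M"
    and integrable_U: "integrable M U"
    and identity: "\<And>\<phi> \<phi>' B. (\<And>x. (\<phi> has_real_derivative \<phi>' x) (at x)) \<Longrightarrow> continuous_on UNIV \<phi>' \<Longrightarrow>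
      (\<And>x. \<bar>\<phi> x\<bar> \<le> B) \<Longrightarrow> (\<And>x. \<bar>\<phi>' x\<bar> \<le> B) \<Longrightarrow>
      expectation (\<lambda>\<omega>. \<phi>' (F \<omega>)) = expectation (\<lambda>\<omega>. \<phi> (F \<omega>) * U \<omega>)"
begin

lemma U_borel [measurable]: "U \<in> borel_measurable M"
  using integrable_U by auto

lemma indicator_atMost_F_borel [measurable]:
  "(\<lambda>\<omega>. indicator {..F \<omega>} t :: real) \<in> borel_measurable M"
proof -
  have "(\<lambda>\<omega>. indicator {..F \<omega>} t) = (\<lambda>\<omega>. indicator {t..} (F \<omega>) :: real)"
    by (auto simp: indicator_def)
  then show ?thesis by simp
qed

text \<open>If \<open>p\<close> is a density with derivative \<open>- u p\<close>, then \<open>p t\<close> is the integral of \<open>u p\<close> over \<open>[t, \<infinity>)\<close>,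
  that is, the expectation of \<open>u(F)\<close> on the event \<open>F \<ge> t\<close>. This formula, with \<open>U\<close> for \<open>u(F)\<close>,
  defines the candidate density.\<close>

definition q :: "real \<Rightarrow> real" where
  "q t = expectation (\<lambda>\<omega>. U \<omega> * indicator {..F \<omega>} t)"

lemma q_borel [measurable]: "q \<in> borel_measurable borel"
  unfolding q_def[abs_def] by measurable

lemma q_bound: "\<bar>q t\<bar> \<le> expectation (\<lambda>\<omega>. \<bar>U \<omega>\<bar>)"
proof -
  have "integrable M (\<lambda>\<omega>. U \<omega> * indicator {..F \<omega>} t)"
    using integrable_U by (rule Bochner_Integration.integrable_bound)
      (auto simp: indicator_def)
  moreover have "\<bar>q t\<bar> \<le> expectation (\<lambda>\<omega>. \<bar>U \<omega> * indicator {..F \<omega>} t\<bar>)"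
    unfolding q_def by (rule integral_abs_bound)
  ultimately show ?thesis
    using integrable_U by (elim order_trans) (intro integral_mono, auto simp: indicator_def)
qed

text \<open>The identity for the primitive \<open>\<phi>\<close> of \<open>\<psi>\<close>, followed by an exchange of the order of integration.\<close>

lemma weak_density:
  assumes cont: "continuous_on UNIV \<psi>" and supp: "\<And>x. x \<notin> {a..b} \<Longrightarrow> \<psi> x = 0" and "a \<le> b"
  shows "expectation (\<lambda>\<omega>. \<psi> (F \<omega>)) = (LINT t|lborel. \<psi> t * q t)"
proof -
  have [measurable]: "\<psi> \<in> borel_measurable borel"
    using cont by (rule borel_measurable_continuous_onI)
  have int\<psi>: "integrable lborel \<psi>"
  proof -
    have "set_integrable lborel {a..b} \<psi>"
      using continuous_on_subset[OF cont] by (intro borel_integrable_atLeastAtMost') auto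
    moreover have "(\<lambda>x. indicator {a..b} x *\<^sub>R \<psi> x) = \<psi>"
      using supp by (fastforce simp: indicator_def)
    ultimately show ?thesis by (simp add: set_integrable_def)
  qed
  define \<phi> where "\<phi> = (\<lambda>x. LINT t|lborel. \<psi> t * indicator {..x} t)"
  have int\<psi>x: "integrable lborel (\<lambda>t. \<psi> t * indicator A t)" if "A \<in> sets borel" for A
    using int\<psi> by (rule Bochner_Integration.integrable_bound) (use that in \<open>auto simp: indicator_def\<close>)
  have deriv: "(\<phi> has_real_derivative \<psi> x) (at x)" for x
  proof -
    define c where "c = min a (x - 1)"
    have eq: "integral {c..z} \<psi> = \<phi> z" if "z \<in> {c..x+1}" for z
    proof -
      have "set_integrable lborel {c..z} \<psi>"
        using continuous_on_subset[OF cont] by (intro borel_integrable_atLeastAtMost') auto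
      then have "integral {c..z} \<psi> = (LINT t:{c..z}|lborel. \<psi> t)"
        by (rule set_borel_integral_eq_integral(2)[symmetric])
      also have "\<dots> = \<phi> z" unfolding \<phi>_def set_lebesgue_integral_def
        by (intro Bochner_Integration.integral_cong) (auto simp: indicator_def c_def intro!: supp)
      finally show ?thesis .
    qed
    have "((\<lambda>z. integral {c..z} \<psi>) has_real_derivative \<psi> x) (at x within {c..x+1})"
      using continuous_on_subset[OF cont] by (intro integral_has_real_derivative) (auto simp: c_def)
    then have "(\<phi> has_real_derivative \<psi> x) (at x within {c..x+1})"
      by (rule has_field_derivative_transform_within[of _ _ _ _ 1]) (use eq in \<open>auto simp: c_def\<close>)
    moreover have "at x within {c..x+1} = at x"
      by (intro at_within_interior) (auto simp: c_def min_def)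
    ultimately show ?thesis by simp
  qed
  have \<phi>_bound: "\<bar>\<phi> x\<bar> \<le> (LINT t|lborel. \<bar>\<psi> t\<bar>)" for x
  proof -
    have "\<bar>\<phi> x\<bar> \<le> (LINT t|lborel. \<bar>\<psi> t * indicator {..x} t\<bar>)"
      unfolding \<phi>_def by (rule integral_abs_bound)
    also have "\<dots> \<le> (LINT t|lborel. \<bar>\<psi> t\<bar>)"
      by (intro integral_mono integrable_abs int\<psi> int\<psi>x) (auto simp: indicator_def)
    finally show ?thesis .
  qed
  obtain B where B: "\<And>x. x \<in> {a..b} \<Longrightarrow> \<bar>\<psi> x\<bar> \<le> B"
  proof -
    have "compact (\<psi> ` {a..b})"
      by (intro compact_continuous_image continuous_on_subset[OF cont]) auto
    then have "bounded (\<psi> ` {a..b})" by (rule compact_imp_bounded)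
    then obtain B where "\<forall>x\<in>{a..b}. \<bar>\<psi> x\<bar> \<le> B" by (auto simp: bounded_iff)
    then show ?thesis using that by blast
  qed
  define B' where "B' = max B 0 + (LINT t|lborel. \<bar>\<psi> t\<bar>)"
  have "0 \<le> (LINT t|lborel. \<bar>\<psi> t\<bar>)" by (rule Bochner_Integration.integral_nonneg) auto
  moreover have "\<bar>\<psi> x\<bar> \<le> max B 0" for x
    using B[of x] supp[of x] by (cases "x \<in> {a..b}") auto
  ultimately have "expectation (\<lambda>\<omega>. \<psi> (F \<omega>)) = expectation (\<lambda>\<omega>. \<phi> (F \<omega>) * U \<omega>)"
    using \<phi>_bound by (intro identity[of \<phi> \<psi> B'] deriv cont) (auto simp: B'_def intro: add_increasing add_increasing2)
  also have "\<dots> = expectation (\<lambda>\<omega>. LINT t|lborel. \<psi> t * U \<omega> * indicator {..F \<omega>} t)"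
  proof (rule Bochner_Integration.integral_cong[OF refl])
    fix \<omega>
    have "\<phi> (F \<omega>) * U \<omega> = (LINT t|lborel. (\<psi> t * indicator {..F \<omega>} t) * U \<omega>)"
      unfolding \<phi>_def by simp
    then show "\<phi> (F \<omega>) * U \<omega> = (LINT t|lborel. \<psi> t * U \<omega> * indicator {..F \<omega>} t)"
      by (simp add: mult_ac)
  qed
  also have "\<dots> = (LINT t|lborel. expectation (\<lambda>\<omega>. \<psi> t * U \<omega> * indicator {..F \<omega>} t))"
  proof -
    interpret P: pair_sigma_finite M lborel ..
    have ind: "(\<lambda>(\<omega>, t). \<psi> t * U \<omega> * indicator {..F \<omega>} t) = (\<lambda>(\<omega>, t). if t \<le> F \<omega> then \<psi> t * U \<omega> else 0)"
      by (auto simp: fun_eq_iff)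
    have [measurable]: "(\<lambda>(\<omega>, t). \<psi> t * U \<omega> * indicator {..F \<omega>} t) \<in> borel_measurable (M \<Otimes>\<^sub>M lborel)"
      unfolding ind by simp
    have "integrable (M \<Otimes>\<^sub>M lborel) (\<lambda>(\<omega>, t). \<psi> t * U \<omega> * indicator {..F \<omega>} t)"
    proof (rule Bochner_Integration.integrable_bound)
      show "integrable (M \<Otimes>\<^sub>M lborel) (\<lambda>(\<omega>, t). U \<omega> * \<psi> t)"
      proof (rule P.Fubini_integrable)
        have "(\<lambda>x. LINT y|lborel. norm (case (x, y) of (\<omega>, t) \<Rightarrow> U \<omega> * \<psi> t))
            = (\<lambda>x. \<bar>U x\<bar> * (LINT t|lborel. \<bar>\<psi> t\<bar>))"
          by (simp add: abs_mult)
        then show "integrable M (\<lambda>x. LINT y|lborel. norm (case (x, y) of (\<omega>, t) \<Rightarrow> U \<omega> * \<psi> t))"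
          using integrable_U by simp
      qed (use int\<psi> in auto)
      show "AE x in M \<Otimes>\<^sub>M lborel. norm (case x of (\<omega>, t) \<Rightarrow> \<psi> t * U \<omega> * indicator {..F \<omega>} t)
          \<le> norm (case x of (\<omega>, t) \<Rightarrow> U \<omega> * \<psi> t)"
        by (intro AE_I2) (auto simp: indicator_def abs_mult split: prod.split)
    qed simp
    then show ?thesis
      by (rule P.Fubini_integral[symmetric])
  qed
  also have "\<dots> = (LINT t|lborel. \<psi> t * q t)"
    by (simp add: q_def mult.assoc)
  finally show ?thesis .
qed


lemma integrable_q:
  assumes "a < b"
  shows "integrable lborel (\<lambda>t. indicator {a<..<b} t * q t)"
proof (rule Bochner_Integration.integrable_bound)
  show "integrable lborel (\<lambda>t. expectation (\<lambda>\<omega>. \<bar>U \<omega>\<bar>) * indicator {a<..<b} t :: real)"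
    using assms by (intro integrable_mult_right integrable_real_indicator) auto
qed (use q_bound in \<open>auto simp: indicator_def\<close>)

lemma prob_interval:
  assumes "a < b"
  shows "expectation (\<lambda>\<omega>. indicator {a<..<b} (F \<omega>)) = (LINT t|lborel. indicator {a<..<b} t * q t)"
proof -
  \<comment> \<open>Continuous trapezoids increasing to the indicator of the open interval.\<close>
  define \<psi> where "\<psi> = (\<lambda>n::nat. \<lambda>t. min 1 (real n * max 0 (min (t - a) (b - t))))"
  have cont: "continuous_on UNIV (\<psi> n)" for n
    unfolding \<psi>_def by (intro continuous_intros)
  have [measurable]: "\<psi> n \<in> borel_measurable borel" for n
    using cont by (rule borel_measurable_continuous_onI)
  have supp: "\<psi> n t = 0" if "t \<notin> {a..b}" for n t
    using that by (auto simp: \<psi>_def max_def min_def)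
  have bound: "\<bar>\<psi> n t\<bar> \<le> indicator {a<..<b} t" for n t
    by (auto simp: \<psi>_def max_def min_def indicator_def)
  have lim: "(\<lambda>n. \<psi> n t) \<longlonglongrightarrow> indicator {a<..<b} t" for t
  proof (cases "t \<in> {a<..<b}")
    case True
    define d where "d = min (t - a) (b - t)"
    have d: "d > 0" using True by (auto simp: d_def)
    obtain N where N: "1 / d < real N" using reals_Archimedean2 by blast
    have "eventually (\<lambda>n. \<psi> n t = 1) sequentially"
      using eventually_ge_at_top[of N]
    proof eventually_elim
      case (elim n)
      then have "1 / d \<le> real n" using N by linarith
      then have "1 \<le> real n * d" using d by (simp add: field_simps)
      then show ?case using d by (simp add: \<psi>_def d_def)
    qed
    then show ?thesis using True by (simp add: tendsto_eventually)
  next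
    case False
    then have "\<psi> n t = 0" for n using bound[of n t] by simp
    then show ?thesis using False by simp
  qed
  have "(\<lambda>n. expectation (\<lambda>\<omega>. \<psi> n (F \<omega>))) \<longlonglongrightarrow> expectation (\<lambda>\<omega>. indicator {a<..<b} (F \<omega>))"
  proof (rule integral_dominated_convergence[where w = "\<lambda>_. 1"])
    show "AE \<omega> in M. norm (\<psi> n (F \<omega>)) \<le> 1" for n
      using order_trans[OF bound indicator_le_1] by (intro AE_I2) simp
  qed (auto intro: lim)
  moreover have "(\<lambda>n. LINT t|lborel. \<psi> n t * q t) \<longlonglongrightarrow> (LINT t|lborel. indicator {a<..<b} t * q t)"
  proof (rule integral_dominated_convergence)
    show "integrable lborel (\<lambda>t. \<bar>indicator {a<..<b} t * q t\<bar>)"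
      using integrable_q[OF assms] by (intro integrable_abs)
    show "AE t in lborel. (\<lambda>n. \<psi> n t * q t) \<longlonglongrightarrow> indicator {a<..<b} t * q t"
      by (intro AE_I2 tendsto_intros lim)
    show "AE t in lborel. norm (\<psi> n t * q t) \<le> \<bar>indicator {a<..<b} t * q t\<bar>" for n
    proof (intro AE_I2)
      fix t
      have "\<bar>\<psi> n t\<bar> * \<bar>q t\<bar> \<le> indicator {a<..<b} t * \<bar>q t\<bar>"
        by (intro mult_right_mono bound) auto
      then show "norm (\<psi> n t * q t) \<le> \<bar>indicator {a<..<b} t * q t\<bar>"
        by (simp add: abs_mult)
    qed
  qed auto
  moreover have "expectation (\<lambda>\<omega>. \<psi> n (F \<omega>)) = (LINT t|lborel. \<psi> n t * q t)" for n
    using assms by (intro weak_density[OF cont supp]) auto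
  ultimately show ?thesis using LIMSEQ_unique by auto
qed

text \<open>Integrals of \<^term>\<open>q\<close> over intervals are probabilities, which makes \<^term>\<open>q\<close> nonnegative almost
  everywhere; left continuity upgrades this to every point.\<close>

lemma q_left_continuous: "(q \<longlongrightarrow> q t) (at_left t)"
proof (rule tendsto_at_left_sequentially[of "t - 1"])
  fix S :: "nat \<Rightarrow> real" assume S: "\<And>n. S n < t" "S \<longlonglongrightarrow> t"
  show "(\<lambda>n. q (S n)) \<longlonglongrightarrow> q t"
    unfolding q_def
  proof (rule integral_dominated_convergence)
    show "integrable M (\<lambda>\<omega>. \<bar>U \<omega>\<bar>)" using integrable_U by simp
    show "AE \<omega> in M. (\<lambda>n. U \<omega> * indicator {..F \<omega>} (S n)) \<longlonglongrightarrow> U \<omega> * indicator {..F \<omega>} t"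
    proof (intro AE_I2 tendsto_mult tendsto_const)
      fix \<omega>
      show "(\<lambda>n. indicator {..F \<omega>} (S n)) \<longlonglongrightarrow> (indicator {..F \<omega>} t :: real)"
      proof (cases "t \<le> F \<omega>")
        case True
        then have "S n \<le> F \<omega>" for n using S(1)[of n] by simp
        then show ?thesis using True by simp
      next
        case False
        then have "eventually (\<lambda>n. F \<omega> < S n) sequentially"
          using S(2) by (intro order_tendstoD) auto
        then have "eventually (\<lambda>n. indicator {..F \<omega>} (S n) = (0::real)) sequentially"
          by eventually_elim auto
        then show ?thesis using False by (simp add: tendsto_eventually)
      qed
    qed
    show "AE \<omega> in M. norm (U \<omega> * indicator {..F \<omega>} (S n)) \<le> \<bar>U \<omega>\<bar>" for n
      by (auto simp: indicator_def)
  qed auto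
qed auto

lemma q_nonneg: "0 \<le> q t"
proof (rule ccontr)
  assume "\<not> 0 \<le> q t"
  then have neg: "q t < q t / 2" by simp
  then have "eventually (\<lambda>s. q s < q t / 2) (at_left t)"
    using q_left_continuous by (intro order_tendstoD)
  then obtain a where a: "a < t" "\<And>s. a < s \<Longrightarrow> s < t \<Longrightarrow> q s < q t / 2"
    unfolding eventually_at_left_field by blast
  have "0 \<le> expectation (\<lambda>\<omega>. indicat_real {a<..<t} (F \<omega>))"
    by (intro Bochner_Integration.integral_nonneg) auto
  also have "\<dots> = (LINT s|lborel. indicator {a<..<t} s * q s)"
    by (rule prob_interval[OF a(1)])
  also have "\<dots> \<le> (LINT s|lborel. (q t / 2) * indicator {a<..<t} s)"
    using a by (intro integral_mono integrable_q integrable_mult_right integrable_real_indicator)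
      (auto simp: indicator_def intro: less_imp_le)
  also have "\<dots> = q t / 2 * (t - a)" using a by simp
  also have "\<dots> < 0" using a neg by (intro mult_neg_pos) auto
  finally show False by simp
qed

lemma distributed_q: "distributed M lborel F (\<lambda>t. ennreal (q t))"
  unfolding distributed_def
proof (intro conjI)
  have interval: "emeasure (distr M lborel F) {a<..<b} = emeasure (density lborel (\<lambda>t. ennreal (q t))) {a<..<b}"
    if "a < b" for a b
  proof -
    have "emeasure (distr M lborel F) {a<..<b} = (\<integral>\<^sup>+\<omega>. indicator {a<..<b} (F \<omega>) \<partial>M)"
      by (subst nn_integral_distr[of F M lborel "indicator {a<..<b}", symmetric]) auto
    also have "\<dots> = (\<integral>\<^sup>+\<omega>. ennreal (indicator {a<..<b} (F \<omega>)) \<partial>M)"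
      by (simp add: ennreal_indicator)
    also have "\<dots> = ennreal (expectation (\<lambda>\<omega>. indicator {a<..<b} (F \<omega>)))"
      by (intro nn_integral_eq_integral integrable_const_bound[where B = 1])
         (auto simp: indicator_def)
    also have "\<dots> = ennreal (LINT t|lborel. indicator {a<..<b} t * q t)"
      using prob_interval[OF that] by simp
    also have "\<dots> = (\<integral>\<^sup>+t. ennreal (indicator {a<..<b} t * q t) \<partial>lborel)"
      using q_nonneg by (intro nn_integral_eq_integral[symmetric] integrable_q that) auto
    also have "\<dots> = emeasure (density lborel (\<lambda>t. ennreal (q t))) {a<..<b}"
      by (subst emeasure_density)
        (auto simp: indicator_def intro!: nn_integral_cong)
    finally show ?thesis .
  qed
  have tail: "emeasure (distr M lborel F) {a<..} = emeasure (density lborel (\<lambda>t. ennreal (q t))) {a<..}" for a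
  proof -
    define A where "A = (\<lambda>n. {a<..<a + real (Suc n)})"
    have inc: "incseq A" by (auto simp: A_def incseq_def)
    have un: "(\<Union>n. A n) = {a<..}"
    proof (intro set_eqI iffI)
      fix x assume "x \<in> {a<..}"
      moreover obtain n where "x - a < real n" using reals_Archimedean2 by blast
      ultimately have "x \<in> A n" by (simp add: A_def)
      then show "x \<in> (\<Union>n. A n)" by blast
    qed (auto simp: A_def)
    have "emeasure (distr M lborel F) {a<..} = (SUP n. emeasure (distr M lborel F) (A n))"
      unfolding un[symmetric] by (intro SUP_emeasure_incseq[symmetric] inc) (auto simp: A_def)
    also have "\<dots> = (SUP n. emeasure (density lborel (\<lambda>t. ennreal (q t))) (A n))"
      unfolding A_def by (simp add: interval)
    also have "\<dots> = emeasure (density lborel (\<lambda>t. ennreal (q t))) {a<..}"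
      unfolding un[symmetric] by (intro SUP_emeasure_incseq inc) (auto simp: A_def)
    finally show ?thesis .
  qed
  interpret D: prob_space "distr M lborel F" by (rule prob_space_distr) simp
  show "distr M lborel F = density lborel (\<lambda>t. ennreal (q t))"
    by (rule measure_eqI_lessThan) (auto simp: tail[symmetric] D.emeasure_eq_measure)
qed auto

text \<open>\<open>D(F)\<close> is the conditional expectation of \<open>f\<close> given \<open>F\<close>, obtained as a function of \<open>F\<close> at once: \<open>D\<close>
  is the density, with respect to the law of \<open>F\<close>, of the image under \<open>F\<close> of the measure with
  density \<open>f\<close>.\<close>

lemma projection_nonneg:
  assumes f: "integrable M f" "\<And>\<omega>. 0 \<le> f \<omega>"
  obtains D :: "real \<Rightarrow> real" where "D \<in> borel_measurable borel" "integrable M (\<lambda>\<omega>. D (F \<omega>))"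
    "\<And>h::real \<Rightarrow> real. h \<in> borel_measurable borel \<Longrightarrow>
       expectation (\<lambda>\<omega>. f \<omega> * h (F \<omega>)) = expectation (\<lambda>\<omega>. D (F \<omega>) * h (F \<omega>))"
proof -
  have [measurable]: "f \<in> borel_measurable M" using f by auto
  define \<mu> where "\<mu> = distr M borel F"
  define N where "N = distr (density M (\<lambda>\<omega>. ennreal (f \<omega>))) borel F"
  interpret \<mu>: prob_space \<mu> unfolding \<mu>_def by (rule prob_space_distr) simp
  have sets: "sets N = sets \<mu>" "sets \<mu> = sets borel" by (auto simp: N_def \<mu>_def)
  have fin: "finite_measure N"
  proof
    have "emeasure N (space N) = (\<integral>\<^sup>+\<omega>. ennreal (f \<omega>) \<partial>M)"
      by (simp add: N_def emeasure_distr emeasure_density cong: nn_integral_cong)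
    also have "\<dots> = ennreal (expectation f)" using f by (intro nn_integral_eq_integral) auto
    finally show "emeasure N (space N) \<noteq> \<infinity>" by simp
  qed
  have ac: "absolutely_continuous \<mu> N"
    unfolding absolutely_continuous_def
  proof
    fix A assume A: "A \<in> null_sets \<mu>"
    then have [measurable]: "A \<in> sets borel" using sets by auto
    have "AE x in \<mu>. x \<notin> A" using A by (rule AE_not_in)
    then have "AE \<omega> in M. F \<omega> \<notin> A"
      unfolding \<mu>_def by (subst (asm) AE_distr_iff) auto
    then have "AE \<omega> in M. ennreal (f \<omega>) * indicator (F -` A \<inter> space M) \<omega> = 0"
      by eventually_elim auto
    then have "emeasure N A = 0"
      by (simp add: N_def emeasure_distr emeasure_density nn_integral_0_iff_AE)
    then show "A \<in> null_sets N" using sets by auto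
  qed
  obtain D where D: "D \<in> borel_measurable \<mu>" "AE x in \<mu>. RN_deriv \<mu> N x = ennreal (D x)" "\<And>x. 0 \<le> D x"
    using \<mu>.real_RN_deriv[OF fin ac sets(1)] by blast
  have D_meas [measurable]: "D \<in> borel_measurable borel"
    using D(1) sets(2) by (simp cong: measurable_cong_sets)
  have "density \<mu> (RN_deriv \<mu> N) = N" by (rule \<mu>.density_RN_deriv[OF ac sets(1)])
  moreover have "density \<mu> (RN_deriv \<mu> N) = density \<mu> (\<lambda>x. ennreal (D x))"
    using D(1,2) by (intro density_cong) auto
  ultimately have N: "N = density \<mu> (\<lambda>x. ennreal (D x))" by simp
  have *: "expectation (\<lambda>\<omega>. f \<omega> * h (F \<omega>)) = expectation (\<lambda>\<omega>. D (F \<omega>) * h (F \<omega>))"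
    if [measurable]: "h \<in> borel_measurable borel" for h :: "real \<Rightarrow> real"
  proof -
    have "expectation (\<lambda>\<omega>. f \<omega> * h (F \<omega>)) = integral\<^sup>L N h"
      using f by (simp add: N_def integral_distr integral_real_density)
    also have "\<dots> = (LINT x|\<mu>. D x * h x)"
      unfolding N using D(1,3) by (subst integral_real_density) (auto simp: \<mu>_def)
    also have "\<dots> = expectation (\<lambda>\<omega>. D (F \<omega>) * h (F \<omega>))"
      by (simp add: \<mu>_def integral_distr)
    finally show ?thesis .
  qed
  have "integrable M (\<lambda>\<omega>. D (F \<omega>))"
  proof -
    have "(\<integral>\<^sup>+\<omega>. ennreal (D (F \<omega>)) \<partial>M) = (\<integral>\<^sup>+x. ennreal (D x) \<partial>\<mu>)"
      by (simp add: \<mu>_def nn_integral_distr)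
    also have "\<dots> = emeasure N (space N)"
      unfolding N using D(1) by (simp add: emeasure_density cong: nn_integral_cong)
    also have "\<dots> < \<infinity>" using fin by (simp add: finite_measure.emeasure_finite less_top[symmetric])
    finally show ?thesis using D(3) by (intro integrableI_nonneg) auto
  qed
  then show ?thesis using that[of D] D_meas * by blast
qed

lemma projection:
  obtains u :: "real \<Rightarrow> real" where "u \<in> borel_measurable borel" "integrable M (\<lambda>\<omega>. u (F \<omega>))"
    "\<And>h B. h \<in> borel_measurable borel \<Longrightarrow> (\<And>x. \<bar>h x\<bar> \<le> B) \<Longrightarrow>
       expectation (\<lambda>\<omega>. U \<omega> * h (F \<omega>)) = expectation (\<lambda>\<omega>. u (F \<omega>) * h (F \<omega>))"
proof -
  have pos: "integrable M (\<lambda>\<omega>. max 0 (U \<omega>))" and neg: "integrable M (\<lambda>\<omega>. max 0 (- U \<omega>))"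
    using integrable_U by auto
  obtain D where D: "D \<in> borel_measurable borel" "integrable M (\<lambda>\<omega>. D (F \<omega>))"
    "\<And>h::real \<Rightarrow> real. h \<in> borel_measurable borel \<Longrightarrow>
       expectation (\<lambda>\<omega>. max 0 (U \<omega>) * h (F \<omega>)) = expectation (\<lambda>\<omega>. D (F \<omega>) * h (F \<omega>))"
    using projection_nonneg[OF pos] by auto
  obtain E where E: "E \<in> borel_measurable borel" "integrable M (\<lambda>\<omega>. E (F \<omega>))"
    "\<And>h::real \<Rightarrow> real. h \<in> borel_measurable borel \<Longrightarrow>
       expectation (\<lambda>\<omega>. max 0 (- U \<omega>) * h (F \<omega>)) = expectation (\<lambda>\<omega>. E (F \<omega>) * h (F \<omega>))"
    using projection_nonneg[OF neg] by auto
  note [measurable] = D(1) E(1)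
  have mult: "integrable M (\<lambda>\<omega>. f \<omega> * h (F \<omega>))"
    if "integrable M f" "h \<in> borel_measurable borel" "\<And>x. \<bar>h x\<bar> \<le> B"
    for f :: "'a \<Rightarrow> real" and h :: "real \<Rightarrow> real" and B
  proof (rule Bochner_Integration.integrable_bound)
    show "integrable M (\<lambda>\<omega>. \<bar>f \<omega>\<bar> * B)" using that(1) by auto
    show "AE \<omega> in M. norm (f \<omega> * h (F \<omega>)) \<le> norm (\<bar>f \<omega>\<bar> * B)"
      using that(3) by (intro AE_I2) (auto simp: abs_mult intro!: mult_left_mono order_trans[OF that(3) abs_ge_self])
  qed (use that in measurable)
  show ?thesis
  proof (rule that[of "\<lambda>x. D x - E x"])
    fix h :: "real \<Rightarrow> real" and B assume h: "h \<in> borel_measurable borel" "\<And>x. \<bar>h x\<bar> \<le> B"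
    note m = mult[OF _ h]
    have "expectation (\<lambda>\<omega>. U \<omega> * h (F \<omega>))
        = expectation (\<lambda>\<omega>. max 0 (U \<omega>) * h (F \<omega>) - max 0 (- U \<omega>) * h (F \<omega>))"
      by (intro Bochner_Integration.integral_cong) (auto simp: max_def)
    also have "\<dots> = expectation (\<lambda>\<omega>. D (F \<omega>) * h (F \<omega>)) - expectation (\<lambda>\<omega>. E (F \<omega>) * h (F \<omega>))"
      by (subst Bochner_Integration.integral_diff[OF m[OF pos] m[OF neg]]) (simp add: D(3) E(3) h)
    also have "\<dots> = expectation (\<lambda>\<omega>. D (F \<omega>) * h (F \<omega>) - E (F \<omega>) * h (F \<omega>))"
      by (rule Bochner_Integration.integral_diff[OF m[OF D(2)] m[OF E(2)], symmetric])
    also have "\<dots> = expectation (\<lambda>\<omega>. (D (F \<omega>) - E (F \<omega>)) * h (F \<omega>))"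
      by (simp add: left_diff_distrib)
    finally show "expectation (\<lambda>\<omega>. U \<omega> * h (F \<omega>)) = expectation (\<lambda>\<omega>. (D (F \<omega>) - E (F \<omega>)) * h (F \<omega>))" .
  qed (use D(2) E(2) in auto)
qed

text \<open>Conditional expectation contracts the mean square. Neither \<open>F\<close> nor \<open>u(F)\<close> need be
  square integrable, so \<open>x - u x\<close> is truncated to a bounded \<open>h\<close>, for which \<open>E h\<^sup>2 = E (F - U) h\<close>; this is at
  most \<open>E (F - U)\<^sup>2 / 2 + E h\<^sup>2 / 2\<close>, and monotone convergence removes the truncation.\<close>

lemma projection_contracts:
  assumes [measurable]: "u \<in> borel_measurable borel" and int_u: "integrable M (\<lambda>\<omega>. u (F \<omega>))"
    and u: "\<And>h B. h \<in> borel_measurable borel \<Longrightarrow> (\<And>x. \<bar>h x\<bar> \<le> B) \<Longrightarrow>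
       expectation (\<lambda>\<omega>. U \<omega> * h (F \<omega>)) = expectation (\<lambda>\<omega>. u (F \<omega>) * h (F \<omega>))"
  shows "(\<integral>\<^sup>+\<omega>. ennreal ((F \<omega> - u (F \<omega>))\<^sup>2) \<partial>M) \<le> (\<integral>\<^sup>+\<omega>. ennreal ((F \<omega> - U \<omega>)\<^sup>2) \<partial>M)"
proof (cases "(\<integral>\<^sup>+\<omega>. ennreal ((F \<omega> - U \<omega>)\<^sup>2) \<partial>M) = \<infinity>")
  case False
  then have sq: "integrable M (\<lambda>\<omega>. (F \<omega> - U \<omega>)\<^sup>2)"
    by (intro integrableI_nonneg) (auto simp: less_top[symmetric])
  define h where "h = (\<lambda>n::nat. \<lambda>x. if \<bar>x\<bar> \<le> real n \<and> \<bar>u x\<bar> \<le> real n then x - u x else 0)"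
  have [measurable]: "h n \<in> borel_measurable borel" for n unfolding h_def by measurable
  have hb: "\<bar>h n x\<bar> \<le> 2 * real n" for n x by (auto simp: h_def)
  have hF: "\<bar>h n x * x\<bar> \<le> 2 * real n * real n" for n x
  proof (cases "\<bar>x\<bar> \<le> real n")
    case True
    then show ?thesis unfolding abs_mult using hb[of n x] by (intro mult_mono) auto
  qed (simp add: h_def)
  have h2: "h n x ^ 2 = x * h n x - u x * h n x" for n x
    by (simp add: h_def power2_eq_square algebra_simps)
  have young: "x * y \<le> x\<^sup>2 / 2 + y\<^sup>2 / 2" for x y :: real
    using sum_squares_bound[of x y] by simp
  have bd: "(\<integral>\<^sup>+\<omega>. ennreal (h n (F \<omega>) ^ 2) \<partial>M) \<le> (\<integral>\<^sup>+\<omega>. ennreal ((F \<omega> - U \<omega>)\<^sup>2) \<partial>M)" for n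
  proof -
    have i1: "integrable M (\<lambda>\<omega>. F \<omega> * h n (F \<omega>))"
      by (rule integrable_const_bound[where B = "2 * real n * real n"])
        (use hF[of n] in \<open>auto simp: mult.commute\<close>)
    have ib: "integrable M (\<lambda>\<omega>. f \<omega> * h n (F \<omega>))" if "integrable M f" for f
    proof (rule Bochner_Integration.integrable_bound)
      show "integrable M (\<lambda>\<omega>. \<bar>f \<omega>\<bar> * (2 * real n))" using that by auto
      show "AE \<omega> in M. norm (f \<omega> * h n (F \<omega>)) \<le> norm (\<bar>f \<omega>\<bar> * (2 * real n))"
        using hb[of n] by (intro AE_I2) (auto simp: abs_mult intro!: mult_left_mono)
    qed (use that in measurable)
    have ih: "integrable M (\<lambda>\<omega>. h n (F \<omega>) ^ 2)"
      unfolding h2 using i1 ib[OF int_u] by auto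
    have "expectation (\<lambda>\<omega>. h n (F \<omega>) ^ 2) = expectation (\<lambda>\<omega>. F \<omega> * h n (F \<omega>)) - expectation (\<lambda>\<omega>. u (F \<omega>) * h n (F \<omega>))"
      unfolding h2 using i1 ib[OF int_u] by auto
    also have "expectation (\<lambda>\<omega>. u (F \<omega>) * h n (F \<omega>)) = expectation (\<lambda>\<omega>. U \<omega> * h n (F \<omega>))"
      by (rule u[of "h n", symmetric]) (use hb in auto)
    also have "expectation (\<lambda>\<omega>. F \<omega> * h n (F \<omega>)) - expectation (\<lambda>\<omega>. U \<omega> * h n (F \<omega>))
        = expectation (\<lambda>\<omega>. (F \<omega> - U \<omega>) * h n (F \<omega>))"
      using i1 ib[OF integrable_U] by (simp add: left_diff_distrib)
    also have "\<dots> \<le> expectation (\<lambda>\<omega>. (F \<omega> - U \<omega>)\<^sup>2 / 2 + h n (F \<omega>) ^ 2 / 2)"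
    proof (rule integral_mono)
      show "integrable M (\<lambda>\<omega>. (F \<omega> - U \<omega>) * h n (F \<omega>))"
        using i1 ib[OF integrable_U] by (simp add: left_diff_distrib)
      show "(F \<omega> - U \<omega>) * h n (F \<omega>) \<le> (F \<omega> - U \<omega>)\<^sup>2 / 2 + h n (F \<omega>) ^ 2 / 2" for \<omega>
        by (rule young)
    qed (use sq ih in auto)
    also have "\<dots> = expectation (\<lambda>\<omega>. (F \<omega> - U \<omega>)\<^sup>2) / 2 + expectation (\<lambda>\<omega>. h n (F \<omega>) ^ 2) / 2"
      using sq ih by simp
    finally have "expectation (\<lambda>\<omega>. h n (F \<omega>) ^ 2) \<le> expectation (\<lambda>\<omega>. (F \<omega> - U \<omega>)\<^sup>2)" by simp
    then show ?thesis
      using sq ih by (simp add: nn_integral_eq_integral ennreal_leI)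
  qed
  have inc: "incseq (\<lambda>n \<omega>. ennreal (h n (F \<omega>) ^ 2))"
    by (auto simp: incseq_def le_fun_def h_def intro!: ennreal_leI)
  have "(\<integral>\<^sup>+\<omega>. ennreal ((F \<omega> - u (F \<omega>))\<^sup>2) \<partial>M) \<le> (\<integral>\<^sup>+\<omega>. (SUP n. ennreal (h n (F \<omega>) ^ 2)) \<partial>M)"
  proof (rule nn_integral_mono)
    fix \<omega>
    obtain n where "max \<bar>F \<omega>\<bar> \<bar>u (F \<omega>)\<bar> < real n" using reals_Archimedean2 by blast
    then have "(F \<omega> - u (F \<omega>))\<^sup>2 = h n (F \<omega>) ^ 2" by (auto simp: h_def)
    then show "ennreal ((F \<omega> - u (F \<omega>))\<^sup>2) \<le> (SUP n. ennreal (h n (F \<omega>) ^ 2))"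
      by (metis SUP_upper UNIV_I)
  qed
  also have "\<dots> = (SUP n. \<integral>\<^sup>+\<omega>. ennreal (h n (F \<omega>) ^ 2) \<partial>M)"
    by (rule nn_integral_monotone_convergence_SUP[OF inc]) measurable
  also have "\<dots> \<le> (\<integral>\<^sup>+\<omega>. ennreal ((F \<omega> - U \<omega>)\<^sup>2) \<partial>M)"
    by (rule SUP_least) (rule bd)
  finally show ?thesis .
qed simp

text \<open>The increments of \<^term>\<open>q\<close> are \<open>- E[U; a \<le> F < b]\<close>. Here \<open>U\<close> may be replaced by its projection \<open>u(F)\<close>,
  which displays \<open>- u q\<close> as a derivative of \<^term>\<open>q\<close> and \<open>- u\<close> as the score.\<close>

theorem fisher_information_distance_le:
  "fisher_information_distance M F \<le> (\<integral>\<^sup>+\<omega>. ennreal ((F \<omega> - U \<omega>)\<^sup>2) \<partial>M)"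
proof -
  obtain u :: "real \<Rightarrow> real" where um [measurable]: "u \<in> borel_measurable borel"
    and int_u: "integrable M (\<lambda>\<omega>. u (F \<omega>))"
    and u: "\<And>h B. h \<in> borel_measurable borel \<Longrightarrow> (\<And>x. \<bar>h x\<bar> \<le> B) \<Longrightarrow>
       expectation (\<lambda>\<omega>. U \<omega> * h (F \<omega>)) = expectation (\<lambda>\<omega>. u (F \<omega>) * h (F \<omega>))"
    using projection by blast
  define q' where "q' = (\<lambda>x. - (q x * u x))"
  have [measurable]: "q' \<in> borel_measurable borel" unfolding q'_def by measurable
  have int_q': "integrable lborel q'"
  proof -
    have "integrable lborel (\<lambda>x. q x * u x)"
      using int_u by (subst distributed_integrable[OF distributed_q]) (auto simp: q_nonneg)
    then show ?thesis unfolding q'_def by auto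
  qed
  have "abs_continuous_with_deriv q q'"
    unfolding abs_continuous_with_deriv_def
  proof (intro allI impI conjI)
    fix a b :: real assume "a \<le> b"
    show "set_integrable lborel {a..b} q'"
      unfolding set_integrable_def using int_q' by (intro integrable_mult_indicator) auto
    have ind: "integrable M (\<lambda>\<omega>. U \<omega> * indicator {..F \<omega>} t)" for t
      using integrable_U by (rule Bochner_Integration.integrable_bound) (auto simp: indicator_def)
    have "q b - q a = expectation (\<lambda>\<omega>. U \<omega> * indicator {..F \<omega>} b - U \<omega> * indicator {..F \<omega>} a)"
      unfolding q_def using ind by simp
    also have "\<dots> = expectation (\<lambda>\<omega>. - (U \<omega> * indicator {a..<b} (F \<omega>)))"
      using \<open>a \<le> b\<close> by (intro Bochner_Integration.integral_cong) (auto simp: indicator_def)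
    also have "\<dots> = - expectation (\<lambda>\<omega>. U \<omega> * indicator {a..<b} (F \<omega>))" by simp
    also have "expectation (\<lambda>\<omega>. U \<omega> * indicator {a..<b} (F \<omega>)) = expectation (\<lambda>\<omega>. u (F \<omega>) * indicator {a..<b} (F \<omega>))"
      by (rule u[of _ 1]) (auto simp: indicator_def)
    also have "\<dots> = (LINT x|lborel. q x * (u x * indicator {a..<b} x))"
      by (rule distributed_integral[OF distributed_q, symmetric]) (auto simp: q_nonneg)
    also have "- \<dots> = (LINT x|lborel. indicator {a..<b} x * q' x)"
      by (simp add: q'_def mult_ac flip: integral_minus)
    also have "\<dots> = (LINT x:{a..b}|lborel. q' x)"
      unfolding set_lebesgue_integral_def
    proof (rule integral_cong_AE)
      show "AE x in lborel. indicator {a..<b} x * q' x = indicator {a..b} x *\<^sub>R q' x"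
        using AE_lborel_singleton[of b] by eventually_elim (auto simp: indicator_def)
    qed auto
    finally show "q b - q a = (LINT x:{a..b}|lborel. q' x)" .
  qed
  then have "fisher_information_distance M F \<le> (\<integral>\<^sup>+\<omega>. ennreal ((q' (F \<omega>) / q (F \<omega>) + F \<omega>)\<^sup>2) \<partial>M)"
    unfolding fisher_information_distance_def
    by (intro INF_lower2[of "(q, q')"]) (auto simp: q_nonneg distributed_q)
  also have "\<dots> = (\<integral>\<^sup>+\<omega>. ennreal ((F \<omega> - u (F \<omega>))\<^sup>2) \<partial>M)"
  proof (rule nn_integral_cong_AE)
    have "AE \<omega> in M. q (F \<omega>) \<noteq> 0"
      by (subst distributed_AE2[OF distributed_q]) auto
    then show "AE \<omega> in M. ennreal ((q' (F \<omega>) / q (F \<omega>) + F \<omega>)\<^sup>2) = ennreal ((F \<omega> - u (F \<omega>))\<^sup>2)"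
      by eventually_elim (simp add: q'_def)
  qed
  also have "\<dots> \<le> (\<integral>\<^sup>+\<omega>. ennreal ((F \<omega> - U \<omega>)\<^sup>2) \<partial>M)"
    by (rule projection_contracts[OF um int_u u])
  finally show ?thesis .
qed

end

section \<open>Even moments of sums of independent centred variables\<close>

lemma power_le_one_plus:
  fixes x :: real assumes "0 \<le> x" "i \<le> j" shows "x ^ i \<le> 1 + x ^ j"
proof (cases "x \<le> 1")
  case True
  then have "x ^ i \<le> 1" using assms by (intro power_le_one) auto
  then show ?thesis using assms by (simp add: add_increasing2)
next
  case False
  then have "x ^ i \<le> x ^ j" using assms by (intro power_increasing) auto
  then show ?thesis by simp
qed

lemma mult_le_sum_squares:
  fixes x y :: real
  shows "x * y \<le> x\<^sup>2 + y\<^sup>2"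
  using sum_squares_bound[of x y] sum_power2_ge_zero[of x y] by linarith

lemma abs_power_add_le:
  fixes s y :: real
  shows "\<bar>s + y\<bar> ^ m \<le> 2 ^ m * (\<bar>s\<bar> ^ m + \<bar>y\<bar> ^ m)"
proof -
  have "\<bar>s + y\<bar> ^ m \<le> (2 * max \<bar>s\<bar> \<bar>y\<bar>) ^ m"
    by (intro power_mono) auto
  also have "\<dots> = 2 ^ m * max \<bar>s\<bar> \<bar>y\<bar> ^ m" by (simp add: power_mult_distrib)
  also have "\<dots> \<le> 2 ^ m * (\<bar>s\<bar> ^ m + \<bar>y\<bar> ^ m)"
    by (intro mult_left_mono) (auto simp: max_def)
  finally show ?thesis .
qed

text \<open>A Taylor expansion to first order in \<open>y\<close>: a term \<open>s\<^sup>b y\<^bsup>a+2\<^esup>\<close> with \<open>a + b = N - 2\<close> is dominated by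
  the two extreme ones. For independent \<open>s\<close> and \<open>y\<close> with centred \<open>y\<close> the linear term has mean zero, so
  adding \<open>y\<close> raises the \<open>N\<close>-th moment only by a multiple of the moment of order \<open>N - 2\<close>, up to a constant.\<close>

lemma even_power_add_le:
  fixes s y :: real
  assumes "even N" "2 \<le> N"
  shows "(s + y) ^ N \<le> s ^ N + real N * (s ^ (N - 1) * y) + 2 ^ N * (s ^ (N - 2) * y\<^sup>2 + y ^ N)"
proof -
  define R where "R = s ^ (N - 2) * y\<^sup>2 + y ^ N"
  have even2: "even (N - 2)" using assms by auto
  have term_le: "y ^ i * s ^ (N - i) \<le> R" if i: "2 \<le> i" "i \<le> N" for i
  proof -
    obtain a where a: "i = 2 + a" using i le_Suc_ex by blast
    define b where "b = N - i"
    have ab: "N - 2 = a + b" "N = 2 + (a + b)" using a i by (auto simp: b_def)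
    have "\<bar>y\<bar> ^ a * \<bar>s\<bar> ^ b \<le> max \<bar>s\<bar> \<bar>y\<bar> ^ a * max \<bar>s\<bar> \<bar>y\<bar> ^ b"
      by (intro mult_mono power_mono) auto
    also have "\<dots> = max \<bar>s\<bar> \<bar>y\<bar> ^ (a + b)" by (simp add: power_add)
    also have "\<dots> \<le> \<bar>s\<bar> ^ (a + b) + \<bar>y\<bar> ^ (a + b)" by (auto simp: max_def)
    also have "\<dots> = s ^ (a + b) + y ^ (a + b)"
      using even2 ab by (simp add: power_even_abs)
    finally have *: "\<bar>y\<bar> ^ a * \<bar>s\<bar> ^ b \<le> s ^ (a + b) + y ^ (a + b)" .
    have "y ^ i * s ^ (N - i) \<le> \<bar>y ^ i * s ^ (N - i)\<bar>" by simp
    also have "\<dots> = y\<^sup>2 * (\<bar>y\<bar> ^ a * \<bar>s\<bar> ^ b)"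
      by (simp add: a b_def abs_mult power_add power_abs power2_eq_square)
    also have "\<dots> \<le> y\<^sup>2 * (s ^ (a + b) + y ^ (a + b))"
      by (intro mult_left_mono *) auto
    also have "\<dots> = R" by (simp add: R_def ab algebra_simps flip: power_add)
    finally show ?thesis .
  qed
  have R0: "0 \<le> R" using assms even2 by (auto simp: R_def zero_le_even_power)
  have "(s + y) ^ N = (\<Sum>i\<le>N. real (N choose i) * y ^ i * s ^ (N - i))"
    using binomial_ring[of y s N] by (simp add: add.commute)
  also have "{..N} = {0, 1} \<union> {2..N}" using assms by auto
  also have "(\<Sum>i\<in>{0, 1} \<union> {2..N}. real (N choose i) * y ^ i * s ^ (N - i))
      = s ^ N + real N * (s ^ (N - 1) * y) + (\<Sum>i=2..N. real (N choose i) * y ^ i * s ^ (N - i))"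
    by (subst sum.union_disjoint) auto
  also have "(\<Sum>i=2..N. real (N choose i) * y ^ i * s ^ (N - i)) \<le> (\<Sum>i=2..N. real (N choose i) * R)"
    unfolding mult.assoc by (intro sum_mono mult_left_mono term_le) auto
  also have "\<dots> \<le> (\<Sum>i\<le>N. real (N choose i) * R)"
    using R0 by (intro sum_mono2) auto
  also have "\<dots> = 2 ^ N * R"
    using choose_row_sum[of N] by (simp add: sum_distrib_right[symmetric] flip: of_nat_sum)
  finally show ?thesis by (simp add: R_def)
qed

lemma (in prob_space) integrable_power_le:
  fixes f :: "'a \<Rightarrow> real"
  assumes [measurable]: "f \<in> borel_measurable M"
    and int: "integrable M (\<lambda>\<omega>. \<bar>f \<omega>\<bar> ^ m)" and "k \<le> m"
  shows "integrable M (\<lambda>\<omega>. \<bar>f \<omega>\<bar> ^ k)" "integrable M (\<lambda>\<omega>. f \<omega> ^ k)"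
    "expectation (\<lambda>\<omega>. \<bar>f \<omega>\<bar> ^ k) \<le> 1 + expectation (\<lambda>\<omega>. \<bar>f \<omega>\<bar> ^ m)"
proof -
  have le: "\<bar>x\<bar> ^ k \<le> 1 + \<bar>x\<bar> ^ m" for x :: real
    using assms(3) by (intro power_le_one_plus) auto
  have int1: "integrable M (\<lambda>\<omega>. 1 + \<bar>f \<omega>\<bar> ^ m)" using int by auto
  show *: "integrable M (\<lambda>\<omega>. \<bar>f \<omega>\<bar> ^ k)"
    by (rule Bochner_Integration.integrable_bound[OF int1]) (use le in \<open>auto intro!: AE_I2\<close>)
  show "integrable M (\<lambda>\<omega>. f \<omega> ^ k)"
    by (rule Bochner_Integration.integrable_bound[OF *]) (auto simp: power_abs)
  have "expectation (\<lambda>\<omega>. \<bar>f \<omega>\<bar> ^ k) \<le> expectation (\<lambda>\<omega>. 1 + \<bar>f \<omega>\<bar> ^ m)"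
    by (intro integral_mono * int1 le)
  also have "\<dots> = 1 + expectation (\<lambda>\<omega>. \<bar>f \<omega>\<bar> ^ m)"
    using int by (simp add: prob_space)
  finally show "expectation (\<lambda>\<omega>. \<bar>f \<omega>\<bar> ^ k) \<le> 1 + expectation (\<lambda>\<omega>. \<bar>f \<omega>\<bar> ^ m)" .
qed

fun moment_const :: "real \<Rightarrow> nat \<Rightarrow> real" where
  "moment_const B 0 = 1"
| "moment_const B (Suc j) = 2 ^ (2 * j + 2) * B * (moment_const B j + 1)"

lemma moment_const_nonneg: "0 \<le> B \<Longrightarrow> 0 \<le> moment_const B j"
  by (induction j) auto

locale independent_centred = prob_space M for M :: "'a measure" +
  fixes Y :: "nat \<Rightarrow> 'a \<Rightarrow> real" and b :: real
  assumes indep: "indep_vars (\<lambda>_. borel) Y {1..}"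
    and mean: "\<And>k. 1 \<le> k \<Longrightarrow> expectation (Y k) = 0"
    and integrable8: "\<And>k. 1 \<le> k \<Longrightarrow> integrable M (\<lambda>\<omega>. \<bar>Y k \<omega>\<bar> ^ 8)"
    and moment8: "\<And>k. 1 \<le> k \<Longrightarrow> expectation (\<lambda>\<omega>. \<bar>Y k \<omega>\<bar> ^ 8) \<le> b"
begin

lemma Y_borel [measurable]: "1 \<le> k \<Longrightarrow> Y k \<in> borel_measurable M"
  using indep by (auto simp: indep_vars_def)

definition S :: "nat \<Rightarrow> 'a \<Rightarrow> real" where "S n \<omega> = (\<Sum>k=1..n. Y k \<omega>)"

lemma S_Suc: "S (Suc n) \<omega> = S n \<omega> + Y (Suc n) \<omega>"
  by (simp add: S_def)

lemma S_borel [measurable]: "S n \<in> borel_measurable M"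
  unfolding S_def[abs_def] by (intro borel_measurable_sum Y_borel) auto

lemma b_nonneg: "0 \<le> b"
proof -
  have "0 \<le> expectation (\<lambda>\<omega>. \<bar>Y 1 \<omega>\<bar> ^ 8)"
    by (intro Bochner_Integration.integral_nonneg) auto
  also have "\<dots> \<le> b" by (rule moment8) auto
  finally show ?thesis .
qed

lemma Y_integrable: "1 \<le> k \<Longrightarrow> i \<le> 8 \<Longrightarrow> integrable M (\<lambda>\<omega>. Y k \<omega> ^ i)"
  by (intro integrable_power_le(2)[OF _ integrable8] Y_borel) auto

lemma Y_moment:
  assumes "1 \<le> k" "i \<le> 8" "even i"
  shows "expectation (\<lambda>\<omega>. Y k \<omega> ^ i) \<le> 1 + b"
proof -
  have "expectation (\<lambda>\<omega>. \<bar>Y k \<omega>\<bar> ^ i) \<le> 1 + expectation (\<lambda>\<omega>. \<bar>Y k \<omega>\<bar> ^ 8)"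
    using assms by (intro integrable_power_le(3) integrable8 Y_borel) auto
  then show ?thesis using assms moment8[of k] by (simp add: power_even_abs)
qed

lemma S_integrable8: "integrable M (\<lambda>\<omega>. \<bar>S n \<omega>\<bar> ^ 8)"
proof (induction n)
  case 0
  then show ?case by (simp add: S_def)
next
  case (Suc n)
  have "integrable M (\<lambda>\<omega>. 2 ^ 8 * (\<bar>S n \<omega>\<bar> ^ 8 + \<bar>Y (Suc n) \<omega>\<bar> ^ 8))"
    using Suc integrable8[of "Suc n"] by (intro integrable_mult_right Bochner_Integration.integrable_add) auto
  then show ?case
    by (rule Bochner_Integration.integrable_bound)
      (use abs_power_add_le[of "S n _" "Y (Suc n) _" 8] in \<open>auto simp: S_Suc\<close>)
qed

lemma S_integrable: "i \<le> 8 \<Longrightarrow> integrable M (\<lambda>\<omega>. S n \<omega> ^ i)"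
  by (intro integrable_power_le(2)[OF _ S_integrable8]) auto

lemma indep_Y_S: "indep_var borel (Y (Suc n)) borel (S n)"
proof -
  have "indep_vars (\<lambda>_. borel) Y (insert (Suc n) {1..n})"
    using indep by (rule indep_vars_subset) auto
  then show ?thesis unfolding S_def[abs_def] by (intro indep_vars_sum) auto
qed

lemma product_moment:
  assumes "i \<le> 8" "j \<le> 8"
  shows "expectation (\<lambda>\<omega>. S n \<omega> ^ i * Y (Suc n) \<omega> ^ j)
       = expectation (\<lambda>\<omega>. S n \<omega> ^ i) * expectation (\<lambda>\<omega>. Y (Suc n) \<omega> ^ j)"
    "integrable M (\<lambda>\<omega>. S n \<omega> ^ i * Y (Suc n) \<omega> ^ j)"
proof -
  have "indep_var borel ((\<lambda>x. x ^ j) \<circ> Y (Suc n)) borel ((\<lambda>x. x ^ i) \<circ> S n)"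
    by (intro indep_var_compose[OF indep_Y_S]) auto
  then have ind: "indep_var borel (\<lambda>\<omega>. Y (Suc n) \<omega> ^ j) borel (\<lambda>\<omega>. S n \<omega> ^ i)"
    by (simp add: comp_def)
  show "expectation (\<lambda>\<omega>. S n \<omega> ^ i * Y (Suc n) \<omega> ^ j)
       = expectation (\<lambda>\<omega>. S n \<omega> ^ i) * expectation (\<lambda>\<omega>. Y (Suc n) \<omega> ^ j)"
    using assms indep_var_lebesgue_integral[OF ind Y_integrable S_integrable] by (simp add: mult.commute)
  show "integrable M (\<lambda>\<omega>. S n \<omega> ^ i * Y (Suc n) \<omega> ^ j)"
    using assms indep_var_integrable[OF ind Y_integrable S_integrable] by (simp add: mult.commute)
qed

text \<open>The increment of the moment of order \<open>2j + 2\<close> at step \<open>n + 1\<close> is of order \<open>(n + 1)\<^sup>j\<close> by the bound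
  for \<open>2j\<close>; summing the increments gives \<open>n\<^bsup>j+1\<^esup>\<close>.\<close>

theorem even_moment_bound:
  assumes "j \<le> 4"
  shows "expectation (\<lambda>\<omega>. S n \<omega> ^ (2 * j)) \<le> moment_const (1 + b) j * real n ^ j"
  using assms
proof (induction j arbitrary: n)
  case 0
  then show ?case by (simp add: prob_space)
next
  case (Suc j)
  define K N where "K = moment_const (1 + b) j" and "N = 2 * j + 2"
  have K: "0 \<le> K" unfolding K_def using b_nonneg by (intro moment_const_nonneg) auto
  have N: "even N" "2 \<le> N" "N \<le> 8" "N - 2 = 2 * j" "even (N - 2)" using Suc.prems by (auto simp: N_def)
  have step: "expectation (\<lambda>\<omega>. S (Suc n) \<omega> ^ N) \<le> expectation (\<lambda>\<omega>. S n \<omega> ^ N)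
      + 2 ^ N * (1 + b) * (K + 1) * real (Suc n) ^ j" for n
  proof -
    note PM = product_moment[where n = n]
    have i1: "integrable M (\<lambda>\<omega>. S n \<omega> ^ (N - 1) * Y (Suc n) \<omega>)"
      using PM(2)[of "N - 1" 1] N by simp
    have i2: "integrable M (\<lambda>\<omega>. S n \<omega> ^ (N - 2) * (Y (Suc n) \<omega>)\<^sup>2)"
      using PM(2)[of "N - 2" 2] N by simp
    have i3: "integrable M (\<lambda>\<omega>. S n \<omega> ^ N)" "integrable M (\<lambda>\<omega>. Y (Suc n) \<omega> ^ N)"
      using S_integrable Y_integrable N by auto
    have "expectation (\<lambda>\<omega>. S (Suc n) \<omega> ^ N)
        \<le> expectation (\<lambda>\<omega>. S n \<omega> ^ N + real N * (S n \<omega> ^ (N - 1) * Y (Suc n) \<omega>)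
            + 2 ^ N * (S n \<omega> ^ (N - 2) * (Y (Suc n) \<omega>)\<^sup>2 + Y (Suc n) \<omega> ^ N))"
      unfolding S_Suc using N(1,2,3) S_integrable[of N "Suc n"] i1 i2 i3
      by (intro integral_mono even_power_add_le) (auto simp: S_Suc)
    also have "\<dots> = expectation (\<lambda>\<omega>. S n \<omega> ^ N) + real N * expectation (\<lambda>\<omega>. S n \<omega> ^ (N - 1) * Y (Suc n) \<omega>)
        + 2 ^ N * (expectation (\<lambda>\<omega>. S n \<omega> ^ (N - 2) * (Y (Suc n) \<omega>)\<^sup>2) + expectation (\<lambda>\<omega>. Y (Suc n) \<omega> ^ N))"
      using i1 i2 i3 by simp
    also have "expectation (\<lambda>\<omega>. S n \<omega> ^ (N - 1) * Y (Suc n) \<omega>) = 0"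
      using PM(1)[of "N - 1" 1] N mean[of "Suc n"] by simp
    also have "expectation (\<lambda>\<omega>. S n \<omega> ^ (N - 2) * (Y (Suc n) \<omega>)\<^sup>2)
        = expectation (\<lambda>\<omega>. S n \<omega> ^ (N - 2)) * expectation (\<lambda>\<omega>. (Y (Suc n) \<omega>)\<^sup>2)"
      using PM(1)[of "N - 2" 2] N by simp
    also have "\<dots> \<le> (K * real (Suc n) ^ j) * (1 + b)"
    proof (intro mult_mono)
      have "expectation (\<lambda>\<omega>. S n \<omega> ^ (N - 2)) \<le> K * real n ^ j"
        using Suc.IH[of n] Suc.prems by (simp add: N(4) K_def)
      also have "\<dots> \<le> K * real (Suc n) ^ j" using K by (intro mult_left_mono power_mono) auto
      finally show "expectation (\<lambda>\<omega>. S n \<omega> ^ (N - 2)) \<le> K * real (Suc n) ^ j" .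
      show "expectation (\<lambda>\<omega>. (Y (Suc n) \<omega>)\<^sup>2) \<le> 1 + b" by (intro Y_moment) auto
      show "0 \<le> expectation (\<lambda>\<omega>. (Y (Suc n) \<omega>)\<^sup>2)"
        by (intro Bochner_Integration.integral_nonneg) auto
    qed (use K in auto)
    also have "expectation (\<lambda>\<omega>. Y (Suc n) \<omega> ^ N) \<le> real (Suc n) ^ j * (1 + b)"
    proof -
      have "expectation (\<lambda>\<omega>. Y (Suc n) \<omega> ^ N) \<le> 1 * (1 + b)" using N Y_moment[of "Suc n" N] by simp
      also have "\<dots> \<le> real (Suc n) ^ j * (1 + b)"
        using b_nonneg by (intro mult_right_mono) auto
      finally show ?thesis .
    qed
    finally show ?thesis by (simp add: algebra_simps)
  qed
  have "expectation (\<lambda>\<omega>. S n \<omega> ^ N) \<le> 2 ^ N * (1 + b) * (K + 1) * real n ^ Suc j"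
  proof (induction n)
    case 0
    then show ?case using N by (simp add: S_def zero_power)
  next
    case (Suc n)
    have "real n ^ j * real n \<le> real (Suc n) ^ j * real n"
      by (intro mult_right_mono power_mono) auto
    then have "real n ^ Suc j + real (Suc n) ^ j \<le> real (Suc n) ^ Suc j"
      by (simp add: algebra_simps)
    then have "2 ^ N * (1 + b) * (K + 1) * (real n ^ Suc j + real (Suc n) ^ j)
        \<le> 2 ^ N * (1 + b) * (K + 1) * real (Suc n) ^ Suc j"
      using K b_nonneg by (intro mult_left_mono) auto
    with step[of n] Suc show ?case by (simp add: distrib_left)
  qed
  then show ?case by (simp add: N_def K_def)
qed

lemma second_moment:
  assumes "\<And>k. 1 \<le> k \<Longrightarrow> expectation (\<lambda>\<omega>. (Y k \<omega>)\<^sup>2) = v"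
  shows "expectation (\<lambda>\<omega>. (S n \<omega>)\<^sup>2) = v * real n"
proof (induction n)
  case 0
  then show ?case by (simp add: S_def)
next
  case (Suc n)
  have "expectation (\<lambda>\<omega>. (S (Suc n) \<omega>)\<^sup>2)
      = expectation (\<lambda>\<omega>. (S n \<omega>)\<^sup>2 + (Y (Suc n) \<omega>)\<^sup>2 + 2 * (S n \<omega> ^ 1 * Y (Suc n) \<omega> ^ 1))"
    by (simp add: S_Suc power2_sum algebra_simps)
  also have "\<dots> = expectation (\<lambda>\<omega>. (S n \<omega>)\<^sup>2) + expectation (\<lambda>\<omega>. (Y (Suc n) \<omega>)\<^sup>2)
      + 2 * expectation (\<lambda>\<omega>. S n \<omega> ^ 1 * Y (Suc n) \<omega> ^ 1)"
    using S_integrable[of 2 n] Y_integrable[of "Suc n" 2] product_moment(2)[of 1 1 n] by simp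
  also have "expectation (\<lambda>\<omega>. S n \<omega> ^ 1 * Y (Suc n) \<omega> ^ 1) = 0"
    using mean[of "Suc n"] by (subst product_moment(1)) auto
  finally show ?case using Suc assms[of "Suc n"] by (simp add: algebra_simps)
qed

end

section \<open>Integration by parts for the sum\<close>

lemma (in prob_space) expectation_indep_pair:
  fixes f :: "'b \<times> 'b \<Rightarrow> real"
  assumes ind: "indep_var N1 X N2 Y" and f [measurable]: "f \<in> borel_measurable (N1 \<Otimes>\<^sub>M N2)"
    and int: "integrable M (\<lambda>\<omega>. f (X \<omega>, Y \<omega>))"
  shows "expectation (\<lambda>\<omega>. f (X \<omega>, Y \<omega>)) = (LINT y|distr M N2 Y. expectation (\<lambda>\<omega>. f (X \<omega>, y)))"
proof -
  have X [measurable]: "X \<in> measurable M N1" and Y [measurable]: "Y \<in> measurable M N2"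
    and eq: "distr M N1 X \<Otimes>\<^sub>M distr M N2 Y = distr M (N1 \<Otimes>\<^sub>M N2) (\<lambda>x. (X x, Y x))"
    using ind unfolding indep_var_distribution_eq by auto
  interpret A: prob_space "distr M N1 X" by (rule prob_space_distr) simp
  interpret B: prob_space "distr M N2 Y" by (rule prob_space_distr) simp
  interpret P: pair_sigma_finite "distr M N1 X" "distr M N2 Y" ..
  have "integrable (distr M N1 X \<Otimes>\<^sub>M distr M N2 Y) (\<lambda>(x, y). f (x, y))"
    unfolding eq using int by (subst integrable_distr_eq) auto
  from P.integral_snd[OF this]
  have "(LINT y|distr M N2 Y. LINT x|distr M N1 X. f (x, y))
      = integral\<^sup>L (distr M N1 X \<Otimes>\<^sub>M distr M N2 Y) f" by simp
  also have "\<dots> = expectation (\<lambda>\<omega>. f (X \<omega>, Y \<omega>))"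
    unfolding eq by (subst integral_distr) auto
  finally have "expectation (\<lambda>\<omega>. f (X \<omega>, Y \<omega>)) = (LINT y|distr M N2 Y. LINT x|distr M N1 X. f (x, y))"
    by simp
  also have "\<dots> = (LINT y|distr M N2 Y. expectation (\<lambda>\<omega>. f (X \<omega>, y)))"
    by (intro Bochner_Integration.integral_cong refl integral_distr) auto
  finally show ?thesis .
qed

context stein_density
begin

abbreviation (input) "\<tau> \<equiv> stein_kernel p"

text \<open>\<open>W\<close> carries what the other coordinates contribute to \<open>S\<close> and to \<open>T\<close>. Since it is independent of \<open>X\<close>,
  the Stein identity may be applied with \<open>W\<close> frozen, to \<open>g x = a(x + w\<^sub>1) / (\<tau> x + w\<^sub>2 + e)\<close>. The
  summand \<open>e\<close> keeps the denominator away from \<open>0\<close>, which the kernel may approach at the ends of the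
  support. The variable \<open>X\<close> is padded with a \<open>0\<close> because both arguments of \<open>indep_var\<close> take values
  in the same type.\<close>

lemma
  fixes W :: "'a \<Rightarrow> real \<times> real" and a a' :: "real \<Rightarrow> real"
  assumes ind: "indep_var (borel \<Otimes>\<^sub>M borel) (\<lambda>\<omega>. (X \<omega>, 0)) (borel \<Otimes>\<^sub>M borel) W" and W: "\<And>\<omega>. 0 \<le> snd (W \<omega>)"
    and sq: "integrable M (\<lambda>\<omega>. (X \<omega>)\<^sup>2)" "integrable M (\<lambda>\<omega>. (\<tau> (X \<omega>))\<^sup>2)"
      "integrable M (\<lambda>\<omega>. (deriv \<tau> (X \<omega>))\<^sup>2)"
    and a: "\<And>x. (a has_real_derivative a' x) (at x)" "a' \<in> borel_measurable borel"
      "\<And>x. \<bar>a x\<bar> \<le> K" "\<And>x. \<bar>a' x\<bar> \<le> K"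
    and e: "0 < e"
  shows stein_identity_regularised: "expectation (\<lambda>\<omega>. X \<omega> * (a (X \<omega> + fst (W \<omega>)) / (\<tau> (X \<omega>) + snd (W \<omega>) + e)))
       = expectation (\<lambda>\<omega>. \<tau> (X \<omega>) * (a' (X \<omega> + fst (W \<omega>)) / (\<tau> (X \<omega>) + snd (W \<omega>) + e)
           - deriv \<tau> (X \<omega>) * a (X \<omega> + fst (W \<omega>)) / (\<tau> (X \<omega>) + snd (W \<omega>) + e)\<^sup>2))"
    and integrable_stein_regularised:
      "integrable M (\<lambda>\<omega>. X \<omega> * (a (X \<omega> + fst (W \<omega>)) / (\<tau> (X \<omega>) + snd (W \<omega>) + e)))"
      "integrable M (\<lambda>\<omega>. \<tau> (X \<omega>) * (a' (X \<omega> + fst (W \<omega>)) / (\<tau> (X \<omega>) + snd (W \<omega>) + e)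
           - deriv \<tau> (X \<omega>) * a (X \<omega> + fst (W \<omega>)) / (\<tau> (X \<omega>) + snd (W \<omega>) + e)\<^sup>2))"
proof -
  note [measurable] = a(2)
  have [measurable]: "a \<in> borel_measurable borel"
    using DERIV_isCont[OF a(1)]
    by (intro borel_measurable_continuous_onI continuous_at_imp_continuous_on) auto
  have [measurable]: "W \<in> measurable M (borel \<Otimes>\<^sub>M borel)"
    using ind unfolding indep_var_distribution_eq by auto
  \<comment> \<open>The absolute value makes d at least e for every y, not only for the values that W takes.\<close>
  define d where "d = (\<lambda>x (y::real \<times> real). \<tau> x + \<bar>snd y\<bar> + e)"
  define g where "g = (\<lambda>y x. a (x + fst y) / d x y)"
  define g' where "g' = (\<lambda>y x. a' (x + fst y) / d x y - deriv \<tau> x * a (x + fst y) / (d x y)\<^sup>2)"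
  have d_ge: "e \<le> d x y" for x y using stein_kernel_nonneg[of x] by (simp add: d_def)
  have K: "0 \<le> K" using a(3)[of 0] by simp
  have g_bound: "\<bar>g y x\<bar> \<le> K / e" for y x
    unfolding g_def abs_divide using d_ge[of x y] e a(3) K by (intro frac_le) auto
  have g'_bound: "\<bar>g' y x\<bar> \<le> K / e + K / e\<^sup>2 * \<bar>deriv \<tau> x\<bar>" for y x
  proof -
    have "\<bar>a' (x + fst y) / d x y\<bar> \<le> K / e"
      unfolding abs_divide using d_ge[of x y] e a(4) K by (intro frac_le) auto
    moreover have "\<bar>deriv \<tau> x * a (x + fst y) / (d x y)\<^sup>2\<bar> \<le> (\<bar>deriv \<tau> x\<bar> * K) / e\<^sup>2"
      unfolding abs_divide abs_mult using d_ge[of x y] e a(3) K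
      by (intro frac_le mult_left_mono) (auto intro: power_mono)
    ultimately have "\<bar>g' y x\<bar> \<le> K / e + (\<bar>deriv \<tau> x\<bar> * K) / e\<^sup>2"
      unfolding g'_def by (intro order_trans[OF abs_triangle_ineq4 add_mono])
    then show ?thesis by (simp add: mult.commute)
  qed
  define f1 f2 where "f1 = (\<lambda>(x :: real \<times> real, y). fst x * g y (fst x))"
    and "f2 = (\<lambda>(x :: real \<times> real, y). \<tau> (fst x) * g' y (fst x))"
  have f_meas [measurable]: "f1 \<in> borel_measurable ((borel \<Otimes>\<^sub>M borel) \<Otimes>\<^sub>M (borel \<Otimes>\<^sub>M borel))"
      "f2 \<in> borel_measurable ((borel \<Otimes>\<^sub>M borel) \<Otimes>\<^sub>M (borel \<Otimes>\<^sub>M borel))"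
    unfolding f1_def f2_def g_def g'_def d_def by measurable
  have g_meas [measurable]: "g y \<in> borel_measurable borel" "g' y \<in> borel_measurable borel" for y
    unfolding g_def g'_def d_def by measurable
  have int_tau: "integrable M (\<lambda>\<omega>. \<tau> (X \<omega>))"
    using integrable_power_le(2)[of "\<lambda>\<omega>. \<tau> (X \<omega>)" 2 1] sq(2) by simp
  have int1: "integrable M (\<lambda>\<omega>. f1 ((X \<omega>, 0), Y \<omega>))" if [measurable]: "Y \<in> measurable M (borel \<Otimes>\<^sub>M borel)" for Y
  proof (rule Bochner_Integration.integrable_bound)
    show "integrable M (\<lambda>\<omega>. \<bar>X \<omega>\<bar> * (K / e))" using integrable_X by auto
    show "AE \<omega> in M. norm (f1 ((X \<omega>, 0), Y \<omega>)) \<le> norm (\<bar>X \<omega>\<bar> * (K / e))"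
    proof (rule AE_I2)
      fix \<omega>
      have "\<bar>X \<omega>\<bar> * \<bar>g (Y \<omega>) (X \<omega>)\<bar> \<le> \<bar>X \<omega>\<bar> * (K / e)"
        by (intro mult_left_mono g_bound) auto
      then show "norm (f1 ((X \<omega>, 0), Y \<omega>)) \<le> norm (\<bar>X \<omega>\<bar> * (K / e))"
        using K e by (simp add: f1_def abs_mult)
    qed
  qed measurable
  have int2: "integrable M (\<lambda>\<omega>. f2 ((X \<omega>, 0), Y \<omega>))" if [measurable]: "Y \<in> measurable M (borel \<Otimes>\<^sub>M borel)" for Y
  proof (rule Bochner_Integration.integrable_bound)
    show "integrable M (\<lambda>\<omega>. K / e * \<tau> (X \<omega>) + K / e\<^sup>2 * ((\<tau> (X \<omega>))\<^sup>2 + (deriv \<tau> (X \<omega>))\<^sup>2))"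
      using sq int_tau by auto
    show "AE \<omega> in M. norm (f2 ((X \<omega>, 0), Y \<omega>))
        \<le> norm (K / e * \<tau> (X \<omega>) + K / e\<^sup>2 * ((\<tau> (X \<omega>))\<^sup>2 + (deriv \<tau> (X \<omega>))\<^sup>2))"
    proof (rule AE_I2)
      fix \<omega>
      define s r where "s = \<tau> (X \<omega>)" and "r = \<bar>deriv \<tau> (X \<omega>)\<bar>"
      have s: "0 \<le> s" by (simp add: s_def stein_kernel_nonneg)
      have "norm (f2 ((X \<omega>, 0), Y \<omega>)) = s * \<bar>g' (Y \<omega>) (X \<omega>)\<bar>"
        using s by (simp add: f2_def s_def abs_mult)
      also have "\<dots> \<le> s * (K / e + K / e\<^sup>2 * r)"
        using s g'_bound by (intro mult_left_mono) (auto simp: r_def)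
      also have "\<dots> = K / e * s + K / e\<^sup>2 * (s * r)" by (simp add: algebra_simps)
      also have "\<dots> \<le> K / e * s + K / e\<^sup>2 * (s\<^sup>2 + r\<^sup>2)"
      proof -
        show ?thesis using K e by (intro add_left_mono mult_left_mono mult_le_sum_squares) auto
      qed
      also have "\<dots> \<le> norm \<dots>" by simp
      finally show "norm (f2 ((X \<omega>, 0), Y \<omega>))
        \<le> norm (K / e * \<tau> (X \<omega>) + K / e\<^sup>2 * ((\<tau> (X \<omega>))\<^sup>2 + (deriv \<tau> (X \<omega>))\<^sup>2))"
        by (simp add: s_def r_def)
    qed
  qed measurable
  have inner: "expectation (\<lambda>\<omega>. f1 ((X \<omega>, 0), y)) = expectation (\<lambda>\<omega>. f2 ((X \<omega>, 0), y))" for y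
    unfolding f1_def f2_def prod.case fst_conv
  proof (rule stein_identity)
    fix x assume x: "x \<in> supp_int"
    show "\<bar>g y x\<bar> \<le> K / e * (1 + \<bar>x\<bar>)"
    proof -
      have "K / e * 1 \<le> K / e * (1 + \<bar>x\<bar>)" using K e by (intro mult_left_mono) auto
      then show ?thesis using g_bound[of y x] by simp
    qed
    have "d x y \<noteq> 0" using d_ge[of x y] e by simp
    have da: "((\<lambda>x. a (x + fst y)) has_real_derivative a' (x + fst y) * 1) (at x)"
      by (rule DERIV_chain2[OF a(1)]) (auto intro!: derivative_eq_intros)
    have dd: "((\<lambda>x. d x y) has_real_derivative deriv \<tau> x) (at x)"
      unfolding d_def using stein_kernel_deriv[OF x] by (auto intro!: derivative_eq_intros)
    have "(g y has_real_derivative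
        (a' (x + fst y) * 1 * d x y - a (x + fst y) * deriv \<tau> x) / (d x y * d x y)) (at x)"
      unfolding g_def by (rule DERIV_divide[OF da dd \<open>d x y \<noteq> 0\<close>])
    also have "(a' (x + fst y) * 1 * d x y - a (x + fst y) * deriv \<tau> x) / (d x y * d x y) = g' y x"
      using \<open>d x y \<noteq> 0\<close> by (simp add: g'_def field_simps power2_eq_square)
    finally show "(g y has_real_derivative g' y x) (at x)" .
  next
    show "integrable M (\<lambda>\<omega>. \<tau> (X \<omega>) * g' y (X \<omega>))"
      using int2[of "\<lambda>_. y"] by (simp add: f2_def space_pair_measure)
  qed (use sq in auto)
  have "expectation (\<lambda>\<omega>. f1 ((X \<omega>, 0), W \<omega>)) = (LINT y|distr M (borel \<Otimes>\<^sub>M borel) W. expectation (\<lambda>\<omega>. f1 ((X \<omega>, 0), y)))"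
    by (intro expectation_indep_pair[OF ind] int1) auto
  also have "\<dots> = (LINT y|distr M (borel \<Otimes>\<^sub>M borel) W. expectation (\<lambda>\<omega>. f2 ((X \<omega>, 0), y)))"
    by (simp add: inner)
  also have "\<dots> = expectation (\<lambda>\<omega>. f2 ((X \<omega>, 0), W \<omega>))"
    by (intro expectation_indep_pair[OF ind, symmetric] int2) auto
  finally have "expectation (\<lambda>\<omega>. f1 ((X \<omega>, 0), W \<omega>)) = expectation (\<lambda>\<omega>. f2 ((X \<omega>, 0), W \<omega>))" .
  then show "expectation (\<lambda>\<omega>. X \<omega> * (a (X \<omega> + fst (W \<omega>)) / (\<tau> (X \<omega>) + snd (W \<omega>) + e)))
       = expectation (\<lambda>\<omega>. \<tau> (X \<omega>) * (a' (X \<omega> + fst (W \<omega>)) / (\<tau> (X \<omega>) + snd (W \<omega>) + e)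
           - deriv \<tau> (X \<omega>) * a (X \<omega> + fst (W \<omega>)) / (\<tau> (X \<omega>) + snd (W \<omega>) + e)\<^sup>2))"
    using W by (simp add: f1_def f2_def g_def g'_def d_def)
  show "integrable M (\<lambda>\<omega>. X \<omega> * (a (X \<omega> + fst (W \<omega>)) / (\<tau> (X \<omega>) + snd (W \<omega>) + e)))"
    using int1[of W] W by (simp add: f1_def g_def d_def)
  show "integrable M (\<lambda>\<omega>. \<tau> (X \<omega>) * (a' (X \<omega> + fst (W \<omega>)) / (\<tau> (X \<omega>) + snd (W \<omega>) + e)
           - deriv \<tau> (X \<omega>) * a (X \<omega> + fst (W \<omega>)) / (\<tau> (X \<omega>) + snd (W \<omega>) + e)\<^sup>2))"
    using int2[of W] W by (simp add: f2_def g'_def d_def)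
qed

end

locale stein_sequence = prob_space M for M :: "'a measure" +
  fixes X :: "nat \<Rightarrow> 'a \<Rightarrow> real" and p :: "nat \<Rightarrow> real \<Rightarrow> real" and b :: real
  assumes indep: "indep_vars (\<lambda>_. borel) X {1..}"
    and density: "\<And>k. 1 \<le> k \<Longrightarrow> stein_density M (X k) (p k)"
    and variance_1: "\<And>k. 1 \<le> k \<Longrightarrow> expectation (\<lambda>\<omega>. (X k \<omega>)\<^sup>2) = 1"
    and X_int: "\<And>k. 1 \<le> k \<Longrightarrow> integrable M (\<lambda>\<omega>. \<bar>X k \<omega>\<bar> ^ 8)"
    and X_moment: "\<And>k. 1 \<le> k \<Longrightarrow> expectation (\<lambda>\<omega>. \<bar>X k \<omega>\<bar> ^ 8) \<le> b"
    and kernel_int: "\<And>k. 1 \<le> k \<Longrightarrow> integrable M (\<lambda>\<omega>. \<bar>stein_kernel (p k) (X k \<omega>)\<bar> ^ 8)"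
    and kernel_moment: "\<And>k. 1 \<le> k \<Longrightarrow> expectation (\<lambda>\<omega>. \<bar>stein_kernel (p k) (X k \<omega>)\<bar> ^ 8) \<le> b"
    and kernel'_int: "\<And>k. 1 \<le> k \<Longrightarrow> integrable M (\<lambda>\<omega>. \<bar>deriv (stein_kernel (p k)) (X k \<omega>)\<bar> ^ 8)"
    and kernel'_moment: "\<And>k. 1 \<le> k \<Longrightarrow> expectation (\<lambda>\<omega>. \<bar>deriv (stein_kernel (p k)) (X k \<omega>)\<bar> ^ 8) \<le> b"
begin

abbreviation t :: "nat \<Rightarrow> 'a \<Rightarrow> real" where "t k \<omega> \<equiv> stein_kernel (p k) (X k \<omega>)"
abbreviation t' :: "nat \<Rightarrow> 'a \<Rightarrow> real" where "t' k \<omega> \<equiv> deriv (stein_kernel (p k)) (X k \<omega>)"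
abbreviation T :: "nat \<Rightarrow> 'a \<Rightarrow> real" where "T \<equiv> stein_kernel_sum X p"
text \<open>This is \<open>\<Sum> \<tau>\<^sub>k \<partial>\<^sub>k T\<close>, which appears when the denominator \<open>T\<close> is differentiated.\<close>

definition Q :: "nat \<Rightarrow> 'a \<Rightarrow> real" where "Q n \<omega> = (\<Sum>k=1..n. t k \<omega> * t' k \<omega>)"

lemma X_borel [measurable]: "1 \<le> k \<Longrightarrow> X k \<in> borel_measurable M"
  using indep by (auto simp: indep_vars_def)

lemma kernel_borel [measurable]: "1 \<le> k \<Longrightarrow> stein_kernel (p k) \<in> borel_measurable borel"
  by (rule stein_density.stein_kernel_borel[OF density])

lemma t_borel [measurable]: "1 \<le> k \<Longrightarrow> t k \<in> borel_measurable M"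
  using measurable_compose[OF X_borel kernel_borel] by simp

lemma t'_borel [measurable]: "1 \<le> k \<Longrightarrow> t' k \<in> borel_measurable M"
  using measurable_compose[OF X_borel stein_density.deriv_stein_kernel_borel[OF density]] by simp

lemma t_nonneg: "1 \<le> k \<Longrightarrow> 0 \<le> t k \<omega>"
  by (rule stein_density.stein_kernel_nonneg[OF density])

lemma T_borel [measurable]: "T n \<in> borel_measurable M"
  unfolding stein_kernel_sum_def[abs_def] by (intro borel_measurable_sum t_borel) auto

lemma Q_borel [measurable]: "Q n \<in> borel_measurable M"
  unfolding Q_def[abs_def] by (intro borel_measurable_sum borel_measurable_times t_borel t'_borel) auto

lemma T_nonneg: "0 \<le> T n \<omega>"
  unfolding stein_kernel_sum_def by (intro sum_nonneg t_nonneg) auto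

sublocale IX: independent_centred M X b
proof
  show "expectation (X k) = 0" if "1 \<le> k" for k
    by (rule stein_density.mean_X[OF density[OF that]])
qed (use indep X_int X_moment in auto)

lemma mean_kernel: assumes k: "1 \<le> k" shows "expectation (t k) = 1"
proof -
  interpret D: stein_density M "X k" "p k" by (rule density[OF k])
  have "expectation (\<lambda>\<omega>. X k \<omega> * X k \<omega>) = expectation (\<lambda>\<omega>. t k \<omega> * 1)"
  proof (rule D.stein_identity)
    show "integrable M (\<lambda>\<omega>. (X k \<omega>)\<^sup>2)" using k by (intro IX.Y_integrable) auto
    show "integrable M (\<lambda>\<omega>. t k \<omega> * 1)"
      using integrable_power_le(2)[of "t k" 8 1] kernel_int[OF k] t_borel[OF k] by simp
    show "\<bar>x\<bar> \<le> 1 * (1 + \<bar>x\<bar>)" for x :: real by simp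
  qed auto
  then show ?thesis using variance_1[OF k] by (simp add: power2_eq_square)
qed

lemma t_integrable: "1 \<le> k \<Longrightarrow> i \<le> 8 \<Longrightarrow> integrable M (\<lambda>\<omega>. t k \<omega> ^ i)"
  by (intro integrable_power_le(2)[OF _ kernel_int] t_borel) auto

lemma t'_integrable: "1 \<le> k \<Longrightarrow> i \<le> 8 \<Longrightarrow> integrable M (\<lambda>\<omega>. t' k \<omega> ^ i)"
  by (intro integrable_power_le(2)[OF _ kernel'_int] t'_borel) auto

lemma indep_t: "indep_vars (\<lambda>_. borel) t {1..}"
  by (rule indep_vars_compose2[OF indep]) auto

sublocale IT: independent_centred M "\<lambda>k \<omega>. t k \<omega> - 1" "2 ^ 8 * (b + 1)"
proof
  show "indep_vars (\<lambda>_. borel) (\<lambda>k \<omega>. t k \<omega> - 1) {1..}"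
    by (rule indep_vars_compose2[OF indep_t]) auto
  fix k :: nat assume k: "1 \<le> k"
  show "expectation (\<lambda>\<omega>. t k \<omega> - 1) = 0"
    using t_integrable[OF k, of 1] mean_kernel[OF k] by (simp add: prob_space)
  have le: "\<bar>t k \<omega> - 1\<bar> ^ 8 \<le> 2 ^ 8 * (\<bar>t k \<omega>\<bar> ^ 8 + 1)" for \<omega>
    using abs_power_add_le[of "t k \<omega>" "-1" 8] by simp
  have int: "integrable M (\<lambda>\<omega>. 2 ^ 8 * (\<bar>t k \<omega>\<bar> ^ 8 + 1))"
    using kernel_int[OF k] by (intro integrable_mult_right Bochner_Integration.integrable_add) auto
  show int': "integrable M (\<lambda>\<omega>. \<bar>t k \<omega> - 1\<bar> ^ 8)"
  proof (rule Bochner_Integration.integrable_bound[OF int])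
    show "AE \<omega> in M. norm (\<bar>t k \<omega> - 1\<bar> ^ 8) \<le> norm (2 ^ 8 * (\<bar>t k \<omega>\<bar> ^ 8 + 1))"
      using le by (intro AE_I2) (auto intro: order_trans)
  qed (use t_borel[OF k] in auto)
  have "expectation (\<lambda>\<omega>. \<bar>t k \<omega> - 1\<bar> ^ 8) \<le> expectation (\<lambda>\<omega>. 2 ^ 8 * (\<bar>t k \<omega>\<bar> ^ 8 + 1))"
    by (intro integral_mono int int' le)
  also have "\<dots> = 2 ^ 8 * (expectation (\<lambda>\<omega>. \<bar>t k \<omega>\<bar> ^ 8) + 1)"
    using kernel_int[OF k] by (simp add: prob_space)
  also have "\<dots> \<le> 2 ^ 8 * (b + 1)"
    using kernel_moment[OF k] by simp
  finally show "expectation (\<lambda>\<omega>. \<bar>t k \<omega> - 1\<bar> ^ 8) \<le> 2 ^ 8 * (b + 1)" .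
qed

lemma IT_S: "IT.S n \<omega> = T n \<omega> - real n"
  by (simp add: IT.S_def stein_kernel_sum_def sum_subtractf)

lemma T_integrable: "integrable M (T n)" and mean_T: "expectation (T n) = real n"
proof -
  have int: "integrable M (t k)" if "k \<in> {1..n}" for k
    using t_integrable[of k 1] that by simp
  then show "integrable M (T n)"
    unfolding stein_kernel_sum_def[abs_def] by (intro Bochner_Integration.integrable_sum)
  show "expectation (T n) = real n"
    unfolding stein_kernel_sum_def[abs_def]
    by (subst Bochner_Integration.integral_sum) (use int mean_kernel in auto)
qed

text \<open>Convexity of the fourth power reduces the sum to its summands, and \<open>(\<tau> \<tau>')\<^sup>4 \<le> (\<tau>\<^sup>8 + \<tau>'\<^sup>8) / 2\<close>.
  A bound of order \<open>n\<close> for \<open>Q\<close> suffices, as it enters the score divided by \<open>T\<^sup>2\<close>.\<close>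

lemma Q_fourth_moment:
  "integrable M (\<lambda>\<omega>. Q n \<omega> ^ 4)" "expectation (\<lambda>\<omega>. Q n \<omega> ^ 4) \<le> b * real n ^ 4"
proof -
  define R where "R = (\<lambda>\<omega>. real n ^ 3 * (\<Sum>k=1..n. (\<bar>t k \<omega>\<bar> ^ 8 + \<bar>t' k \<omega>\<bar> ^ 8) / 2))"
  have le: "Q n \<omega> ^ 4 \<le> R \<omega>" for \<omega>
  proof (cases "n = 0")
    case False
    have "Q n \<omega> ^ 4 = real n ^ 4 * ((\<Sum>k=1..n. 1 / real n * (t k \<omega> * t' k \<omega>)) ^ 4)"
      using False by (simp add: Q_def power_divide flip: sum_distrib_left sum_divide_distrib)
    also have "\<dots> \<le> real n ^ 4 * (\<Sum>k=1..n. 1 / real n * (t k \<omega> * t' k \<omega>) ^ 4)"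
    proof (rule mult_left_mono)
      have "convex_on UNIV (\<lambda>x::real. x ^ 4)" by (rule convex_power_even) simp
      from convex_on_sum[OF _ _ this, of "{1..n}" "\<lambda>_. 1 / real n" "\<lambda>k. t k \<omega> * t' k \<omega>"]
      show "(\<Sum>k=1..n. 1 / real n * (t k \<omega> * t' k \<omega>)) ^ 4 \<le> (\<Sum>k=1..n. 1 / real n * (t k \<omega> * t' k \<omega>) ^ 4)"
        using False by simp
    qed simp
    also have "\<dots> = real n ^ 3 * (\<Sum>k=1..n. (t k \<omega> * t' k \<omega>) ^ 4)"
      using False by (simp add: power4_eq_xxxx power3_eq_cube flip: sum_divide_distrib)
    also have "\<dots> \<le> R \<omega>"
      unfolding R_def
    proof (intro mult_left_mono sum_mono)
      fix k
      have "2 * (t k \<omega> ^ 4) * (t' k \<omega> ^ 4) \<le> (t k \<omega> ^ 4)\<^sup>2 + (t' k \<omega> ^ 4)\<^sup>2"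
        by (rule sum_squares_bound)
      then show "(t k \<omega> * t' k \<omega>) ^ 4 \<le> (\<bar>t k \<omega>\<bar> ^ 8 + \<bar>t' k \<omega>\<bar> ^ 8) / 2"
        by (simp add: power_mult_distrib power_even_abs flip: power_mult)
    qed auto
    finally show ?thesis by simp
  qed (simp add: Q_def R_def)
  have int_k: "integrable M (\<lambda>\<omega>. (\<bar>t k \<omega>\<bar> ^ 8 + \<bar>t' k \<omega>\<bar> ^ 8) / 2)" if "k \<in> {1..n}" for k
    using kernel_int[of k] kernel'_int[of k] that by auto
  have int_R: "integrable M R"
    unfolding R_def by (intro integrable_mult_right Bochner_Integration.integrable_sum int_k)
  show *: "integrable M (\<lambda>\<omega>. Q n \<omega> ^ 4)"
    by (rule Bochner_Integration.integrable_bound[OF int_R]) (use le in \<open>auto intro!: AE_I2 order_trans[OF le]\<close>)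
  have "expectation (\<lambda>\<omega>. Q n \<omega> ^ 4) \<le> expectation R"
    by (intro integral_mono * int_R le)
  also have "\<dots> = real n ^ 3 * (\<Sum>k=1..n. expectation (\<lambda>\<omega>. (\<bar>t k \<omega>\<bar> ^ 8 + \<bar>t' k \<omega>\<bar> ^ 8) / 2))"
    unfolding R_def using int_k by (simp add: Bochner_Integration.integral_sum)
  also have "\<dots> \<le> real n ^ 3 * (\<Sum>k=1..n. b)"
  proof (intro mult_left_mono sum_mono)
    fix k assume "k \<in> {1..n}"
    then have k: "1 \<le> k" by simp
    show "expectation (\<lambda>\<omega>. (\<bar>t k \<omega>\<bar> ^ 8 + \<bar>t' k \<omega>\<bar> ^ 8) / 2) \<le> b"
      using kernel_int[OF k] kernel'_int[OF k] kernel_moment[OF k] kernel'_moment[OF k] by simp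
  qed auto
  also have "\<dots> = b * real n ^ 4" by (simp add: power4_eq_xxxx power3_eq_cube)
  finally show "expectation (\<lambda>\<omega>. Q n \<omega> ^ 4) \<le> b * real n ^ 4" .
qed


lemma indep_rest:
  assumes k: "k \<in> {1..n}"
  shows "indep_var (borel \<Otimes>\<^sub>M borel) (\<lambda>\<omega>. (X k \<omega>, 0 :: real)) (borel \<Otimes>\<^sub>M borel)
    (\<lambda>\<omega>. (\<Sum>j\<in>{1..n} - {k}. X j \<omega>, \<Sum>j\<in>{1..n} - {k}. t j \<omega>))"
proof -
  define R where "R = {1..n} - {k}"
  have "indep_var (PiM {k} (\<lambda>_. borel)) (\<lambda>\<omega>. restrict (\<lambda>i. X i \<omega>) {k})
      (PiM R (\<lambda>_. borel)) (\<lambda>\<omega>. restrict (\<lambda>i. X i \<omega>) R)"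
    using k by (intro indep_var_restrict[OF indep]) (auto simp: R_def)
  moreover have "(\<lambda>f. (f k, 0 :: real)) \<in> measurable (PiM {k} (\<lambda>_. borel)) (borel \<Otimes>\<^sub>M borel)"
    by (intro measurable_Pair measurable_const measurable_component_singleton) auto
  moreover have "(\<lambda>f. (\<Sum>j\<in>R. f j, \<Sum>j\<in>R. stein_kernel (p j) (f j)))
      \<in> measurable (PiM R (\<lambda>_. borel)) (borel \<Otimes>\<^sub>M borel)"
  proof (intro measurable_Pair borel_measurable_sum)
    fix j assume j: "j \<in> R"
    then show *: "(\<lambda>f. f j) \<in> borel_measurable (PiM R (\<lambda>_. borel))"
      by (intro measurable_component_singleton)
    show "(\<lambda>f. stein_kernel (p j) (f j)) \<in> borel_measurable (PiM R (\<lambda>_. borel))"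
      using j by (intro measurable_compose[OF * kernel_borel]) (auto simp: R_def)
  qed
  ultimately have "indep_var (borel \<Otimes>\<^sub>M borel) ((\<lambda>f. (f k, 0 :: real)) \<circ> (\<lambda>\<omega>. restrict (\<lambda>i. X i \<omega>) {k}))
      (borel \<Otimes>\<^sub>M borel) ((\<lambda>f. (\<Sum>j\<in>R. f j, \<Sum>j\<in>R. stein_kernel (p j) (f j))) \<circ> (\<lambda>\<omega>. restrict (\<lambda>i. X i \<omega>) R))"
    by (rule indep_var_compose)
  moreover have "(\<lambda>f. (\<Sum>j\<in>R. f j, \<Sum>j\<in>R. stein_kernel (p j) (f j))) \<circ> (\<lambda>\<omega>. restrict (\<lambda>i. X i \<omega>) R)
      = (\<lambda>\<omega>. (\<Sum>j\<in>R. X j \<omega>, \<Sum>j\<in>R. t j \<omega>))"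
    by (auto simp: fun_eq_iff intro!: sum.cong)
  ultimately show ?thesis by (simp add: comp_def R_def)
qed

text \<open>The sum over \<open>k\<close> of the identities in the single variables. The derivative of the numerator gets the
  total weight \<open>\<Sum> \<tau>\<^sub>k = T\<close>.\<close>

lemma score_of_sum_regularised:
  assumes a: "\<And>x. (a has_real_derivative a' x) (at x)" "a' \<in> borel_measurable borel"
      "\<And>x. \<bar>a x\<bar> \<le> K" "\<And>x. \<bar>a' x\<bar> \<le> K"
    and e: "0 < e"
  shows "expectation (\<lambda>\<omega>. IX.S n \<omega> * (a (IX.S n \<omega>) / (T n \<omega> + e)))
    = expectation (\<lambda>\<omega>. T n \<omega> * (a' (IX.S n \<omega>) / (T n \<omega> + e))
        - Q n \<omega> * (a (IX.S n \<omega>) / (T n \<omega> + e)\<^sup>2))"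
proof -
  define s e' where "s = IX.S n" and "e' = (\<lambda>\<omega>. T n \<omega> + e)"
  define L where "L = (\<lambda>k \<omega>. X k \<omega> * (a (s \<omega>) / e' \<omega>))"
  define R where "R = (\<lambda>k \<omega>. t k \<omega> * (a' (s \<omega>) / e' \<omega> - t' k \<omega> * a (s \<omega>) / (e' \<omega>)\<^sup>2))"
  have k_identity: "expectation (L k) = expectation (R k)" "integrable M (L k)" "integrable M (R k)"
    if k: "k \<in> {1..n}" for k
  proof -
    have k1: "1 \<le> k" using k by simp
    interpret D: stein_density M "X k" "p k" by (rule density[OF k1])
    define W where "W = (\<lambda>\<omega>. (\<Sum>j\<in>{1..n} - {k}. X j \<omega>, \<Sum>j\<in>{1..n} - {k}. t j \<omega>))"
    have W: "X k \<omega> + fst (W \<omega>) = s \<omega>" "t k \<omega> + snd (W \<omega>) + e = e' \<omega>" for \<omega>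
      using sum.remove[OF _ k, of "\<lambda>j. X j \<omega>"] sum.remove[OF _ k, of "\<lambda>j. t j \<omega>"]
      by (simp_all add: W_def s_def e'_def IX.S_def stein_kernel_sum_def)
    have nonneg: "0 \<le> snd (W \<omega>)" for \<omega>
      unfolding W_def snd_conv by (intro sum_nonneg t_nonneg) auto
    note hyps = indep_rest[OF k, folded W_def] nonneg IX.Y_integrable[OF k1, of 2]
      t_integrable[OF k1, of 2] t'_integrable[OF k1, of 2] a e
    show "expectation (L k) = expectation (R k)"
      using D.stein_identity_regularised[OF hyps(1-3), of a a' K e] hyps(4-) unfolding W L_def R_def by simp
    show "integrable M (L k)" "integrable M (R k)"
      using D.integrable_stein_regularised[OF hyps(1-3), of a a' K e] hyps(4-) unfolding W L_def R_def by simp_all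
  qed
  have "(\<Sum>k=1..n. L k \<omega>) = s \<omega> * (a (s \<omega>) / e' \<omega>)" for \<omega>
    unfolding L_def s_def IX.S_def sum_distrib_right ..
  moreover have "(\<Sum>k=1..n. R k \<omega>) = T n \<omega> * (a' (s \<omega>) / e' \<omega>) - Q n \<omega> * (a (s \<omega>) / (e' \<omega>)\<^sup>2)" for \<omega>
  proof -
    have "R k \<omega> = t k \<omega> * (a' (s \<omega>) / e' \<omega>) - t k \<omega> * t' k \<omega> * (a (s \<omega>) / (e' \<omega>)\<^sup>2)" for k
      by (simp add: R_def right_diff_distrib)
    then show ?thesis
      unfolding stein_kernel_sum_def Q_def sum_distrib_right by (simp add: sum_subtractf)
  qed
  moreover have "expectation (\<lambda>\<omega>. \<Sum>k=1..n. L k \<omega>) = expectation (\<lambda>\<omega>. \<Sum>k=1..n. R k \<omega>)"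
    using k_identity by (simp add: Bochner_Integration.integral_sum)
  ultimately show ?thesis by (simp add: s_def e'_def)
qed

text \<open>Letting \<open>e\<close> tend to \<open>0\<close> cancels \<open>T\<close> in front of \<open>a'\<close>. In this sense \<open>S/T + Q/T\<^sup>2\<close> is minus the score
  of \<open>S\<close>.\<close>

theorem score_of_sum:
  assumes a: "\<And>x. (a has_real_derivative a' x) (at x)" "a' \<in> borel_measurable borel"
      "\<And>x. \<bar>a x\<bar> \<le> K" "\<And>x. \<bar>a' x\<bar> \<le> K"
    and pos: "AE \<omega> in M. 0 < T n \<omega>"
    and int: "integrable M (\<lambda>\<omega>. IX.S n \<omega> / T n \<omega>)" "integrable M (\<lambda>\<omega>. Q n \<omega> / (T n \<omega>)\<^sup>2)"
  shows "expectation (\<lambda>\<omega>. a' (IX.S n \<omega>))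
    = expectation (\<lambda>\<omega>. a (IX.S n \<omega>) * (IX.S n \<omega> / T n \<omega> + Q n \<omega> / (T n \<omega>)\<^sup>2))"
proof -
  note [measurable] = a(2)
  have [measurable]: "a \<in> borel_measurable borel"
    using DERIV_isCont[OF a(1)]
    by (intro borel_measurable_continuous_onI continuous_at_imp_continuous_on) auto
  have K: "0 \<le> K" using a(3)[of 0] by simp
  define s where "s = IX.S n"
  define e where "e = (\<lambda>i. 1 / real (Suc i))"
  have [measurable]: "s \<in> borel_measurable M" by (simp add: s_def)
  have e: "0 < e i" for i by (simp add: e_def)
  have e_lim: "e \<longlonglongrightarrow> 0"
    unfolding e_def using LIMSEQ_inverse_real_of_nat by (simp add: inverse_eq_divide)
  have "(\<lambda>i. expectation (\<lambda>\<omega>. s \<omega> * (a (s \<omega>) / (T n \<omega> + e i)))) \<longlonglongrightarrow> expectation (\<lambda>\<omega>. s \<omega> * (a (s \<omega>) / T n \<omega>))"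
  proof (rule integral_dominated_convergence)
    show "integrable M (\<lambda>\<omega>. K * \<bar>s \<omega> / T n \<omega>\<bar>)"
      unfolding s_def by (intro integrable_mult_right integrable_abs int)
    show "AE \<omega> in M. (\<lambda>i. s \<omega> * (a (s \<omega>) / (T n \<omega> + e i))) \<longlonglongrightarrow> s \<omega> * (a (s \<omega>) / T n \<omega>)"
      using pos
    proof eventually_elim
      case (elim \<omega>)
      have "(\<lambda>i. s \<omega> * (a (s \<omega>) / (T n \<omega> + e i))) \<longlonglongrightarrow> s \<omega> * (a (s \<omega>) / (T n \<omega> + 0))"
        using elim by (intro tendsto_intros e_lim) auto
      then show ?case by simp
    qed
    show "AE \<omega> in M. norm (s \<omega> * (a (s \<omega>) / (T n \<omega> + e i))) \<le> K * \<bar>s \<omega> / T n \<omega>\<bar>" for i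
      using pos
    proof eventually_elim
      case (elim \<omega>)
      have "\<bar>a (s \<omega>)\<bar> / (T n \<omega> + e i) \<le> K / T n \<omega>"
        using elim e[of i] a(3) K by (intro frac_le) auto
      then have "\<bar>s \<omega>\<bar> * (\<bar>a (s \<omega>)\<bar> / (T n \<omega> + e i)) \<le> \<bar>s \<omega>\<bar> * (K / T n \<omega>)"
        by (intro mult_left_mono) auto
      then show ?case using elim e[of i] by (simp add: abs_mult mult.commute)
    qed
  qed measurable
  moreover have "(\<lambda>i. expectation (\<lambda>\<omega>. T n \<omega> * (a' (s \<omega>) / (T n \<omega> + e i)) - Q n \<omega> * (a (s \<omega>) / (T n \<omega> + e i)\<^sup>2)))
      \<longlonglongrightarrow> expectation (\<lambda>\<omega>. a' (s \<omega>) - Q n \<omega> * (a (s \<omega>) / (T n \<omega>)\<^sup>2))"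
  proof (rule integral_dominated_convergence)
    show "integrable M (\<lambda>\<omega>. K + K * \<bar>Q n \<omega> / (T n \<omega>)\<^sup>2\<bar>)"
      by (intro Bochner_Integration.integrable_add integrable_mult_right integrable_abs int integrable_const)
    show "AE \<omega> in M. (\<lambda>i. T n \<omega> * (a' (s \<omega>) / (T n \<omega> + e i)) - Q n \<omega> * (a (s \<omega>) / (T n \<omega> + e i)\<^sup>2))
        \<longlonglongrightarrow> a' (s \<omega>) - Q n \<omega> * (a (s \<omega>) / (T n \<omega>)\<^sup>2)"
      using pos
    proof eventually_elim
      case (elim \<omega>)
      have "(\<lambda>i. T n \<omega> * (a' (s \<omega>) / (T n \<omega> + e i)) - Q n \<omega> * (a (s \<omega>) / (T n \<omega> + e i)\<^sup>2))
          \<longlonglongrightarrow> T n \<omega> * (a' (s \<omega>) / (T n \<omega> + 0)) - Q n \<omega> * (a (s \<omega>) / (T n \<omega> + 0)\<^sup>2)"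
        using elim by (intro tendsto_intros e_lim) auto
      then show ?case using elim by simp
    qed
    show "AE \<omega> in M. norm (T n \<omega> * (a' (s \<omega>) / (T n \<omega> + e i)) - Q n \<omega> * (a (s \<omega>) / (T n \<omega> + e i)\<^sup>2))
        \<le> K + K * \<bar>Q n \<omega> / (T n \<omega>)\<^sup>2\<bar>" for i
      using pos
    proof eventually_elim
      case (elim \<omega>)
      have "\<bar>a' (s \<omega>)\<bar> / (T n \<omega> + e i) \<le> K / T n \<omega>"
        using elim e[of i] a(4) K by (intro frac_le) auto
      then have "T n \<omega> * (\<bar>a' (s \<omega>)\<bar> / (T n \<omega> + e i)) \<le> T n \<omega> * (K / T n \<omega>)"
        using elim by (intro mult_left_mono) auto
      then have 1: "\<bar>T n \<omega> * (a' (s \<omega>) / (T n \<omega> + e i))\<bar> \<le> K"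
        using elim e[of i] by (simp add: abs_mult)
      have "\<bar>a (s \<omega>)\<bar> / (T n \<omega> + e i)\<^sup>2 \<le> K / (T n \<omega>)\<^sup>2"
        using elim e[of i] a(3) K by (intro frac_le power_mono) auto
      then have "\<bar>Q n \<omega>\<bar> * (\<bar>a (s \<omega>)\<bar> / (T n \<omega> + e i)\<^sup>2) \<le> \<bar>Q n \<omega>\<bar> * (K / (T n \<omega>)\<^sup>2)"
        by (intro mult_left_mono) auto
      then have 2: "\<bar>Q n \<omega> * (a (s \<omega>) / (T n \<omega> + e i)\<^sup>2)\<bar> \<le> K * \<bar>Q n \<omega> / (T n \<omega>)\<^sup>2\<bar>"
        by (simp add: abs_mult mult.commute)
      show ?case unfolding real_norm_def
        by (rule order_trans[OF abs_triangle_ineq4 add_mono[OF 1 2]])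
    qed
  qed measurable
  moreover have "expectation (\<lambda>\<omega>. s \<omega> * (a (s \<omega>) / (T n \<omega> + e i)))
      = expectation (\<lambda>\<omega>. T n \<omega> * (a' (s \<omega>) / (T n \<omega> + e i)) - Q n \<omega> * (a (s \<omega>) / (T n \<omega> + e i)\<^sup>2))" for i
    unfolding s_def by (rule score_of_sum_regularised[OF a e])
  ultimately have eq: "expectation (\<lambda>\<omega>. s \<omega> * (a (s \<omega>) / T n \<omega>))
      = expectation (\<lambda>\<omega>. a' (s \<omega>) - Q n \<omega> * (a (s \<omega>) / (T n \<omega>)\<^sup>2))"
    using LIMSEQ_unique by auto
  have mult: "integrable M (\<lambda>\<omega>. a (s \<omega>) * f \<omega>)" if "integrable M f" for f
  proof (rule Bochner_Integration.integrable_bound)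
    show "integrable M (\<lambda>\<omega>. K * \<bar>f \<omega>\<bar>)" using that by auto
    show "AE \<omega> in M. norm (a (s \<omega>) * f \<omega>) \<le> norm (K * \<bar>f \<omega>\<bar>)"
      using a(3) K by (intro AE_I2) (auto simp: abs_mult intro!: mult_right_mono)
  qed (use that in measurable)
  have i1: "integrable M (\<lambda>\<omega>. a (s \<omega>) * (s \<omega> / T n \<omega>))" and i2: "integrable M (\<lambda>\<omega>. a (s \<omega>) * (Q n \<omega> / (T n \<omega>)\<^sup>2))"
    using mult[OF int(1)] mult[OF int(2)] by (simp_all add: s_def)
  have i3: "integrable M (\<lambda>\<omega>. a' (s \<omega>))"
    by (rule integrable_const_bound[where B = K]) (use a(4) in auto)
  have "expectation (\<lambda>\<omega>. a (s \<omega>) * (s \<omega> / T n \<omega>)) = expectation (\<lambda>\<omega>. a' (s \<omega>) - a (s \<omega>) * (Q n \<omega> / (T n \<omega>)\<^sup>2))"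
    using eq by (simp add: mult.commute)
  also have "\<dots> = expectation (\<lambda>\<omega>. a' (s \<omega>)) - expectation (\<lambda>\<omega>. a (s \<omega>) * (Q n \<omega> / (T n \<omega>)\<^sup>2))"
    by (rule Bochner_Integration.integral_diff[OF i3 i2])
  finally have "expectation (\<lambda>\<omega>. a' (s \<omega>)) = expectation (\<lambda>\<omega>. a (s \<omega>) * (s \<omega> / T n \<omega>)) + expectation (\<lambda>\<omega>. a (s \<omega>) * (Q n \<omega> / (T n \<omega>)\<^sup>2))"
    by simp
  also have "\<dots> = expectation (\<lambda>\<omega>. a (s \<omega>) * (s \<omega> / T n \<omega>) + a (s \<omega>) * (Q n \<omega> / (T n \<omega>)\<^sup>2))"
    by (rule Bochner_Integration.integral_add[OF i1 i2, symmetric])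
  finally show ?thesis by (simp add: s_def distrib_left)
qed

end

section \<open>Negative moments of the sum of the kernels\<close>

lemma (in prob_space) indep_var_nn_integral:
  fixes f g :: "'a \<Rightarrow> ennreal"
  assumes "indep_var borel f borel g"
  shows "(\<integral>\<^sup>+\<omega>. f \<omega> * g \<omega> \<partial>M) = (\<integral>\<^sup>+\<omega>. f \<omega> \<partial>M) * (\<integral>\<^sup>+\<omega>. g \<omega> \<partial>M)"
proof -
  have "(\<lambda>_. borel) = case_bool borel (borel :: ennreal measure)"
    by (auto simp: fun_eq_iff split: bool.split)
  then have "indep_vars (\<lambda>_. borel) (case_bool f g) UNIV"
    using assms by (simp add: indep_var_def)
  then have "(\<integral>\<^sup>+\<omega>. (\<Prod>i\<in>UNIV. case_bool f g i \<omega>) \<partial>M) = (\<Prod>i\<in>UNIV. \<integral>\<^sup>+\<omega>. case_bool f g i \<omega> \<partial>M)"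
    by (intro indep_vars_nn_integral) auto
  then show ?thesis by (simp add: UNIV_bool mult.commute)
qed

lemma inverse_ennreal_antimono:
  assumes "0 \<le> x" "x \<le> y"
  shows "inverse (ennreal y) \<le> inverse (ennreal x)"
  using assms by (cases "x = 0") (auto simp: inverse_ennreal intro!: ennreal_leI le_imp_inverse_le)

lemma power8_exp_le:
  fixes c x :: real
  assumes "0 < c" "0 \<le> x"
  shows "x ^ 8 * exp (- (c * x)) \<le> (8 / c) ^ 8"
proof -
  have "c * x / 8 \<le> exp (c * x / 8)" using exp_ge_add_one_self[of "c * x / 8"] by linarith
  then have "(c * x / 8) ^ 8 \<le> exp (c * x / 8) ^ 8" using assms by (intro power_mono) auto
  also have "\<dots> = exp (c * x)" by (simp flip: exp_of_nat_mult)
  finally have "(c * x / 8) ^ 8 \<le> exp (c * x)" .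
  then have "(c * x / 8) ^ 8 * exp (- (c * x)) \<le> 1"
    by (simp add: exp_minus divide_inverse[symmetric])
  then have "(8 / c) ^ 8 * ((c * x / 8) ^ 8 * exp (- (c * x))) \<le> (8 / c) ^ 8 * 1"
    using assms by (intro mult_left_mono) auto
  moreover have "(8 / c) ^ 8 * (c * x / 8) ^ 8 = x ^ 8"
    using assms unfolding power_mult_distrib[symmetric] by simp
  ultimately show ?thesis by (simp only: mult.assoc[symmetric] mult_1_right)
qed

context stein_sequence
begin

text \<open>The parameter of the exponential tilting: it minimises the bound
  \<open>1 - \<lambda> + \<lambda>\<^sup>2 (1 + b) / 2\<close> for the Laplace transform of a kernel at \<open>\<lambda>\<close>.\<close>

definition rate :: real where "rate = 1 / (1 + b)"

lemma rate: "0 < rate" "rate * (1 + b) = 1"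
  using IX.b_nonneg by (auto simp: rate_def)

text \<open>From \<open>exp(-y) \<le> 1 - y + y\<^sup>2/2\<close> for \<open>y \<ge> 0\<close>: the kernel is nonnegative with mean \<open>1\<close> and second moment
  at most \<open>1 + b\<close>.\<close>

lemma laplace_kernel:
  assumes k: "1 \<le> k"
  shows "(\<integral>\<^sup>+\<omega>. ennreal (exp (- (rate * t k \<omega>))) \<partial>M) \<le> ennreal (exp (- rate / 2))"
proof -
  have int: "integrable M (t k)" "integrable M (\<lambda>\<omega>. (t k \<omega>)\<^sup>2)"
    using t_integrable[OF k, of 1] t_integrable[OF k, of 2] by auto
  have e_le: "exp (- y) \<le> 1 - y + y\<^sup>2 / 2" if "0 \<le> y" for y :: real
  proof -
    have "1 \<le> exp y * (1 - y + y\<^sup>2 / 2)"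
    proof (cases "y = 0")
      case False
      have "(\<lambda>x. exp x * (1 - x + x\<^sup>2 / 2)) 0 \<le> (\<lambda>x. exp x * (1 - x + x\<^sup>2 / 2)) y"
      proof (rule DERIV_nonneg_imp_nondecreasing[OF that])
        fix x :: real
        have "((\<lambda>x. exp x * (1 - x + x\<^sup>2 / 2)) has_real_derivative exp x * (x\<^sup>2 / 2)) (at x)"
          by (auto intro!: derivative_eq_intros simp: algebra_simps)
        then show "\<exists>D. ((\<lambda>x. exp x * (1 - x + x\<^sup>2 / 2)) has_real_derivative D) (at x) \<and> 0 \<le> D"
          by (intro exI[of _ "exp x * (x\<^sup>2 / 2)"]) auto
      qed
      then show ?thesis by simp
    qed simp
    then show ?thesis by (simp add: exp_minus field_simps)
  qed
  have second: "expectation (\<lambda>\<omega>. (t k \<omega>)\<^sup>2) \<le> 1 + b"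
    using integrable_power_le(3)[OF t_borel[OF k] kernel_int[OF k], of 2] kernel_moment[OF k] by simp
  have int_exp: "integrable M (\<lambda>\<omega>. exp (- (rate * t k \<omega>)))"
    by (rule integrable_const_bound[where B = 1])
      (use rate t_nonneg[OF k] t_borel[OF k] in auto)
  have "expectation (\<lambda>\<omega>. exp (- (rate * t k \<omega>))) \<le> expectation (\<lambda>\<omega>. 1 - rate * t k \<omega> + rate\<^sup>2 / 2 * (t k \<omega>)\<^sup>2)"
  proof (rule integral_mono[OF int_exp])
    show "integrable M (\<lambda>\<omega>. 1 - rate * t k \<omega> + rate\<^sup>2 / 2 * (t k \<omega>)\<^sup>2)" using int by auto
    show "exp (- (rate * t k \<omega>)) \<le> 1 - rate * t k \<omega> + rate\<^sup>2 / 2 * (t k \<omega>)\<^sup>2" for \<omega>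
      using e_le[of "rate * t k \<omega>"] rate t_nonneg[OF k, of \<omega>] by (simp add: power_mult_distrib)
  qed
  also have "\<dots> = 1 - rate + rate\<^sup>2 / 2 * expectation (\<lambda>\<omega>. (t k \<omega>)\<^sup>2)"
    using int mean_kernel[OF k] by (simp add: prob_space)
  also have "\<dots> \<le> 1 - rate + rate\<^sup>2 / 2 * (1 + b)"
    using second by (intro add_left_mono mult_left_mono) auto
  also have "\<dots> = 1 - rate / 2"
    using rate by (simp add: power2_eq_square mult.assoc)
  also have "\<dots> \<le> exp (- rate / 2)" using exp_ge_add_one_self[of "- rate / 2"] by simp
  finally show ?thesis
    by (subst nn_integral_eq_integral[OF int_exp]) (auto intro: ennreal_leI)
qed

lemma T_add: "T (n + k) \<omega> = T n \<omega> + (\<Sum>j=1..k. t (n + j) \<omega>)"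
  by (induction k) (auto simp: stein_kernel_sum_def)

text \<open>By independence, each further kernel multiplies the expectation by its Laplace transform. Only the
  first \<open>n\<close> kernels are asked for a negative moment.\<close>

lemma tilted_negative_moment:
  "(\<integral>\<^sup>+\<omega>. inverse (ennreal (\<bar>T n \<omega>\<bar> ^ 8)) * ennreal (exp (- (rate * (\<Sum>j=1..k. t (n + j) \<omega>)))) \<partial>M)
    \<le> neg_eighth_moment M (T n) * ennreal (exp (- rate / 2)) ^ k"
proof (induction k)
  case 0
  then show ?case by (simp add: neg_eighth_moment_def)
next
  case (Suc k)
  define N where "N = n + k"
  define Z where "Z = (\<lambda>\<omega>. inverse (ennreal (\<bar>T n \<omega>\<bar> ^ 8)) * ennreal (exp (- (rate * (\<Sum>j=1..k. t (n + j) \<omega>)))))"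
  define A where "A = {1..N}"
  define zf where "zf = (\<lambda>f :: nat \<Rightarrow> real. inverse (ennreal (\<bar>\<Sum>j=1..n. stein_kernel (p j) (f j)\<bar> ^ 8))
      * ennreal (exp (- (rate * (\<Sum>j=1..k. stein_kernel (p (n + j)) (f (n + j)))))))"
  define ef where "ef = (\<lambda>f :: nat \<Rightarrow> real. ennreal (exp (- (rate * stein_kernel (p (Suc N)) (f (Suc N))))))"
  have comp: "(\<lambda>f. stein_kernel (p j) (f j)) \<in> borel_measurable (PiM B (\<lambda>_. borel))" if "j \<in> B" "1 \<le> j" for j B
  proof -
    have "(\<lambda>f. f j) \<in> borel_measurable (PiM B (\<lambda>_. borel))"
      using that by (intro measurable_component_singleton)
    then show ?thesis using that by (intro measurable_compose[OF _ kernel_borel]) auto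
  qed
  have "indep_var (PiM A (\<lambda>_. borel)) (\<lambda>\<omega>. restrict (\<lambda>i. X i \<omega>) A)
      (PiM {Suc N} (\<lambda>_. borel)) (\<lambda>\<omega>. restrict (\<lambda>i. X i \<omega>) {Suc N})"
    by (intro indep_var_restrict[OF indep]) (auto simp: A_def)
  moreover have "zf \<in> borel_measurable (PiM A (\<lambda>_. borel))"
  proof -
    have 1: "(\<lambda>f. \<Sum>j=1..n. stein_kernel (p j) (f j)) \<in> borel_measurable (PiM A (\<lambda>_. borel))"
      by (intro borel_measurable_sum comp) (auto simp: A_def N_def)
    have 2: "(\<lambda>f. \<Sum>j=1..k. stein_kernel (p (n + j)) (f (n + j))) \<in> borel_measurable (PiM A (\<lambda>_. borel))"
      by (intro borel_measurable_sum comp) (auto simp: A_def N_def)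
    note [measurable] = 1 2
    show ?thesis unfolding zf_def by measurable
  qed
  moreover have "ef \<in> borel_measurable (PiM {Suc N} (\<lambda>_. borel))"
    using comp[of "Suc N" "{Suc N}"] unfolding ef_def by measurable
  ultimately have "indep_var borel (zf \<circ> (\<lambda>\<omega>. restrict (\<lambda>i. X i \<omega>) A)) borel (ef \<circ> (\<lambda>\<omega>. restrict (\<lambda>i. X i \<omega>) {Suc N}))"
    by (rule indep_var_compose)
  moreover have "zf \<circ> (\<lambda>\<omega>. restrict (\<lambda>i. X i \<omega>) A) = Z"
  proof
    fix \<omega>
    have "(\<Sum>j=1..n. stein_kernel (p j) (restrict (\<lambda>i. X i \<omega>) A j)) = T n \<omega>"
      unfolding stein_kernel_sum_def by (intro sum.cong) (auto simp: A_def N_def)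
    moreover have "(\<Sum>j=1..k. stein_kernel (p (n + j)) (restrict (\<lambda>i. X i \<omega>) A (n + j))) = (\<Sum>j=1..k. t (n + j) \<omega>)"
      by (intro sum.cong) (auto simp: A_def N_def)
    ultimately show "(zf \<circ> (\<lambda>\<omega>. restrict (\<lambda>i. X i \<omega>) A)) \<omega> = Z \<omega>"
      by (simp only: comp_def zf_def Z_def)
  qed
  moreover have "ef \<circ> (\<lambda>\<omega>. restrict (\<lambda>i. X i \<omega>) {Suc N}) = (\<lambda>\<omega>. ennreal (exp (- (rate * t (Suc N) \<omega>))))"
    by (simp add: ef_def comp_def)
  ultimately have "(\<integral>\<^sup>+\<omega>. Z \<omega> * ennreal (exp (- (rate * t (Suc N) \<omega>))) \<partial>M)
      = (\<integral>\<^sup>+\<omega>. Z \<omega> \<partial>M) * (\<integral>\<^sup>+\<omega>. ennreal (exp (- (rate * t (Suc N) \<omega>))) \<partial>M)"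
    by (intro indep_var_nn_integral) simp
  also have "\<dots> \<le> (neg_eighth_moment M (T n) * ennreal (exp (- rate / 2)) ^ k) * ennreal (exp (- rate / 2))"
    using Suc laplace_kernel[of "Suc N"] by (intro mult_mono) (auto simp: Z_def)
  also have "\<dots> = neg_eighth_moment M (T n) * ennreal (exp (- rate / 2)) ^ Suc k"
    by (simp add: mult_ac)
  finally have "(\<integral>\<^sup>+\<omega>. Z \<omega> * ennreal (exp (- (rate * t (Suc N) \<omega>))) \<partial>M)
      \<le> neg_eighth_moment M (T n) * ennreal (exp (- rate / 2)) ^ Suc k" .
  moreover have "Z \<omega> * ennreal (exp (- (rate * t (Suc N) \<omega>)))
      = inverse (ennreal (\<bar>T n \<omega>\<bar> ^ 8)) * ennreal (exp (- (rate * (\<Sum>j=1..Suc k. t (n + j) \<omega>))))" for \<omega>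
  proof -
    have "exp (- (rate * (\<Sum>j=1..Suc k. t (n + j) \<omega>)))
        = exp (- (rate * (\<Sum>j=1..k. t (n + j) \<omega>))) * exp (- (rate * t (Suc N) \<omega>))"
      by (simp add: N_def distrib_left flip: exp_add)
    then show ?thesis by (simp add: Z_def mult.assoc ennreal_mult')
  qed
  ultimately show ?case by simp
qed

text \<open>Either the \<open>k\<close> further kernels add up to at least \<open>k/4\<close>, and this alone bounds \<open>T\<close> below, or the tilting
  factor \<open>exp(rate (k/4 - R))\<close> is at least \<open>1\<close> and may be inserted. Its expectation decays like
  \<open>exp(rate k/4 - rate k/2)\<close>, which beats the factor \<open>(n + k)\<^sup>8\<close>.\<close>

lemma negative_moment_step:
  assumes "1 \<le> k"
  shows "of_nat (n + k) ^ 8 * neg_eighth_moment M (T (n + k))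
    \<le> ennreal ((4 * (real n + 1)) ^ 8) + neg_eighth_moment M (T n) * ennreal ((real n + 1) ^ 8 * (32 / rate) ^ 8)"
proof -
  define R where "R = (\<lambda>\<omega>. \<Sum>j=1..k. t (n + j) \<omega>)"
  have [measurable]: "R \<in> borel_measurable M"
    unfolding R_def by (intro borel_measurable_sum t_borel) auto
  have R_nonneg: "0 \<le> R \<omega>" for \<omega> unfolding R_def by (intro sum_nonneg t_nonneg) auto
  define E where "E = exp (rate * real k / 4)"
  have le: "inverse (ennreal (\<bar>T (n + k) \<omega>\<bar> ^ 8))
      \<le> ennreal ((4 / real k) ^ 8) + ennreal E * (inverse (ennreal (\<bar>T n \<omega>\<bar> ^ 8)) * ennreal (exp (- (rate * R \<omega>))))" for \<omega>
  proof (cases "real k / 4 \<le> R \<omega>")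
    case True
    then have "real k / 4 \<le> T (n + k) \<omega>" using T_nonneg[of n \<omega>] by (simp add: T_add R_def)
    then have "(real k / 4) ^ 8 \<le> \<bar>T (n + k) \<omega>\<bar> ^ 8" by (intro power_mono) auto
    then have "inverse (ennreal (\<bar>T (n + k) \<omega>\<bar> ^ 8)) \<le> inverse (ennreal ((real k / 4) ^ 8))"
      by (intro inverse_ennreal_antimono) auto
    also have "\<dots> = ennreal ((4 / real k) ^ 8)"
      using assms by (subst inverse_ennreal) (auto simp: power_divide)
    finally show ?thesis by (simp add: add_increasing2)
  next
    case False
    have "1 \<le> E * exp (- (rate * R \<omega>))"
      using False rate by (simp add: E_def mult_left_mono flip: exp_add)
    then have *: "1 \<le> ennreal E * ennreal (exp (- (rate * R \<omega>)))"
      by (simp add: E_def flip: ennreal_mult ennreal_1)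
    have "T n \<omega> \<le> T (n + k) \<omega>" using R_nonneg[of \<omega>] by (simp add: T_add R_def)
    then have "\<bar>T n \<omega>\<bar> ^ 8 \<le> \<bar>T (n + k) \<omega>\<bar> ^ 8"
      using T_nonneg[of n \<omega>] by (intro power_mono) auto
    then have "inverse (ennreal (\<bar>T (n + k) \<omega>\<bar> ^ 8)) \<le> inverse (ennreal (\<bar>T n \<omega>\<bar> ^ 8)) * 1"
      by (simp add: inverse_ennreal_antimono)
    also have "\<dots> \<le> inverse (ennreal (\<bar>T n \<omega>\<bar> ^ 8)) * (ennreal E * ennreal (exp (- (rate * R \<omega>))))"
      by (intro mult_left_mono *) auto
    also have "\<dots> = ennreal E * (inverse (ennreal (\<bar>T n \<omega>\<bar> ^ 8)) * ennreal (exp (- (rate * R \<omega>))))"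
      by (simp add: mult_ac)
    finally show ?thesis by (simp add: add_increasing)
  qed
  have "neg_eighth_moment M (T (n + k)) \<le> (\<integral>\<^sup>+\<omega>. ennreal ((4 / real k) ^ 8)
      + ennreal E * (inverse (ennreal (\<bar>T n \<omega>\<bar> ^ 8)) * ennreal (exp (- (rate * R \<omega>)))) \<partial>M)"
    unfolding neg_eighth_moment_def by (intro nn_integral_mono le)
  also have "\<dots> = ennreal ((4 / real k) ^ 8)
      + ennreal E * (\<integral>\<^sup>+\<omega>. inverse (ennreal (\<bar>T n \<omega>\<bar> ^ 8)) * ennreal (exp (- (rate * R \<omega>))) \<partial>M)"
    by (subst nn_integral_add) (auto simp: nn_integral_cmult emeasure_space_1)
  also have "\<dots> \<le> ennreal ((4 / real k) ^ 8)
      + ennreal E * (neg_eighth_moment M (T n) * ennreal (exp (- rate / 2)) ^ k)"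
    unfolding R_def by (intro add_left_mono mult_left_mono tilted_negative_moment) auto
  also have "\<dots> = ennreal ((4 / real k) ^ 8) + neg_eighth_moment M (T n) * ennreal (exp (- (rate / 4 * real k)))"
  proof -
    have "ennreal E * ennreal (exp (- rate / 2)) ^ k = ennreal (exp (- (rate / 4 * real k)))"
      by (simp add: E_def ennreal_power field_simps flip: ennreal_mult exp_of_nat_mult exp_add)
    then show ?thesis by (subst mult.left_commute) simp
  qed
  finally have "of_nat (n + k) ^ 8 * neg_eighth_moment M (T (n + k))
      \<le> of_nat (n + k) ^ 8 * (ennreal ((4 / real k) ^ 8) + neg_eighth_moment M (T n) * ennreal (exp (- (rate / 4 * real k))))"
    by (intro mult_left_mono) auto
  also have eq8: "of_nat (n + k) ^ 8 = ennreal (real (n + k) ^ 8)"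
    by (simp add: ennreal_of_nat_eq_real_of_nat ennreal_power del: of_nat_add)
  also have "ennreal (real (n + k) ^ 8) * (ennreal ((4 / real k) ^ 8) + neg_eighth_moment M (T n) * ennreal (exp (- (rate / 4 * real k))))
      = ennreal (real (n + k) ^ 8 * (4 / real k) ^ 8)
        + neg_eighth_moment M (T n) * ennreal (real (n + k) ^ 8 * exp (- (rate / 4 * real k)))"
    by (simp add: distrib_left ennreal_mult mult_ac)
  also have "\<dots> \<le> ennreal ((4 * (real n + 1)) ^ 8) + neg_eighth_moment M (T n) * ennreal ((real n + 1) ^ 8 * (32 / rate) ^ 8)"
  proof (intro add_mono mult_left_mono ennreal_leI)
    have nk: "real (n + k) \<le> (real n + 1) * real k"
    proof -
      have "1 * real n \<le> real k * real n" using assms by (intro mult_right_mono) auto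
      then show ?thesis by (simp add: algebra_simps)
    qed
    then have "real (n + k) * (4 / real k) \<le> 4 * (real n + 1)"
      using assms by (simp add: field_simps)
    then show "real (n + k) ^ 8 * (4 / real k) ^ 8 \<le> (4 * (real n + 1)) ^ 8"
      unfolding power_mult_distrib[symmetric] by (intro power_mono) auto
    have "real (n + k) ^ 8 * exp (- (rate / 4 * real k)) \<le> ((real n + 1) * real k) ^ 8 * exp (- (rate / 4 * real k))"
      using nk by (intro mult_right_mono power_mono) auto
    also have "\<dots> = (real n + 1) ^ 8 * (real k ^ 8 * exp (- (rate / 4 * real k)))"
      by (simp add: power_mult_distrib mult.assoc)
    also have "\<dots> \<le> (real n + 1) ^ 8 * (8 / (rate / 4)) ^ 8"
      using rate by (intro mult_left_mono power8_exp_le) auto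
    finally show "real (n + k) ^ 8 * exp (- (rate / 4 * real k)) \<le> (real n + 1) ^ 8 * (32 / rate) ^ 8"
      by simp
  qed auto
  finally show ?thesis unfolding eq8 .
qed

theorem neg_moment_bound_finite:
  assumes "neg_eighth_moment M (T n) < \<infinity>"
  shows "neg_moment_bound M X p n < \<infinity>"
proof -
  define B where "B = of_nat n ^ 8 * neg_eighth_moment M (T n)
      + (ennreal ((4 * (real n + 1)) ^ 8) + neg_eighth_moment M (T n) * ennreal ((real n + 1) ^ 8 * (32 / rate) ^ 8))"
  have "neg_moment_bound M X p n \<le> B"
    unfolding neg_moment_bound_def
  proof (rule SUP_least)
    fix k assume "k \<in> {n..}"
    then obtain j where j: "k = n + j" using le_Suc_ex by auto
    show "of_nat k ^ 8 * neg_eighth_moment M (T k) \<le> B"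
    proof (cases "j = 0")
      case True
      then show ?thesis using j by (simp add: B_def add_increasing2)
    next
      case False
      then show ?thesis using j negative_moment_step[of j n] by (simp add: B_def add_increasing)
    qed
  qed
  also have "B < \<infinity>" using assms
    by (auto simp: B_def ennreal_mult_less_top ennreal_of_nat_eq_real_of_nat ennreal_power)
  finally show ?thesis .
qed

lemma ratio_moment:
  assumes n: "1 \<le> n" and le: "of_nat n ^ 8 * neg_eighth_moment M (T n) \<le> ennreal g" and g: "0 \<le> g"
  shows "AE \<omega> in M. 0 < T n \<omega>" "integrable M (\<lambda>\<omega>. (real n / T n \<omega>) ^ 8)"
    "expectation (\<lambda>\<omega>. (real n / T n \<omega>) ^ 8) \<le> g"
proof -
  have n8: "of_nat n ^ 8 = ennreal (real n ^ 8)"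
    by (simp add: ennreal_of_nat_eq_real_of_nat ennreal_power)
  have "ennreal 1 * neg_eighth_moment M (T n) \<le> ennreal (real n ^ 8) * neg_eighth_moment M (T n)"
    using n by (intro mult_right_mono ennreal_leI) auto
  also have "\<dots> \<le> ennreal g" using le by (simp only: n8)
  also have "\<dots> < \<infinity>" by simp
  finally have "neg_eighth_moment M (T n) < \<infinity>" by simp
  then have "AE \<omega> in M. inverse (ennreal (\<bar>T n \<omega>\<bar> ^ 8)) \<noteq> \<infinity>"
    unfolding neg_eighth_moment_def by (intro nn_integral_noteq_infinite) auto
  then show pos: "AE \<omega> in M. 0 < T n \<omega>"
    by eventually_elim (use T_nonneg[of n] in \<open>auto simp: less_le\<close>)
  have "(\<integral>\<^sup>+\<omega>. ennreal ((real n / T n \<omega>) ^ 8) \<partial>M) = (\<integral>\<^sup>+\<omega>. of_nat n ^ 8 * inverse (ennreal (\<bar>T n \<omega>\<bar> ^ 8)) \<partial>M)"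
  proof (rule nn_integral_cong_AE)
    show "AE \<omega> in M. ennreal ((real n / T n \<omega>) ^ 8) = of_nat n ^ 8 * inverse (ennreal (\<bar>T n \<omega>\<bar> ^ 8))"
      using pos
    proof eventually_elim
      case (elim \<omega>)
      then have "inverse (ennreal (\<bar>T n \<omega>\<bar> ^ 8)) = ennreal (inverse (T n \<omega> ^ 8))"
        by (subst inverse_ennreal) auto
      moreover have "(real n / T n \<omega>) ^ 8 = real n ^ 8 * inverse (T n \<omega> ^ 8)"
        unfolding power_divide by (rule divide_inverse)
      ultimately show ?case using elim unfolding n8 by (simp add: ennreal_mult')
    qed
  qed
  also have "\<dots> = of_nat n ^ 8 * neg_eighth_moment M (T n)"
    unfolding neg_eighth_moment_def by (rule nn_integral_cmult) measurable
  finally have nn: "(\<integral>\<^sup>+\<omega>. ennreal ((real n / T n \<omega>) ^ 8) \<partial>M) \<le> ennreal g" using le by simp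
  then show int: "integrable M (\<lambda>\<omega>. (real n / T n \<omega>) ^ 8)"
    by (intro integrableI_nonneg) (auto intro: le_less_trans)
  have "ennreal (expectation (\<lambda>\<omega>. (real n / T n \<omega>) ^ 8)) = (\<integral>\<^sup>+\<omega>. ennreal ((real n / T n \<omega>) ^ 8) \<partial>M)"
    by (intro nn_integral_eq_integral[symmetric] int) auto
  then have "ennreal (expectation (\<lambda>\<omega>. (real n / T n \<omega>) ^ 8)) \<le> ennreal g" using nn by (rule ord_eq_le_trans)
  then show "expectation (\<lambda>\<omega>. (real n / T n \<omega>) ^ 8) \<le> g" by (rule ennreal_le_iff[THEN iffD1, OF g])
qed

end

section \<open>The delta method statistic\<close>

locale delta_method = stein_sequence M X p b for M :: "'a measure" and X p b +
  fixes H :: "real \<Rightarrow> real" and h1 h2 m \<gamma> :: real and n :: nat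
  assumes H_deriv: "\<And>x. (H has_real_derivative deriv H x) (at x)"
    and H'_deriv: "\<And>x. (deriv H has_real_derivative deriv (deriv H) x) (at x)"
    and h1: "\<And>x. \<bar>deriv H x\<bar> \<le> h1" and h2: "\<And>x. \<bar>deriv (deriv H) x\<bar> \<le> h2"
    and m: "0 < m" "\<And>x. m \<le> \<bar>deriv H x\<bar>"
    and n: "1 \<le> n"
    and T_pos: "AE \<omega> in M. 0 < T n \<omega>"
    and r_int: "integrable M (\<lambda>\<omega>. (real n / T n \<omega>) ^ 8)"
    and r_moment: "expectation (\<lambda>\<omega>. (real n / T n \<omega>) ^ 8) \<le> \<gamma>"
begin

text \<open>The sum \<open>s\<close> fluctuates like \<open>\<surd>n\<close> and \<open>T\<close> like \<open>n\<close> up to \<open>\<surd>n\<close>, so \<open>r\<close>, \<open>z\<close>, \<open>y\<close> and \<open>q\<close> are all of order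
  one; every error below is expressed through them.\<close>

definition s :: "'a \<Rightarrow> real" where "s = IX.S n"
definition F :: "'a \<Rightarrow> real" where "F = delta_statistic M H X n"
definition \<sigma>2 :: real where "\<sigma>2 = delta_variance M H X n"
definition r :: "'a \<Rightarrow> real" where "r \<omega> = real n / T n \<omega>"
definition z :: "'a \<Rightarrow> real" where "z \<omega> = \<bar>s \<omega>\<bar> / sqrt (real n)"
definition y :: "'a \<Rightarrow> real" where "y \<omega> = \<bar>T n \<omega> - real n\<bar> / sqrt (real n)"
definition q :: "'a \<Rightarrow> real" where "q \<omega> = \<bar>Q n \<omega>\<bar> / real n"

lemma h_nonneg: "0 \<le> h1" "0 \<le> h2"
  using h1[of 0] h2[of 0] by linarith+

lemma sqrt_n: "0 < sqrt (real n)" "1 \<le> sqrt (real n)" "sqrt (real n) * sqrt (real n) = real n"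
  using n by auto

lemma n_pos: "0 < real n" using n by simp

lemma H_borel [measurable]: "H \<in> borel_measurable borel"
  using DERIV_isCont[OF H_deriv]
  by (intro borel_measurable_continuous_onI continuous_at_imp_continuous_on) auto

lemma H'_borel [measurable]: "deriv H \<in> borel_measurable borel"
  using DERIV_isCont[OF H'_deriv]
  by (intro borel_measurable_continuous_onI continuous_at_imp_continuous_on) auto

lemma H''_borel [measurable]: "deriv (deriv H) \<in> borel_measurable borel"
  by (rule borel_measurable_deriv_off_finite[where E = "{}"])
    (use H'_deriv in \<open>auto simp: real_differentiable_def\<close>)

lemma s_borel [measurable]: "s \<in> borel_measurable M" by (simp add: s_def)

lemma F_eq: "F \<omega> = sqrt (real n) * (H (s \<omega> / real n) - expectation (\<lambda>\<omega>. H (s \<omega> / real n)))"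
  by (simp add: F_def delta_statistic_def sample_mean_def[abs_def] s_def IX.S_def[abs_def])

lemma F_borel [measurable]: "F \<in> borel_measurable M"
  unfolding F_eq[abs_def] by measurable

lemma
  shows r_borel [measurable]: "r \<in> borel_measurable M"
    and z_borel [measurable]: "z \<in> borel_measurable M"
    and y_borel [measurable]: "y \<in> borel_measurable M"
    and q_borel [measurable]: "q \<in> borel_measurable M"
  unfolding r_def[abs_def] z_def[abs_def] y_def[abs_def] q_def[abs_def] by measurable

lemma z_nonneg: "0 \<le> z \<omega>" and y_nonneg: "0 \<le> y \<omega>" and q_nonneg: "0 \<le> q \<omega>"
  by (simp_all add: z_def y_def q_def)

lemma s_integrable: "i \<le> 8 \<Longrightarrow> integrable M (\<lambda>\<omega>. s \<omega> ^ i)"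
  unfolding s_def by (rule IX.S_integrable)

lemma z_power: "even i \<Longrightarrow> z \<omega> ^ i = s \<omega> ^ i / sqrt (real n) ^ i"
  by (simp add: z_def power_divide power_even_abs)

lemma z_integrable: "i \<le> 8 \<Longrightarrow> integrable M (\<lambda>\<omega>. z \<omega> ^ i)"
  unfolding z_def power_divide
  using integrable_abs[OF s_integrable[of i]] by (simp add: power_abs)

definition z4_const :: real where "z4_const = moment_const (1 + b) 2"
definition z8_const :: real where "z8_const = moment_const (1 + b) 4"
definition y8_const :: real where "y8_const = moment_const (1 + 2 ^ 8 * (b + 1)) 4"

lemma sqrt_power: "sqrt (real n) ^ (2 * j) = real n ^ j"
  by (simp add: power_mult)

lemma second_moment_z: "expectation (\<lambda>\<omega>. (z \<omega>)\<^sup>2) = 1"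
proof -
  have "expectation (\<lambda>\<omega>. (s \<omega>)\<^sup>2) = real n"
    unfolding s_def using IX.second_moment[of 1 n] variance_1 by simp
  then show ?thesis using n_pos by (simp add: z_power)
qed

lemma fourth_moment_z: "expectation (\<lambda>\<omega>. z \<omega> ^ 4) \<le> z4_const"
  using IX.even_moment_bound[of 2 n] n_pos sqrt_power[of 2]
  by (simp add: z_power s_def z4_const_def field_simps)

lemma eighth_moment_z: "expectation (\<lambda>\<omega>. z \<omega> ^ 8) \<le> z8_const"
  using IX.even_moment_bound[of 4 n] n_pos sqrt_power[of 4]
  by (simp add: z_power s_def z8_const_def field_simps)

lemma y_power8: "y \<omega> ^ 8 = IT.S n \<omega> ^ 8 / real n ^ 4"
  using sqrt_power[of 4] by (simp add: y_def power_divide power_even_abs IT_S)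

lemma y_integrable: "integrable M (\<lambda>\<omega>. y \<omega> ^ 8)"
  unfolding y_power8 using IT.S_integrable[of 8 n] by simp

lemma eighth_moment_y: "expectation (\<lambda>\<omega>. y \<omega> ^ 8) \<le> y8_const"
  using IT.even_moment_bound[of 4 n] n_pos
  by (simp add: y_power8 y8_const_def field_simps)

lemma q_power4: "q \<omega> ^ 4 = Q n \<omega> ^ 4 / real n ^ 4"
  by (simp add: q_def power_divide power_even_abs)

lemma q_integrable: "integrable M (\<lambda>\<omega>. q \<omega> ^ 4)"
  unfolding q_power4 using Q_fourth_moment(1)[of n] by simp

lemma fourth_moment_q: "expectation (\<lambda>\<omega>. q \<omega> ^ 4) \<le> b"
  using Q_fourth_moment(2)[of n] n_pos by (simp add: q_power4 field_simps)

lemma H_lipschitz: "\<bar>H x - H w\<bar> \<le> h1 * \<bar>x - w\<bar>"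
  using field_differentiable_bound[of UNIV H "deriv H" h1 x w] H_deriv h1 by simp

lemma H'_lipschitz: "\<bar>deriv H x - deriv H w\<bar> \<le> h2 * \<bar>x - w\<bar>"
  using field_differentiable_bound[of UNIV "deriv H" "deriv (deriv H)" h2 x w] H'_deriv h2 by simp

definition h :: real where "h = deriv H 0"
definition rem :: "real \<Rightarrow> real" where "rem x = H x - H 0 - h * x"

lemma rem_bound: "\<bar>rem x\<bar> \<le> h2 * x\<^sup>2"
proof -
  have "\<bar>(H x - h * x) - (H 0 - h * 0)\<bar> \<le> (h2 * \<bar>x\<bar>) * \<bar>x - 0\<bar>"
    unfolding real_norm_def[symmetric]
  proof (rule field_differentiable_bound[of "closed_segment 0 x" "\<lambda>x. H x - h * x" "\<lambda>x. deriv H x - h"])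
    fix u assume u: "u \<in> closed_segment 0 x"
    show "((\<lambda>x. H x - h * x) has_real_derivative deriv H u - h) (at u within closed_segment 0 x)"
      by (rule has_field_derivative_at_within) (auto intro!: derivative_eq_intros H_deriv)
    have "\<bar>u\<bar> \<le> \<bar>x\<bar>" using u by (auto simp: closed_segment_eq_real_ivl split: if_splits)
    then have "h2 * \<bar>u - 0\<bar> \<le> h2 * \<bar>x\<bar>" using h_nonneg by (intro mult_left_mono) auto
    then show "norm (deriv H u - h) \<le> h2 * norm x"
      using H'_lipschitz[of u 0] by (simp add: h_def)
  qed auto
  then show ?thesis by (simp add: rem_def power2_eq_square algebra_simps)
qed

lemma s_over_n: "\<bar>s \<omega> / real n\<bar> = z \<omega> / sqrt (real n)"
  using sqrt_n by (simp add: z_def)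

lemma HX_integrable: "integrable M (\<lambda>\<omega>. H (s \<omega> / real n))"
proof (rule Bochner_Integration.integrable_bound)
  show "integrable M (\<lambda>\<omega>. \<bar>H 0\<bar> + h1 * (z \<omega> ^ 1 / sqrt (real n)))"
    using z_integrable[of 1] by auto
  show "AE \<omega> in M. norm (H (s \<omega> / real n)) \<le> norm (\<bar>H 0\<bar> + h1 * (z \<omega> ^ 1 / sqrt (real n)))"
  proof (rule AE_I2)
    fix \<omega>
    have "\<bar>H (s \<omega> / real n) - H 0\<bar> \<le> h1 * (z \<omega> ^ 1 / sqrt (real n))"
      using H_lipschitz[of "s \<omega> / real n" 0] by (simp add: s_over_n del: abs_divide)
    then show "norm (H (s \<omega> / real n)) \<le> norm (\<bar>H 0\<bar> + h1 * (z \<omega> ^ 1 / sqrt (real n)))"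
      by simp
  qed
qed measurable

lemma rem_integrable: "integrable M (\<lambda>\<omega>. rem (s \<omega> / real n))"
  unfolding rem_def using HX_integrable s_integrable[of 1] by simp

lemma mean_s: "expectation s = 0"
proof -
  have "integrable M (X k)" if "k \<in> {1..n}" for k using IX.Y_integrable[of k 1] that by simp
  then show ?thesis
    unfolding s_def IX.S_def[abs_def]
    by (subst Bochner_Integration.integral_sum) (auto intro!: sum.neutral IX.mean)
qed

lemma first_moment_z: "expectation z \<le> 1"
proof -
  have "expectation z \<le> expectation (\<lambda>\<omega>. 1 / 2 + (z \<omega>)\<^sup>2 / 2)"
  proof (rule integral_mono)
    show "integrable M z" using z_integrable[of 1] by simp
    show "integrable M (\<lambda>\<omega>. 1 / 2 + (z \<omega>)\<^sup>2 / 2)" using z_integrable[of 2] by auto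
    show "z \<omega> \<le> 1 / 2 + (z \<omega>)\<^sup>2 / 2" for \<omega> using sum_squares_bound[of "z \<omega>" 1] by simp
  qed
  also have "\<dots> = 1" using z_integrable[of 2] second_moment_z by (simp add: prob_space)
  finally show ?thesis .
qed

lemma F_bound: "\<bar>F \<omega>\<bar> \<le> h1 * (z \<omega> + 1)"
proof -
  define E where "E = expectation (\<lambda>\<omega>. H (s \<omega> / real n))"
  have le: "\<bar>H (s \<omega> / real n) - H 0\<bar> \<le> h1 * (z \<omega> / sqrt (real n))" for \<omega>
    using H_lipschitz[of "s \<omega> / real n" 0] by (simp add: s_over_n del: abs_divide)
  have "E - H 0 = expectation (\<lambda>\<omega>. H (s \<omega> / real n) - H 0)"
    using HX_integrable by (simp add: E_def prob_space)
  also have "\<bar>\<dots>\<bar> \<le> expectation (\<lambda>\<omega>. \<bar>H (s \<omega> / real n) - H 0\<bar>)"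
    by (rule integral_abs_bound)
  also have "\<dots> \<le> expectation (\<lambda>\<omega>. h1 * (z \<omega> / sqrt (real n)))"
    using HX_integrable z_integrable[of 1] by (intro integral_mono le) auto
  also have "\<dots> = h1 / sqrt (real n) * expectation z" by simp
  also have "\<dots> \<le> h1 / sqrt (real n) * 1"
    using first_moment_z h_nonneg by (intro mult_left_mono) auto
  finally have E: "\<bar>E - H 0\<bar> \<le> h1 / sqrt (real n)" by simp
  have "\<bar>F \<omega>\<bar> = sqrt (real n) * \<bar>H (s \<omega> / real n) - E\<bar>"
    by (simp add: F_eq E_def abs_mult)
  also have "\<dots> \<le> sqrt (real n) * (h1 * (z \<omega> / sqrt (real n)) + h1 / sqrt (real n))"
    using le[of \<omega>] E by (intro mult_left_mono) (linarith, simp)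
  also have "\<dots> = h1 * (z \<omega> + 1)" using sqrt_n by (simp add: field_simps)
  finally show ?thesis .
qed

text \<open>The error of the linearisation \<open>H'(0) S/\<surd>n\<close> of \<open>F\<close>.\<close>

definition D :: "'a \<Rightarrow> real" where "D \<omega> = F \<omega> - h * (s \<omega> / sqrt (real n))"

lemma D_borel [measurable]: "D \<in> borel_measurable M"
  unfolding D_def[abs_def] by measurable

lemma D_bound: "\<bar>D \<omega>\<bar> \<le> h2 * ((z \<omega>)\<^sup>2 + 1) / sqrt (real n)"
proof -
  \<comment> \<open>The mean of the linear part vanishes, so centring F only subtracts the mean of the remainder.\<close>
  define E where "E = expectation (\<lambda>\<omega>. rem (s \<omega> / real n))"
  have le: "\<bar>rem (s \<omega> / real n)\<bar> \<le> h2 * ((z \<omega>)\<^sup>2 / real n)" for \<omega>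
  proof -
    have "(s \<omega> / real n)\<^sup>2 = (z \<omega>)\<^sup>2 / real n"
      using n_pos by (simp add: z_def power_divide power2_eq_square)
    then show ?thesis using rem_bound[of "s \<omega> / real n"] by simp
  qed
  have EH: "expectation (\<lambda>\<omega>. H (s \<omega> / real n)) = H 0 + E"
    unfolding E_def rem_def using HX_integrable s_integrable[of 1] mean_s by (simp add: prob_space)
  have "\<bar>E\<bar> \<le> expectation (\<lambda>\<omega>. \<bar>rem (s \<omega> / real n)\<bar>)"
    unfolding E_def by (rule integral_abs_bound)
  also have "\<dots> \<le> expectation (\<lambda>\<omega>. h2 * ((z \<omega>)\<^sup>2 / real n))"
    using rem_integrable z_integrable[of 2] by (intro integral_mono le) auto
  also have "\<dots> = h2 / real n" using second_moment_z by simp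
  finally have E: "\<bar>E\<bar> \<le> h2 / real n" .
  have "D \<omega> = sqrt (real n) * (rem (s \<omega> / real n) - E)"
    using sqrt_n n_pos by (simp add: D_def F_eq EH rem_def field_simps)
  then have "\<bar>D \<omega>\<bar> = sqrt (real n) * \<bar>rem (s \<omega> / real n) - E\<bar>" by (simp add: abs_mult)
  also have "\<dots> \<le> sqrt (real n) * (h2 * ((z \<omega>)\<^sup>2 / real n) + h2 / real n)"
    using le[of \<omega>] E by (intro mult_left_mono) (linarith, simp)
  also have "\<dots> = (sqrt (real n) / real n) * (h2 * ((z \<omega>)\<^sup>2 + 1))"
    by (simp add: divide_inverse algebra_simps)
  also have "sqrt (real n) / real n = 1 / sqrt (real n)"
    using sqrt_n n_pos by (simp add: field_simps)
  finally show ?thesis by simp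
qed

lemma F_square_integrable: "integrable M (\<lambda>\<omega>. (F \<omega>)\<^sup>2)"
proof -
  show ?thesis
  proof (rule Bochner_Integration.integrable_bound)
    have "integrable M (\<lambda>\<omega>. h1\<^sup>2 * ((z \<omega>)\<^sup>2 + 2 * z \<omega> ^ 1 + 1))"
      using z_integrable[of 1] z_integrable[of 2] by auto
    moreover have "(h1 * (z \<omega> + 1))\<^sup>2 = h1\<^sup>2 * ((z \<omega>)\<^sup>2 + 2 * z \<omega> ^ 1 + 1)" for \<omega>
      by (simp add: power2_eq_square algebra_simps)
    ultimately show "integrable M (\<lambda>\<omega>. (h1 * (z \<omega> + 1))\<^sup>2)" by simp
    show "AE \<omega> in M. norm ((F \<omega>)\<^sup>2) \<le> norm ((h1 * (z \<omega> + 1))\<^sup>2)"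
      using F_bound z_nonneg h_nonneg by (intro AE_I2) (auto simp: abs_le_square_iff[symmetric] abs_mult)
  qed measurable
qed

lemma mean_F: "expectation F = 0"
  unfolding F_eq[abs_def] using HX_integrable by (simp add: prob_space)

lemma \<sigma>2_eq: "\<sigma>2 = expectation (\<lambda>\<omega>. (F \<omega>)\<^sup>2)"
  using mean_F by (simp add: \<sigma>2_def delta_variance_def F_def)

lemma \<sigma>2_bounds: "0 \<le> \<sigma>2" "\<sigma>2 \<le> 4 * h1\<^sup>2"
proof -
  show "0 \<le> \<sigma>2" unfolding \<sigma>2_eq by (intro Bochner_Integration.integral_nonneg) auto
  have "\<sigma>2 \<le> expectation (\<lambda>\<omega>. h1\<^sup>2 * (2 * (z \<omega>)\<^sup>2 + 2))"
    unfolding \<sigma>2_eq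
  proof (rule integral_mono[OF F_square_integrable])
    show "integrable M (\<lambda>\<omega>. h1\<^sup>2 * (2 * (z \<omega>)\<^sup>2 + 2))" using z_integrable[of 2] by auto
    fix \<omega>
    have "(F \<omega>)\<^sup>2 \<le> (h1 * (z \<omega> + 1))\<^sup>2"
      using F_bound[of \<omega>] z_nonneg[of \<omega>] h_nonneg by (auto simp: abs_le_square_iff[symmetric] abs_mult)
    also have "\<dots> = h1\<^sup>2 * (z \<omega> + 1)\<^sup>2" by (simp add: power_mult_distrib)
    also have "\<dots> \<le> h1\<^sup>2 * (2 * (z \<omega>)\<^sup>2 + 2)"
      using sum_squares_bound[of "z \<omega>" 1] by (intro mult_left_mono) (auto simp: power2_sum)
    finally show "(F \<omega>)\<^sup>2 \<le> h1\<^sup>2 * (2 * (z \<omega>)\<^sup>2 + 2)" .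
  qed
  also have "\<dots> = 4 * h1\<^sup>2" using z_integrable[of 2] second_moment_z by (simp add: prob_space)
  finally show "\<sigma>2 \<le> 4 * h1\<^sup>2" .
qed

definition variance_const :: real where "variance_const = (4 * h1 * h2 + 2 * h2\<^sup>2) * (1 + z4_const)"

lemma variance_const_nonneg: "0 \<le> variance_const"
proof -
  have "0 \<le> z4_const" unfolding z4_const_def using IX.b_nonneg by (intro moment_const_nonneg) auto
  then show ?thesis using h_nonneg by (simp add: variance_const_def)
qed

text \<open>\<open>F = h w + D\<close> with \<open>E w\<^sup>2 = 1\<close> and \<open>D\<close> of order \<open>1/\<surd>n\<close>.\<close>

lemma variance_expansion: "\<bar>\<sigma>2 - h\<^sup>2\<bar> \<le> variance_const / sqrt (real n)"
proof -
  define w where "w = (\<lambda>\<omega>. s \<omega> / sqrt (real n))"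
  have w2: "(w \<omega>)\<^sup>2 = (z \<omega>)\<^sup>2" "\<bar>w \<omega>\<bar> = z \<omega>" for \<omega> by (auto simp: w_def z_def power_divide)
  have F: "F \<omega> = h * w \<omega> + D \<omega>" for \<omega> by (simp add: D_def w_def)
  have int_w2: "integrable M (\<lambda>\<omega>. (h * w \<omega>)\<^sup>2)"
    unfolding power_mult_distrib w2 using z_integrable[of 2] by simp
  have "\<sigma>2 - h\<^sup>2 = expectation (\<lambda>\<omega>. (F \<omega>)\<^sup>2 - (h * w \<omega>)\<^sup>2)"
    using F_square_integrable int_w2 second_moment_z by (simp add: \<sigma>2_eq power_mult_distrib w2)
  also have "\<bar>\<dots>\<bar> \<le> expectation (\<lambda>\<omega>. \<bar>(F \<omega>)\<^sup>2 - (h * w \<omega>)\<^sup>2\<bar>)" by (rule integral_abs_bound)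
  also have "\<dots> \<le> expectation (\<lambda>\<omega>. (4 * h1 * h2 + 2 * h2\<^sup>2) / sqrt (real n) * (1 + z \<omega> ^ 4))"
  proof (rule integral_mono)
    show "integrable M (\<lambda>\<omega>. \<bar>(F \<omega>)\<^sup>2 - (h * w \<omega>)\<^sup>2\<bar>)"
      using F_square_integrable int_w2 by auto
    show "integrable M (\<lambda>\<omega>. (4 * h1 * h2 + 2 * h2\<^sup>2) / sqrt (real n) * (1 + z \<omega> ^ 4))"
      using z_integrable[of 4] by auto
    fix \<omega>
    define k where "k = sqrt (real n)"
    define x where "x = z \<omega>"
    have k: "0 < k" "1 \<le> k" using sqrt_n by (auto simp: k_def)
    have x: "0 \<le> x" by (simp add: x_def z_nonneg)
    have D: "\<bar>D \<omega>\<bar> \<le> h2 * (x\<^sup>2 + 1) / k" using D_bound[of \<omega>] by (simp add: x_def k_def)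
    have p: "x ^ 1 \<le> 1 + x ^ 4" "x ^ 2 \<le> 1 + x ^ 4" "x ^ 3 \<le> 1 + x ^ 4"
      using power_le_one_plus[OF x, of 1 4] power_le_one_plus[OF x, of 2 4] power_le_one_plus[OF x, of 3 4]
      by simp_all
    have t1: "\<bar>2 * h * w \<omega> * D \<omega>\<bar> \<le> 4 * h1 * h2 / k * (1 + x ^ 4)"
    proof -
      have "\<bar>2 * h * w \<omega> * D \<omega>\<bar> = 2 * (\<bar>h\<bar> * x * \<bar>D \<omega>\<bar>)" by (simp add: abs_mult w2 x_def)
      also have "\<dots> \<le> 2 * (h1 * x * (h2 * (x\<^sup>2 + 1) / k))"
        using D x h1[of 0] h_nonneg k by (intro mult_left_mono mult_mono) (auto simp: h_def)
      also have "\<dots> = 2 * h1 * h2 / k * (x ^ 3 + x ^ 1)"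
        by (simp add: field_simps power2_eq_square power3_eq_cube)
      also have "\<dots> \<le> 2 * h1 * h2 / k * (2 * (1 + x ^ 4))"
        using p h_nonneg k by (intro mult_left_mono) auto
      also have "\<dots> = 4 * h1 * h2 / k * (1 + x ^ 4)" by (simp add: field_simps)
      finally show ?thesis .
    qed
    have t2: "(D \<omega>)\<^sup>2 \<le> 2 * h2\<^sup>2 / k * (1 + x ^ 4)"
    proof -
      have "(D \<omega>)\<^sup>2 \<le> (h2 * (x\<^sup>2 + 1) / k)\<^sup>2"
        using D x h_nonneg k by (subst abs_le_square_iff[symmetric]) auto
      also have "\<dots> = h2\<^sup>2 * (x\<^sup>2 + 1)\<^sup>2 / k\<^sup>2" by (simp add: power_mult_distrib power_divide)
      also have "\<dots> \<le> h2\<^sup>2 * (2 * (1 + x ^ 4)) / k"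
      proof (intro frac_le mult_left_mono)
        have "2 * x\<^sup>2 * 1 \<le> (x\<^sup>2)\<^sup>2 + 1\<^sup>2" by (rule sum_squares_bound)
        then show "(x\<^sup>2 + 1)\<^sup>2 \<le> 2 * (1 + x ^ 4)" by (simp add: power2_sum flip: power_mult)
        show "k \<le> k\<^sup>2" using k by (simp add: power2_eq_square)
      qed (use k in auto)
      finally show ?thesis by (simp add: field_simps)
    qed
    have "(F \<omega>)\<^sup>2 - (h * w \<omega>)\<^sup>2 = 2 * h * w \<omega> * D \<omega> + (D \<omega>)\<^sup>2"
      by (simp add: F power2_sum algebra_simps)
    then have "\<bar>(F \<omega>)\<^sup>2 - (h * w \<omega>)\<^sup>2\<bar> \<le> \<bar>2 * h * w \<omega> * D \<omega>\<bar> + (D \<omega>)\<^sup>2"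
      by (metis abs_power2 abs_triangle_ineq)
    also have "\<dots> \<le> 4 * h1 * h2 / k * (1 + x ^ 4) + 2 * h2\<^sup>2 / k * (1 + x ^ 4)"
      by (rule add_mono[OF t1 t2])
    also have "\<dots> = (4 * h1 * h2 + 2 * h2\<^sup>2) / k * (1 + x ^ 4)"
      by (simp add: add_divide_distrib distrib_right)
    finally show "\<bar>(F \<omega>)\<^sup>2 - (h * w \<omega>)\<^sup>2\<bar> \<le> (4 * h1 * h2 + 2 * h2\<^sup>2) / sqrt (real n) * (1 + z \<omega> ^ 4)"
      by (simp add: x_def k_def)
  qed
  also have "\<dots> = (4 * h1 * h2 + 2 * h2\<^sup>2) / sqrt (real n) * (1 + expectation (\<lambda>\<omega>. z \<omega> ^ 4))"
    using z_integrable[of 4] by (simp add: prob_space)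
  also have "\<dots> \<le> (4 * h1 * h2 + 2 * h2\<^sup>2) / sqrt (real n) * (1 + z4_const)"
    using fourth_moment_z h_nonneg by (intro mult_left_mono) auto
  also have "\<dots> = variance_const / sqrt (real n)" by (simp add: variance_const_def)
  finally show ?thesis .
qed

text \<open>Minus the score of \<open>S\<close>, divided by the derivative \<open>H'(S/n)/\<surd>n\<close> of \<open>F\<close> as a function of \<open>S\<close>; the second
  summand comes from differentiating that divisor.\<close>

definition U :: "'a \<Rightarrow> real" where
  "U \<omega> = sqrt (real n) * (s \<omega> / T n \<omega> + Q n \<omega> / (T n \<omega>)\<^sup>2) / deriv H (s \<omega> / real n)
     + deriv (deriv H) (s \<omega> / real n) / (sqrt (real n) * (deriv H (s \<omega> / real n))\<^sup>2)"

lemma U_borel [measurable]: "U \<in> borel_measurable M"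
  unfolding U_def[abs_def] by measurable

lemma r_integrable: "i \<le> 8 \<Longrightarrow> integrable M (\<lambda>\<omega>. r \<omega> ^ i)"
  using integrable_power_le(2)[of r 8 i] r_int by (simp add: r_def[abs_def] power_divide)

lemma sT_integrable: "integrable M (\<lambda>\<omega>. s \<omega> / T n \<omega>)"
proof (rule Bochner_Integration.integrable_bound)
  show "integrable M (\<lambda>\<omega>. ((s \<omega>)\<^sup>2 + (r \<omega>)\<^sup>2) / real n)"
    using s_integrable[of 2] r_integrable[of 2] by auto
  show "AE \<omega> in M. norm (s \<omega> / T n \<omega>) \<le> norm (((s \<omega>)\<^sup>2 + (r \<omega>)\<^sup>2) / real n)"
  proof (rule AE_I2)
    fix \<omega>
    have "\<bar>s \<omega>\<bar> * \<bar>r \<omega>\<bar> \<le> (s \<omega>)\<^sup>2 + (r \<omega>)\<^sup>2"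
      using mult_le_sum_squares[of "\<bar>s \<omega>\<bar>" "\<bar>r \<omega>\<bar>"] by simp
    then have "\<bar>s \<omega>\<bar> * \<bar>r \<omega>\<bar> / real n \<le> ((s \<omega>)\<^sup>2 + (r \<omega>)\<^sup>2) / real n"
      by (rule divide_right_mono) simp
    moreover have "\<bar>s \<omega> / T n \<omega>\<bar> = \<bar>s \<omega>\<bar> * \<bar>r \<omega>\<bar> / real n" using n_pos by (simp add: r_def)
    ultimately show "norm (s \<omega> / T n \<omega>) \<le> norm (((s \<omega>)\<^sup>2 + (r \<omega>)\<^sup>2) / real n)" by simp
  qed
qed measurable

lemma QT_integrable: "integrable M (\<lambda>\<omega>. Q n \<omega> / (T n \<omega>)\<^sup>2)"
proof (rule Bochner_Integration.integrable_bound)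
  show "integrable M (\<lambda>\<omega>. q \<omega> ^ 2 + r \<omega> ^ 4)"
    using integrable_power_le(2)[of q 4 2] q_integrable r_integrable[of 4]
    by (auto simp: power_even_abs)
  show "AE \<omega> in M. norm (Q n \<omega> / (T n \<omega>)\<^sup>2) \<le> norm (q \<omega> ^ 2 + r \<omega> ^ 4)"
  proof (rule AE_I2)
    fix \<omega>
    have *: "q \<omega> * (r \<omega>)\<^sup>2 \<le> (q \<omega>)\<^sup>2 + r \<omega> ^ 4"
      using mult_le_sum_squares[of "q \<omega>" "(r \<omega>)\<^sup>2"] by (simp flip: power_mult)
    have "\<bar>Q n \<omega> / (T n \<omega>)\<^sup>2\<bar> = q \<omega> * (r \<omega>)\<^sup>2 / real n"
      using n_pos by (simp add: q_def r_def power_divide power2_eq_square)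
    also have "\<dots> \<le> q \<omega> * (r \<omega>)\<^sup>2 / 1"
      using n q_nonneg[of \<omega>] by (intro divide_left_mono) auto
    finally show "norm (Q n \<omega> / (T n \<omega>)\<^sup>2) \<le> norm (q \<omega> ^ 2 + r \<omega> ^ 4)" using * by simp
  qed
qed measurable

lemma inverse_H': "\<bar>1 / deriv H x\<bar> \<le> 1 / m" "deriv H x \<noteq> 0"
  using m(1) m(2)[of x] by (auto simp: abs_divide intro!: divide_left_mono)

lemma U_parts_integrable:
  "integrable M (\<lambda>\<omega>. sqrt (real n) * (s \<omega> / T n \<omega> + Q n \<omega> / (T n \<omega>)\<^sup>2) / deriv H (s \<omega> / real n))" (is "integrable M ?A")
  "integrable M (\<lambda>\<omega>. deriv (deriv H) (s \<omega> / real n) / (sqrt (real n) * (deriv H (s \<omega> / real n))\<^sup>2))" (is "integrable M ?B")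
proof -
  show "integrable M ?A"
  proof (rule Bochner_Integration.integrable_bound)
    show "integrable M (\<lambda>\<omega>. sqrt (real n) * (s \<omega> / T n \<omega> + Q n \<omega> / (T n \<omega>)\<^sup>2) / m)"
      using sT_integrable QT_integrable by auto
    show "AE \<omega> in M. norm (?A \<omega>) \<le> norm (sqrt (real n) * (s \<omega> / T n \<omega> + Q n \<omega> / (T n \<omega>)\<^sup>2) / m)"
      unfolding real_norm_def abs_divide[of "sqrt (real n) * _"]
      using m by (intro AE_I2 divide_left_mono) (auto simp: inverse_H'(2))
  qed measurable
  show "integrable M ?B"
  proof (rule integrable_const_bound[where B = "h2 / (sqrt (real n) * m\<^sup>2)"])
    show "AE \<omega> in M. norm (?B \<omega>) \<le> h2 / (sqrt (real n) * m\<^sup>2)"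
    proof (rule AE_I2)
      fix \<omega>
      have "m\<^sup>2 \<le> (deriv H (s \<omega> / real n))\<^sup>2"
        using m by (subst abs_le_square_iff[symmetric]) auto
      then show "norm (?B \<omega>) \<le> h2 / (sqrt (real n) * m\<^sup>2)"
        unfolding real_norm_def abs_divide using h2 m sqrt_n h_nonneg
        by (intro frac_le) (auto simp: abs_mult intro!: mult_left_mono)
    qed
  qed measurable
qed

lemma U_integrable: "integrable M U"
  unfolding U_def[abs_def] by (intro Bochner_Integration.integrable_add U_parts_integrable)

theorem score_of_F:
  assumes \<phi>: "\<And>x. (\<phi> has_real_derivative \<phi>' x) (at x)" "continuous_on UNIV \<phi>'"
    "\<And>x. \<bar>\<phi> x\<bar> \<le> B" "\<And>x. \<bar>\<phi>' x\<bar> \<le> B"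
  shows "expectation (\<lambda>\<omega>. \<phi>' (F \<omega>)) = expectation (\<lambda>\<omega>. \<phi> (F \<omega>) * U \<omega>)"
proof -
  have [measurable]: "\<phi>' \<in> borel_measurable borel" using \<phi>(2) by (rule borel_measurable_continuous_onI)
  have [measurable]: "\<phi> \<in> borel_measurable borel"
    using DERIV_isCont[OF \<phi>(1)]
    by (intro borel_measurable_continuous_onI continuous_at_imp_continuous_on) auto
  define k where "k = sqrt (real n)"
  have k: "0 < k" "real n = k * k" using sqrt_n by (auto simp: k_def)
  have B: "0 \<le> B" using \<phi>(3)[of 0] by simp
  define E where "E = expectation (\<lambda>\<omega>. H (s \<omega> / real n))"
  define G where "G = (\<lambda>x. k * (H (x / real n) - E))"
  \<comment> \<open>Division by the derivative of G makes a' start with phi'(G) alone.\<close>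
  define a where "a = (\<lambda>x. k * \<phi> (G x) / deriv H (x / real n))"
  define a2 where "a2 = (\<lambda>x. \<phi> (G x) * (deriv (deriv H) (x / real n) / (k * (deriv H (x / real n))\<^sup>2)))"
  define a' where "a' = (\<lambda>x. \<phi>' (G x) - a2 x)"
  have G: "G (s \<omega>) = F \<omega>" for \<omega> by (simp add: G_def F_eq k_def E_def)
  have a_deriv: "(a has_real_derivative a' x) (at x)" for x
  proof -
    define u where "u = deriv H (x / real n)"
    define v where "v = deriv (deriv H) (x / real n)"
    have u: "u \<noteq> 0" unfolding u_def by (rule inverse_H')
    have inner: "((\<lambda>x. x / real n) has_real_derivative 1 / real n) (at x)"
      by (intro DERIV_cdivide DERIV_ident)
    have dH: "((\<lambda>x. H (x / real n)) has_real_derivative u * (1 / real n)) (at x)"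
      unfolding u_def by (rule DERIV_chain2[OF H_deriv inner])
    have dH': "((\<lambda>x. deriv H (x / real n)) has_real_derivative v * (1 / real n)) (at x)"
      unfolding v_def by (rule DERIV_chain2[OF H'_deriv inner])
    have dG: "(G has_real_derivative k * (u * (1 / real n))) (at x)"
      unfolding G_def using dH by (auto intro!: derivative_eq_intros)
    have d\<phi>: "((\<lambda>x. k * \<phi> (G x)) has_real_derivative k * (\<phi>' (G x) * (k * (u * (1 / real n))))) (at x)"
      by (intro DERIV_cmult DERIV_chain2[OF \<phi>(1) dG])
    have "(a has_real_derivative
        (k * (\<phi>' (G x) * (k * (u * (1 / real n)))) * u - k * \<phi> (G x) * (v * (1 / real n))) / (u * u)) (at x)"
      unfolding a_def u_def[symmetric]
      using DERIV_divide[OF d\<phi> dH'] u by (simp add: u_def)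
    also have "(k * (\<phi>' (G x) * (k * (u * (1 / real n)))) * u - k * \<phi> (G x) * (v * (1 / real n))) / (u * u) = a' x"
      proof -
      have "a' x = \<phi>' (G x) - \<phi> (G x) * (v / (k * u\<^sup>2))"
        by (simp add: a'_def a2_def u_def v_def)
      then show ?thesis
        unfolding k(2) using u k(1) by (simp add: field_simps power2_eq_square)
    qed
    finally show ?thesis .
  qed
  have a_bound: "\<bar>a x\<bar> \<le> k * B / m" for x
  proof -
    have "\<bar>a x\<bar> = k * \<bar>\<phi> (G x)\<bar> / \<bar>deriv H (x / real n)\<bar>" using k by (simp add: a_def abs_mult)
    also have "\<dots> \<le> k * B / m" using \<phi>(3) m k B by (intro frac_le mult_left_mono mult_nonneg_nonneg) auto
    finally show ?thesis .
  qed
  have a2_bound: "\<bar>a2 x\<bar> \<le> B * (h2 / (k * m\<^sup>2))" for x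
  proof -
    have "m\<^sup>2 \<le> (deriv H (x / real n))\<^sup>2"
      using m by (subst abs_le_square_iff[symmetric]) auto
    then have "\<bar>deriv (deriv H) (x / real n) / (k * (deriv H (x / real n))\<^sup>2)\<bar> \<le> h2 / (k * m\<^sup>2)"
      unfolding abs_divide using h2 m k h_nonneg
      by (intro frac_le) (auto simp: abs_mult intro!: mult_left_mono)
    then show ?thesis unfolding a2_def abs_mult using \<phi>(3) B by (intro mult_mono) auto
  qed
  have a'_bound: "\<bar>a' x\<bar> \<le> B + B * (h2 / (k * m\<^sup>2))" for x
    unfolding a'_def by (rule order_trans[OF abs_triangle_ineq4 add_mono[OF \<phi>(4) a2_bound]])
  define B' where "B' = k * B / m + (B + B * (h2 / (k * m\<^sup>2)))"
  have B': "\<bar>a x\<bar> \<le> B'" "\<bar>a' x\<bar> \<le> B'" for x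
    using a_bound[of x] a'_bound[of x] abs_ge_zero[of "a x"] abs_ge_zero[of "a' x"]
    unfolding B'_def by linarith+
  have [measurable]: "G \<in> borel_measurable borel" unfolding G_def by measurable
  have [measurable]: "a2 \<in> borel_measurable borel" unfolding a2_def by measurable
  have a'_borel: "a' \<in> borel_measurable borel" unfolding a'_def by measurable
  have "expectation (\<lambda>\<omega>. a' (s \<omega>)) = expectation (\<lambda>\<omega>. a (s \<omega>) * (s \<omega> / T n \<omega> + Q n \<omega> / (T n \<omega>)\<^sup>2))"
    unfolding s_def
    by (rule score_of_sum[OF a_deriv a'_borel B' T_pos]) (use sT_integrable QT_integrable in \<open>auto simp: s_def\<close>)
  moreover have int_a2: "integrable M (\<lambda>\<omega>. a2 (s \<omega>))"
    by (rule integrable_const_bound[where B = "B * (h2 / (k * m\<^sup>2))"]) (use a2_bound in auto)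
  moreover have int_\<phi>': "integrable M (\<lambda>\<omega>. \<phi>' (F \<omega>))"
    by (rule integrable_const_bound[where B = B]) (use \<phi>(4) in auto)
  ultimately have "expectation (\<lambda>\<omega>. \<phi>' (F \<omega>))
      = expectation (\<lambda>\<omega>. a (s \<omega>) * (s \<omega> / T n \<omega> + Q n \<omega> / (T n \<omega>)\<^sup>2)) + expectation (\<lambda>\<omega>. a2 (s \<omega>))"
    by (simp add: a'_def G)
  also have "\<dots> = expectation (\<lambda>\<omega>. a (s \<omega>) * (s \<omega> / T n \<omega> + Q n \<omega> / (T n \<omega>)\<^sup>2) + a2 (s \<omega>))"
  proof (rule Bochner_Integration.integral_add[symmetric, OF _ int_a2])
    have "integrable M (\<lambda>\<omega>. \<phi> (F \<omega>) * (sqrt (real n) * (s \<omega> / T n \<omega> + Q n \<omega> / (T n \<omega>)\<^sup>2) / deriv H (s \<omega> / real n)))"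
    proof (rule Bochner_Integration.integrable_bound)
      show "integrable M (\<lambda>\<omega>. B * \<bar>sqrt (real n) * (s \<omega> / T n \<omega> + Q n \<omega> / (T n \<omega>)\<^sup>2) / deriv H (s \<omega> / real n)\<bar>)"
        by (intro integrable_mult_right integrable_abs U_parts_integrable)
      show "AE \<omega> in M. norm (\<phi> (F \<omega>) * (sqrt (real n) * (s \<omega> / T n \<omega> + Q n \<omega> / (T n \<omega>)\<^sup>2) / deriv H (s \<omega> / real n)))
        \<le> norm (B * \<bar>sqrt (real n) * (s \<omega> / T n \<omega> + Q n \<omega> / (T n \<omega>)\<^sup>2) / deriv H (s \<omega> / real n)\<bar>)"
        unfolding real_norm_def abs_mult[of "\<phi> _"] abs_mult[of B] abs_abs
        using \<phi>(3) B by (intro AE_I2 mult_right_mono) auto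
    qed measurable
    then show "integrable M (\<lambda>\<omega>. a (s \<omega>) * (s \<omega> / T n \<omega> + Q n \<omega> / (T n \<omega>)\<^sup>2))"
      by (simp add: a_def G k_def mult_ac)
  qed
  also have "\<dots> = expectation (\<lambda>\<omega>. \<phi> (F \<omega>) * U \<omega>)"
    by (simp add: a_def a2_def G k_def U_def distrib_left add_divide_distrib mult_ac)
  finally show ?thesis .
qed

text \<open>A degenerate \<open>F\<close> would vanish almost surely, and the identity for \<open>\<phi> = sin\<close> would read \<open>1 = 0\<close>.\<close>

lemma \<sigma>2_pos: "0 < \<sigma>2"
proof (rule ccontr)
  assume "\<not> 0 < \<sigma>2"
  then have "\<sigma>2 = 0" using \<sigma>2_bounds(1) by linarith
  then have "expectation (\<lambda>\<omega>. (F \<omega>)\<^sup>2) = 0" by (simp add: \<sigma>2_eq)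
  then have F0: "AE \<omega> in M. F \<omega> = 0"
    using integral_nonneg_eq_0_iff_AE[OF F_square_integrable] by simp
  have "expectation (\<lambda>\<omega>. cos (F \<omega>)) = expectation (\<lambda>\<omega>. sin (F \<omega>) * U \<omega>)"
    by (rule score_of_F[of sin cos 1]) (auto intro!: continuous_intros DERIV_sin)
  moreover have "expectation (\<lambda>\<omega>. cos (F \<omega>)) = expectation (\<lambda>\<omega>. 1)"
    using F0 by (intro integral_cong_AE) (auto elim: eventually_mono)
  moreover have "expectation (\<lambda>\<omega>. sin (F \<omega>) * U \<omega>) = expectation (\<lambda>\<omega>. 0)"
    using F0 by (intro integral_cong_AE) (auto elim: eventually_mono)
  ultimately show False by (simp add: prob_space)
qed


definition numerator_const :: real where "numerator_const = h1\<^sup>2 + 3 * h1 * h2 + variance_const"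
definition discrepancy_const :: real where "discrepancy_const = numerator_const / m + 4 * h1\<^sup>2 / m + 4 * h1\<^sup>2 * h2 / m\<^sup>2"
definition v :: "'a \<Rightarrow> real" where "v \<omega> = (1 + (z \<omega>)\<^sup>2) + ((y \<omega>)\<^sup>2 + q \<omega>)"

lemma const_nonneg: "0 \<le> numerator_const" "0 \<le> discrepancy_const"
proof -
  show "0 \<le> numerator_const" using h_nonneg variance_const_nonneg by (simp add: numerator_const_def)
  then show "0 \<le> discrepancy_const" using h_nonneg m by (simp add: discrepancy_const_def)
qed

lemma v_borel [measurable]: "v \<in> borel_measurable M"
  unfolding v_def[abs_def] by measurable

text \<open>The leading terms of \<open>F H' T\<close> and \<open>\<sigma>\<^sup>2 \<surd>n S\<close> are both \<open>H'(0)\<^sup>2 \<surd>n S\<close>. The difference splits into the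
  errors of the four replacements \<open>T \<leadsto> n\<close>, \<open>H'(S/n) \<leadsto> H'(0)\<close>, \<open>F \<leadsto> H'(0) S/\<surd>n\<close> and
  \<open>\<sigma>\<^sup>2 \<leadsto> H'(0)\<^sup>2\<close>, each of order \<open>\<surd>n\<close>.\<close>

lemma numerator_bound:
  "\<bar>F \<omega> * deriv H (s \<omega> / real n) * T n \<omega> - \<sigma>2 * sqrt (real n) * s \<omega>\<bar>
    \<le> sqrt (real n) * (numerator_const * v \<omega>)"
proof -
  define k where "k = sqrt (real n)"
  define x w d Y where "x = s \<omega>" and "w = z \<omega>" and "d = deriv H (s \<omega> / real n)" and "Y = y \<omega>"
  have k: "0 < k" "real n = k * k" using sqrt_n by (auto simp: k_def)
  have w: "0 \<le> w" and Y: "0 \<le> Y" by (simp_all add: w_def Y_def z_nonneg y_nonneg)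
  have x: "\<bar>x\<bar> = k * w" and t: "\<bar>T n \<omega> - k * k\<bar> = k * Y"
    using k by (simp_all add: x_def w_def z_def Y_def y_def flip: k_def)
  have d1: "\<bar>d\<bar> \<le> h1" by (simp add: d_def h1)
  have d2: "\<bar>d - h\<bar> \<le> h2 * (w / k)"
    using H'_lipschitz[of "s \<omega> / real n" 0] by (simp add: d_def h_def w_def k_def s_over_n del: abs_divide)
  have F1: "\<bar>F \<omega>\<bar> \<le> h1 * (w + 1)" using F_bound[of \<omega>] by (simp add: w_def)
  have D1: "\<bar>D \<omega>\<bar> \<le> h2 * (w\<^sup>2 + 1) / k" using D_bound[of \<omega>] by (simp add: w_def k_def)
  have V: "\<bar>h\<^sup>2 - \<sigma>2\<bar> \<le> variance_const / k" using variance_expansion by (simp add: k_def)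
  have hh: "\<bar>h\<bar> \<le> h1" by (simp add: h_def h1)
  define W where "W = 1 + w\<^sup>2 + Y\<^sup>2"
  have W: "(w + 1) * Y \<le> W" "(w + 1) * w \<le> 2 * W" "w\<^sup>2 + 1 \<le> W" "w \<le> W"
  proof -
    have W_eq: "W = 1 + w * w + Y * Y" by (simp add: W_def power2_eq_square)
    have sq: "2 * (w * Y) \<le> w * w + Y * Y" "2 * Y \<le> 1 + Y * Y" "2 * w \<le> w * w + 1"
      using sum_squares_bound[of w Y] sum_squares_bound[of 1 Y] sum_squares_bound[of w 1]
      by (simp_all add: power2_eq_square)
    have nonneg: "0 \<le> w * w" "0 \<le> Y * Y" by simp_all
    show "(w + 1) * Y \<le> W" using sq nonneg unfolding W_eq distrib_right by linarith
    have "(w + 1) * w = w * w + w" by (simp add: distrib_right)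
    then show "(w + 1) * w \<le> 2 * W" using sq(3) nonneg W_eq by linarith
    show "w\<^sup>2 + 1 \<le> W" by (simp add: W_def)
    show "w \<le> W" using sq nonneg unfolding W_eq by linarith
  qed
  have t1: "\<bar>F \<omega> * d * (T n \<omega> - k * k)\<bar> \<le> k * (h1\<^sup>2 * W)"
  proof -
    have "\<bar>F \<omega> * d * (T n \<omega> - k * k)\<bar> \<le> h1 * (w + 1) * h1 * (k * Y)"
      unfolding abs_mult t using F1 d1 h_nonneg w k Y by (intro mult_mono) auto
    also have "\<dots> = k * (h1\<^sup>2 * ((w + 1) * Y))" by (simp add: power2_eq_square mult_ac)
    also have "\<dots> \<le> k * (h1\<^sup>2 * W)" using W k by (intro mult_left_mono) auto
    finally show ?thesis .
  qed
  have t2: "\<bar>k * k * (F \<omega> * (d - h))\<bar> \<le> k * (2 * h1 * h2 * W)"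
  proof -
    have "\<bar>k * k * (F \<omega> * (d - h))\<bar> \<le> k * k * (h1 * (w + 1) * (h2 * (w / k)))"
      unfolding abs_mult using F1 d2 h_nonneg w k by (intro mult_mono) auto
    also have "\<dots> = k * (h1 * h2 * ((w + 1) * w))" using k by (simp add: field_simps)
    also have "\<dots> \<le> k * (h1 * h2 * (2 * W))" using W k h_nonneg by (intro mult_left_mono) auto
    finally show ?thesis by (simp add: mult_ac)
  qed
  have t3: "\<bar>k * k * (h * D \<omega>)\<bar> \<le> k * (h1 * h2 * W)"
  proof -
    have "\<bar>k * k * (h * D \<omega>)\<bar> \<le> k * k * (h1 * (h2 * (w\<^sup>2 + 1) / k))"
      unfolding abs_mult using hh D1 h_nonneg w k by (intro mult_mono) auto
    also have "\<dots> = k * (h1 * h2 * (w\<^sup>2 + 1))" using k by (simp add: field_simps)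
    also have "\<dots> \<le> k * (h1 * h2 * W)" using W k h_nonneg by (intro mult_left_mono) auto
    finally show ?thesis .
  qed
  have t4: "\<bar>k * x * (h\<^sup>2 - \<sigma>2)\<bar> \<le> k * (variance_const * W)"
  proof -
    have "\<bar>k * x * (h\<^sup>2 - \<sigma>2)\<bar> \<le> k * (k * w) * (variance_const / k)"
      unfolding abs_mult x using V w k by (intro mult_mono) auto
    also have "\<dots> = k * (variance_const * w)" using k by simp
    also have "\<dots> \<le> k * (variance_const * W)" using W k variance_const_nonneg by (intro mult_left_mono) auto
    finally show ?thesis .
  qed
  have "F \<omega> * d * T n \<omega> - \<sigma>2 * k * x
      = F \<omega> * d * (T n \<omega> - k * k) + k * k * (F \<omega> * (d - h)) + k * k * (h * D \<omega>) + k * x * (h\<^sup>2 - \<sigma>2)"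
    using k by (simp add: D_def x_def k_def[symmetric] field_simps power2_eq_square)
  also have "\<bar>\<dots>\<bar> \<le> k * (h1\<^sup>2 * W) + k * (2 * h1 * h2 * W) + k * (h1 * h2 * W) + k * (variance_const * W)"
    using t1 t2 t3 t4 by linarith
  also have "\<dots> = k * (numerator_const * W)" by (simp add: numerator_const_def algebra_simps)
  also have "\<dots> \<le> k * (numerator_const * v \<omega>)"
    using k const_nonneg q_nonneg[of \<omega>]
    by (intro mult_left_mono) (auto simp: v_def W_def w_def Y_def)
  finally show ?thesis by (simp add: d_def k_def x_def)
qed

text \<open>Multiplied by \<open>\<surd>n\<close>, the three parts of \<open>F - \<sigma>\<^sup>2 U\<close> are of the sizes \<open>v r\<close>, \<open>q r\<^sup>2\<close> and \<open>1\<close>.\<close>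

lemma discrepancy_bound:
  assumes T: "0 < T n \<omega>"
  shows "sqrt (real n) * \<bar>F \<omega> - \<sigma>2 * U \<omega>\<bar> \<le> discrepancy_const * (v \<omega> * (1 + (r \<omega>)\<^sup>2))"
proof -
  define k where "k = sqrt (real n)"
  define x d e A where "x = s \<omega>" and "d = deriv H (s \<omega> / real n)" and "e = deriv (deriv H) (s \<omega> / real n)"
    and "A = F \<omega> * d * T n \<omega> - \<sigma>2 * k * x"
  have k: "0 < k" "real n = k * k" using sqrt_n by (auto simp: k_def)
  have d: "d \<noteq> 0" "m \<le> \<bar>d\<bar>" using m inverse_H' by (auto simp: d_def)
  have r: "r \<omega> = k * k / T n \<omega>" "0 < r \<omega>" using T k by (auto simp: r_def)
  have v1: "1 \<le> v \<omega>" "q \<omega> \<le> v \<omega>" "0 \<le> v \<omega>" using q_nonneg[of \<omega>] by (auto simp: v_def)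
  have r1: "r \<omega> \<le> 1 + (r \<omega>)\<^sup>2" "(r \<omega>)\<^sup>2 \<le> 1 + (r \<omega>)\<^sup>2" "1 \<le> 1 + (r \<omega>)\<^sup>2"
    using power_le_one_plus[of "r \<omega>" 1 2] r by auto
  define P where "P = v \<omega> * (1 + (r \<omega>)\<^sup>2)"
  have eq: "k * (F \<omega> - \<sigma>2 * U \<omega>) = k * A / (d * T n \<omega>) - \<sigma>2 * (k * k * Q n \<omega>) / (d * (T n \<omega>)\<^sup>2) - \<sigma>2 * e / d\<^sup>2"
  proof -
    have 1: "k * A / (d * T n \<omega>) = k * F \<omega> - \<sigma>2 * (k * k * x) / (d * T n \<omega>)"
      using d T by (simp add: A_def right_diff_distrib diff_divide_distrib mult_ac)
    have "U \<omega> = k * (x / T n \<omega> + Q n \<omega> / (T n \<omega>)\<^sup>2) / d + e / (k * d\<^sup>2)"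
      by (simp add: U_def k_def x_def d_def e_def)
    then have 2: "k * U \<omega> = k * k * x / (d * T n \<omega>) + k * k * Q n \<omega> / (d * (T n \<omega>)\<^sup>2) + e / d\<^sup>2"
      using k(1) by (simp add: distrib_left add_divide_distrib mult_ac)
    have "k * (F \<omega> - \<sigma>2 * U \<omega>) = k * F \<omega> - \<sigma>2 * (k * U \<omega>)" by (simp add: algebra_simps)
    then show ?thesis unfolding 1 2 by (simp add: distrib_left)
  qed
  have t1: "\<bar>k * A / (d * T n \<omega>)\<bar> \<le> numerator_const / m * P"
  proof -
    have "\<bar>A\<bar> \<le> k * (numerator_const * v \<omega>)"
      using numerator_bound[of \<omega>] by (simp add: A_def k_def d_def x_def)
    then have "k * \<bar>A\<bar> / (\<bar>d\<bar> * T n \<omega>) \<le> k * (k * (numerator_const * v \<omega>)) / (m * T n \<omega>)"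
      using k m T d const_nonneg v1 by (intro frac_le mult_left_mono mult_right_mono) auto
    also have "\<dots> = numerator_const / m * (v \<omega> * r \<omega>)" using T m by (simp add: r field_simps)
    also have "\<dots> \<le> numerator_const / m * P"
      unfolding P_def using r1 v1 m const_nonneg by (intro mult_left_mono) auto
    finally show ?thesis using k T by (simp add: abs_mult)
  qed
  have t2: "\<bar>\<sigma>2 * (k * k * Q n \<omega>) / (d * (T n \<omega>)\<^sup>2)\<bar> \<le> 4 * h1\<^sup>2 / m * P"
  proof -
    have "\<sigma>2 * (k * k * \<bar>Q n \<omega>\<bar>) / (\<bar>d\<bar> * (T n \<omega>)\<^sup>2) \<le> (4 * h1\<^sup>2) * (k * k * \<bar>Q n \<omega>\<bar>) / (m * (T n \<omega>)\<^sup>2)"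
      using k m T d \<sigma>2_bounds by (intro frac_le mult_right_mono) auto
    also have "\<dots> = 4 * h1\<^sup>2 / m * (q \<omega> * (r \<omega>)\<^sup>2)"
      using T m k(1) by (simp add: q_def k(2) r power_divide field_simps power2_eq_square)
    also have "\<dots> \<le> 4 * h1\<^sup>2 / m * P"
      unfolding P_def using r1 v1 m by (intro mult_left_mono mult_mono) auto
    finally show ?thesis using k T \<sigma>2_bounds by (simp add: abs_mult)
  qed
  have t3: "\<bar>\<sigma>2 * e / d\<^sup>2\<bar> \<le> 4 * h1\<^sup>2 * h2 / m\<^sup>2 * P"
  proof -
    have "\<bar>e\<bar> \<le> h2" by (simp add: e_def h2)
    moreover have "m\<^sup>2 \<le> d\<^sup>2" using d m by (subst abs_le_square_iff[symmetric]) auto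
    ultimately have "\<sigma>2 * \<bar>e\<bar> / d\<^sup>2 \<le> 4 * h1\<^sup>2 * h2 / m\<^sup>2"
      using m \<sigma>2_bounds h_nonneg by (intro frac_le mult_mono) auto
    also have "\<dots> \<le> 4 * h1\<^sup>2 * h2 / m\<^sup>2 * P"
    proof -
      have "1 * 1 \<le> P" unfolding P_def using r1 v1 by (intro mult_mono) auto
      then have "4 * h1\<^sup>2 * h2 / m\<^sup>2 * 1 \<le> 4 * h1\<^sup>2 * h2 / m\<^sup>2 * P"
        using h_nonneg m by (intro mult_left_mono) auto
      then show ?thesis by simp
    qed
    finally show ?thesis using \<sigma>2_bounds by (simp add: abs_mult)
  qed
  have "k * \<bar>F \<omega> - \<sigma>2 * U \<omega>\<bar> = \<bar>k * (F \<omega> - \<sigma>2 * U \<omega>)\<bar>" using k by (simp add: abs_mult)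
  also have "\<dots> \<le> numerator_const / m * P + 4 * h1\<^sup>2 / m * P + 4 * h1\<^sup>2 * h2 / m\<^sup>2 * P"
    unfolding eq using t1 t2 t3 by linarith
  also have "\<dots> = discrepancy_const * P" by (simp add: discrepancy_const_def distrib_right)
  finally show ?thesis by (simp add: k_def P_def)
qed

definition v4_const :: real where "v4_const = 2 ^ 8 * (1 + z8_const + y8_const + b)"

lemma v_fourth_moment: "integrable M (\<lambda>\<omega>. v \<omega> ^ 4)" "expectation (\<lambda>\<omega>. v \<omega> ^ 4) \<le> v4_const"
proof -
  define w where "w = (\<lambda>\<omega>. 2 ^ 8 * (1 + z \<omega> ^ 8 + y \<omega> ^ 8 + q \<omega> ^ 4))"
  have v_nonneg: "0 \<le> v \<omega>" for \<omega> using q_nonneg[of \<omega>] by (simp add: v_def)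
  have le: "v \<omega> ^ 4 \<le> w \<omega>" for \<omega>
  proof -
    define a c where "a = 1 + (z \<omega>)\<^sup>2" and "c = (y \<omega>)\<^sup>2 + q \<omega>"
    have "\<bar>a + c\<bar> ^ 4 \<le> 2 ^ 4 * (\<bar>a\<bar> ^ 4 + \<bar>c\<bar> ^ 4)" by (rule abs_power_add_le)
    also have "\<dots> \<le> 2 ^ 4 * (2 ^ 4 * (\<bar>1\<bar> ^ 4 + \<bar>(z \<omega>)\<^sup>2\<bar> ^ 4) + 2 ^ 4 * (\<bar>(y \<omega>)\<^sup>2\<bar> ^ 4 + \<bar>q \<omega>\<bar> ^ 4))"
      unfolding a_def c_def by (intro mult_left_mono add_mono abs_power_add_le) auto
    also have "\<dots> = w \<omega>" using q_nonneg[of \<omega>] by (simp add: w_def flip: power_mult)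
    finally show ?thesis using v_nonneg[of \<omega>] by (simp add: v_def a_def c_def)
  qed
  have int_w: "integrable M w"
    unfolding w_def using z_integrable[of 8] y_integrable q_integrable by auto
  show *: "integrable M (\<lambda>\<omega>. v \<omega> ^ 4)"
    by (rule Bochner_Integration.integrable_bound[OF int_w])
      (use v_nonneg in \<open>auto intro!: AE_I2 order_trans[OF le]\<close>)
  have "expectation (\<lambda>\<omega>. v \<omega> ^ 4) \<le> expectation w"
    by (intro integral_mono * int_w le)
  also have "\<dots> = 2 ^ 8 * (1 + expectation (\<lambda>\<omega>. z \<omega> ^ 8) + expectation (\<lambda>\<omega>. y \<omega> ^ 8) + expectation (\<lambda>\<omega>. q \<omega> ^ 4))"
    unfolding w_def using z_integrable[of 8] y_integrable q_integrable by (simp add: prob_space)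
  also have "\<dots> \<le> v4_const"
    unfolding v4_const_def using eighth_moment_z eighth_moment_y fourth_moment_q
    by (intro mult_left_mono add_mono) auto
  finally show "expectation (\<lambda>\<omega>. v \<omega> ^ 4) \<le> v4_const" .
qed

text \<open>Jensen's inequality for \<open>x\<^bsup>-8\<^esup>\<close> and the mean \<open>1\<close> of \<open>T/n\<close>, through the tangent \<open>9 - 8 x\<close> at \<open>1\<close>. It lets
  bounded terms be absorbed into \<open>\<surd>\<gamma>\<close>.\<close>

lemma gamma_ge_1: "1 \<le> \<gamma>"
proof -
  have "1 = expectation (\<lambda>\<omega>. 9 - 8 * (T n \<omega> / real n))"
    using mean_T[of n] T_integrable[of n] n_pos by (simp add: prob_space)
  also have "\<dots> \<le> expectation (\<lambda>\<omega>. r \<omega> ^ 8)"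
  proof (rule integral_mono_AE)
    show "integrable M (\<lambda>\<omega>. 9 - 8 * (T n \<omega> / real n))" using T_integrable[of n] by auto
    show "integrable M (\<lambda>\<omega>. r \<omega> ^ 8)" by (rule r_integrable) simp
    show "AE \<omega> in M. 9 - 8 * (T n \<omega> / real n) \<le> r \<omega> ^ 8"
      using T_pos
    proof eventually_elim
      case (elim \<omega>)
      define x where "x = r \<omega>"
      have x: "0 < x" "T n \<omega> / real n = 1 / x" using elim n_pos by (auto simp: x_def r_def)
      have "1 + real 9 * (x - 1) \<le> (1 + (x - 1)) ^ 9"
        using x by (intro Bernoulli_inequality) auto
      then have "9 * x - 8 \<le> x ^ 8 * x" by (simp flip: power_Suc2)
      then have "(9 * x - 8) / x \<le> x ^ 8" using x by (simp add: field_simps)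
      then show ?case using x by (simp add: diff_divide_distrib flip: x_def)
    qed
  qed
  also have "\<dots> \<le> \<gamma>" using r_moment by (simp add: r_def)
  finally show ?thesis .
qed

text \<open>The product \<open>v\<^sup>2 R\<close> with \<open>R = (1 + r\<^sup>2)\<^sup>2\<close> is split as \<open>(g v\<^sup>4 + R\<^sup>2/g) / 2\<close>. The mean of \<open>R\<^sup>2\<close> is of order \<open>\<gamma>\<close>,
  so the weight \<open>g = \<surd>\<gamma>\<close> makes both halves of order \<open>\<surd>\<gamma>\<close>.\<close>

lemma discrepancy_moment:
  "integrable M (\<lambda>\<omega>. (F \<omega> - \<sigma>2 * U \<omega>)\<^sup>2)"
  "expectation (\<lambda>\<omega>. (F \<omega> - \<sigma>2 * U \<omega>)\<^sup>2) \<le> discrepancy_const\<^sup>2 * (v4_const + 8) * sqrt \<gamma> / real n"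
proof -
  define g where "g = sqrt \<gamma>"
  have g: "0 < g" "g * g = \<gamma>" using gamma_ge_1 by (auto simp: g_def)
  define w where "w = (\<lambda>\<omega>. discrepancy_const\<^sup>2 / real n * ((g * v \<omega> ^ 4 + (8 + 8 * r \<omega> ^ 8) / g) / 2))"
  have le: "AE \<omega> in M. (F \<omega> - \<sigma>2 * U \<omega>)\<^sup>2 \<le> w \<omega>"
    using T_pos
  proof eventually_elim
    case (elim \<omega>)
    define R where "R = (1 + (r \<omega>)\<^sup>2)\<^sup>2"
    have "(sqrt (real n) * \<bar>F \<omega> - \<sigma>2 * U \<omega>\<bar>)\<^sup>2 \<le> (discrepancy_const * (v \<omega> * (1 + (r \<omega>)\<^sup>2)))\<^sup>2"
      using discrepancy_bound[OF elim] by (intro power_mono) auto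
    then have "real n * (F \<omega> - \<sigma>2 * U \<omega>)\<^sup>2 \<le> discrepancy_const\<^sup>2 * ((v \<omega>)\<^sup>2 * R)"
      by (simp add: power_mult_distrib R_def)
    also have "\<dots> \<le> discrepancy_const\<^sup>2 * ((g * v \<omega> ^ 4 + (8 + 8 * r \<omega> ^ 8) / g) / 2)"
    proof (rule mult_left_mono)
      have "2 * (g * (v \<omega>)\<^sup>2) * R \<le> (g * (v \<omega>)\<^sup>2)\<^sup>2 + R\<^sup>2" by (rule sum_squares_bound)
      also have "(g * (v \<omega>)\<^sup>2)\<^sup>2 = g * (g * v \<omega> ^ 4)"
        by (simp add: power_mult_distrib power2_eq_square power4_eq_xxxx)
      also have "R\<^sup>2 \<le> 8 + 8 * r \<omega> ^ 8"
      proof -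
        have c: "(1 + x)\<^sup>2 \<le> 2 * (1 + x\<^sup>2)" for x :: real
          using sum_squares_bound[of 1 x] by (simp add: power2_sum)
        have "R \<le> 2 * (1 + r \<omega> ^ 4)" using c[of "(r \<omega>)\<^sup>2"] by (simp add: R_def flip: power_mult)
        then have "R\<^sup>2 \<le> (2 * (1 + r \<omega> ^ 4))\<^sup>2" by (intro power_mono) (auto simp: R_def)
        also have "\<dots> = 4 * (1 + r \<omega> ^ 4)\<^sup>2" by (subst power_mult_distrib) simp
        also have "\<dots> \<le> 4 * (2 * (1 + r \<omega> ^ 8))"
          using c[of "r \<omega> ^ 4"] by (intro mult_left_mono) (auto simp flip: power_mult)
        finally show ?thesis by simp
      qed
      finally have "2 * (g * (v \<omega>)\<^sup>2) * R \<le> g * (g * v \<omega> ^ 4) + (8 + 8 * r \<omega> ^ 8)" by simp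
      then show "(v \<omega>)\<^sup>2 * R \<le> (g * v \<omega> ^ 4 + (8 + 8 * r \<omega> ^ 8) / g) / 2"
        using g(1) by (simp add: field_simps)
    qed simp
    finally show ?case using n_pos by (simp add: w_def field_simps)
  qed
  have int_w: "integrable M w"
    unfolding w_def using v_fourth_moment(1) r_integrable[of 8] by auto
  show *: "integrable M (\<lambda>\<omega>. (F \<omega> - \<sigma>2 * U \<omega>)\<^sup>2)"
  proof (rule Bochner_Integration.integrable_bound[OF int_w])
    show "AE \<omega> in M. norm ((F \<omega> - \<sigma>2 * U \<omega>)\<^sup>2) \<le> norm (w \<omega>)"
      using le by eventually_elim auto
  qed measurable
  have "expectation (\<lambda>\<omega>. (F \<omega> - \<sigma>2 * U \<omega>)\<^sup>2) \<le> expectation w"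
    by (rule integral_mono_AE[OF * int_w le])
  also have "\<dots> = discrepancy_const\<^sup>2 / real n * ((g * expectation (\<lambda>\<omega>. v \<omega> ^ 4) + (8 + 8 * expectation (\<lambda>\<omega>. r \<omega> ^ 8)) / g) / 2)"
    unfolding w_def using v_fourth_moment(1) r_integrable[of 8] by (simp add: prob_space)
  also have "\<dots> \<le> discrepancy_const\<^sup>2 / real n * ((g * v4_const + (8 * \<gamma> + 8 * \<gamma>) / g) / 2)"
    using v_fourth_moment(2) r_moment gamma_ge_1 g(1)
    by (intro mult_left_mono divide_right_mono add_mono) (auto simp: r_def)
  also have "(8 * \<gamma> + 8 * \<gamma>) / g = 16 * g"
    using g by (simp add: field_simps)
  also have "discrepancy_const\<^sup>2 / real n * ((g * v4_const + 16 * g) / 2) = (discrepancy_const\<^sup>2 * g / real n) * ((v4_const + 16) / 2)"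
    by (simp add: field_simps)
  also have "\<dots> \<le> (discrepancy_const\<^sup>2 * g / real n) * (v4_const + 8)"
  proof (rule mult_left_mono)
    have "0 \<le> expectation (\<lambda>\<omega>. v \<omega> ^ 4)" by (intro Bochner_Integration.integral_nonneg) auto
    then have "0 \<le> v4_const" using v_fourth_moment(2) by (rule order_trans)
    then show "(v4_const + 16) / 2 \<le> v4_const + 8" by simp
  qed (use g in auto)
  finally show "expectation (\<lambda>\<omega>. (F \<omega> - \<sigma>2 * U \<omega>)\<^sup>2) \<le> discrepancy_const\<^sup>2 * (v4_const + 8) * sqrt \<gamma> / real n"
    by (simp add: g_def mult_ac)
qed

text \<open>Scaling \<open>F\<close> by \<open>1/\<sigma>\<close> scales \<open>U\<close> by \<open>\<sigma>\<close>, and \<open>F/\<sigma> - \<sigma> U = (F - \<sigma>\<^sup>2 U) / \<sigma>\<close>.\<close>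

theorem fisher_information_bound:
  "fisher_information_distance M (\<lambda>\<omega>. F \<omega> / sqrt \<sigma>2)
    \<le> ennreal (discrepancy_const\<^sup>2 * (v4_const + 8) * sqrt \<gamma> / (real n * \<sigma>2))"
proof -
  define c where "c = sqrt \<sigma>2"
  have c: "0 < c" "c\<^sup>2 = \<sigma>2" using \<sigma>2_pos by (auto simp: c_def)
  interpret SI: score_identity M "\<lambda>\<omega>. F \<omega> / c" "\<lambda>\<omega>. c * U \<omega>"
  proof
    show "(\<lambda>\<omega>. F \<omega> / c) \<in> borel_measurable M" by measurable
    show "integrable M (\<lambda>\<omega>. c * U \<omega>)" using U_integrable by simp
    fix \<phi> \<phi>' :: "real \<Rightarrow> real" and B
    assume \<phi>: "\<And>x. (\<phi> has_real_derivative \<phi>' x) (at x)" "continuous_on UNIV \<phi>'"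
      "\<And>x. \<bar>\<phi> x\<bar> \<le> B" "\<And>x. \<bar>\<phi>' x\<bar> \<le> B"
    have B: "0 \<le> B" using \<phi>(3)[of 0] by simp
    have "expectation (\<lambda>\<omega>. \<phi>' (F \<omega> / c)) = expectation (\<lambda>\<omega>. (c * \<phi> (F \<omega> / c)) * U \<omega>)"
    proof (rule score_of_F)
      fix x
      have "((\<lambda>x. c * \<phi> (x / c)) has_real_derivative c * (\<phi>' (x / c) * (1 / c))) (at x)"
        by (intro DERIV_cmult DERIV_chain2[OF \<phi>(1)] DERIV_cdivide DERIV_ident)
      then show "((\<lambda>x. c * \<phi> (x / c)) has_real_derivative \<phi>' (x / c)) (at x)"
        using c by simp
      have "\<bar>c * \<phi> (x / c)\<bar> \<le> c * B"
        unfolding abs_mult using c \<phi>(3) by (intro mult_mono) auto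
      then show "\<bar>c * \<phi> (x / c)\<bar> \<le> c * B + B" using B by linarith
      have "0 \<le> c * B" using c B by simp
      then show "\<bar>\<phi>' (x / c)\<bar> \<le> c * B + B" using \<phi>(4)[of "x / c"] by linarith
    next
      have "continuous_on UNIV (\<phi>' \<circ> (\<lambda>x. x / c))"
        using c by (intro continuous_on_compose continuous_intros continuous_on_subset[OF \<phi>(2)]) auto
      then show "continuous_on UNIV (\<lambda>x. \<phi>' (x / c))" by (simp add: comp_def)
    qed
    then show "expectation (\<lambda>\<omega>. \<phi>' (F \<omega> / c)) = expectation (\<lambda>\<omega>. \<phi> (F \<omega> / c) * (c * U \<omega>))"
      by (simp add: mult_ac)
  qed
  have "fisher_information_distance M (\<lambda>\<omega>. F \<omega> / c) \<le> (\<integral>\<^sup>+\<omega>. ennreal ((F \<omega> / c - c * U \<omega>)\<^sup>2) \<partial>M)"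
    by (rule SI.fisher_information_distance_le)
  also have "\<dots> = (\<integral>\<^sup>+\<omega>. ennreal ((F \<omega> - \<sigma>2 * U \<omega>)\<^sup>2 / \<sigma>2) \<partial>M)"
  proof (intro nn_integral_cong arg_cong[where f = ennreal])
    fix \<omega>
    have "F \<omega> / c - c * U \<omega> = (F \<omega> - \<sigma>2 * U \<omega>) / c"
      using c by (simp add: diff_divide_distrib power2_eq_square flip: c(2))
    then show "(F \<omega> / c - c * U \<omega>)\<^sup>2 = (F \<omega> - \<sigma>2 * U \<omega>)\<^sup>2 / \<sigma>2"
      by (simp add: power_divide c)
  qed
  also have "\<dots> = ennreal (expectation (\<lambda>\<omega>. (F \<omega> - \<sigma>2 * U \<omega>)\<^sup>2 / \<sigma>2))"
    using discrepancy_moment(1) \<sigma>2_pos by (intro nn_integral_eq_integral) auto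
  also have "\<dots> \<le> ennreal (discrepancy_const\<^sup>2 * (v4_const + 8) * sqrt \<gamma> / (real n * \<sigma>2))"
  proof (rule ennreal_leI)
    have "expectation (\<lambda>\<omega>. (F \<omega> - \<sigma>2 * U \<omega>)\<^sup>2 / \<sigma>2) = expectation (\<lambda>\<omega>. (F \<omega> - \<sigma>2 * U \<omega>)\<^sup>2) / \<sigma>2"
      by simp
    also have "\<dots> \<le> (discrepancy_const\<^sup>2 * (v4_const + 8) * sqrt \<gamma> / real n) / \<sigma>2"
      using discrepancy_moment(2) \<sigma>2_pos by (intro divide_right_mono) auto
    finally show "expectation (\<lambda>\<omega>. (F \<omega> - \<sigma>2 * U \<omega>)\<^sup>2 / \<sigma>2) \<le> discrepancy_const\<^sup>2 * (v4_const + 8) * sqrt \<gamma> / (real n * \<sigma>2)"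
      by simp
  qed
  finally show ?thesis by (simp add: c_def)
qed

end

section \<open>The bound on the Fisher information distance\<close>

text \<open>The maximum with \<open>1\<close> keeps the constant positive for arguments that are not moments and norms.\<close>

definition delta_constant :: "real \<Rightarrow> real \<Rightarrow> real \<Rightarrow> real \<Rightarrow> real" where
  "delta_constant b h1 h2 m = max 1 ((delta_method.discrepancy_const b h1 h2 m)\<^sup>2 * (delta_method.v4_const b + 8))"

lemma (in prob_space) eighth_moment_le_imp:
  assumes [measurable]: "Y \<in> borel_measurable M" and le: "eighth_moment M Y \<le> ennreal c" and "0 \<le> c"
  shows "integrable M (\<lambda>\<omega>. \<bar>Y \<omega>\<bar> ^ 8)" "expectation (\<lambda>\<omega>. \<bar>Y \<omega>\<bar> ^ 8) \<le> c"
proof -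
  have "eighth_moment M Y < \<infinity>" using le by (rule le_less_trans) simp
  then show int: "integrable M (\<lambda>\<omega>. \<bar>Y \<omega>\<bar> ^ 8)"
    by (intro integrableI_nonneg) (auto simp: eighth_moment_def)
  have "ennreal (expectation (\<lambda>\<omega>. \<bar>Y \<omega>\<bar> ^ 8)) = eighth_moment M Y"
    unfolding eighth_moment_def by (intro nn_integral_eq_integral[symmetric] int) auto
  then have "ennreal (expectation (\<lambda>\<omega>. \<bar>Y \<omega>\<bar> ^ 8)) \<le> ennreal c" using le by (rule ord_eq_le_trans)
  then show "expectation (\<lambda>\<omega>. \<bar>Y \<omega>\<bar> ^ 8) \<le> c" by (rule ennreal_le_iff[THEN iffD1, OF \<open>0 \<le> c\<close>])
qed

lemma stein_sequence_of_moment_bound: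
  assumes "prob_space M" and indep: "prob_space.indep_vars M (\<lambda>_. borel) X {1..}"
    and X: "\<And>k. 1 \<le> k \<Longrightarrow> integrable M (X k) \<and> prob_space.expectation M (X k) = 0 \<and>
             prob_space.variance M (X k) = 1"
    and dens: "\<And>k. 1 \<le> k \<Longrightarrow> differentiable_density_on_interval M (X k) (p k)"
    and fin: "moment_bound M X p < \<infinity>"
  shows "stein_sequence M X p (enn2real (moment_bound M X p))"
proof -
  interpret prob_space M by fact
  define b where "b = enn2real (moment_bound M X p)"
  have b: "moment_bound M X p = ennreal b" using fin by (simp add: b_def)
  have sd: "stein_density M (X k) (p k)" if "1 \<le> k" for k
    using X[OF that] dens[OF that] by unfold_locales auto
  have le: "eighth_moment M (Y k) \<le> ennreal b"
    if "1 \<le> k" "(SUP k\<in>{1..}. eighth_moment M (Y k)) \<in> {SUP k\<in>{1..}. eighth_moment M (X k),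
          SUP k\<in>{1..}. eighth_moment M (\<lambda>\<omega>. stein_kernel (p k) (X k \<omega>)),
          SUP k\<in>{1..}. eighth_moment M (\<lambda>\<omega>. deriv (stein_kernel (p k)) (X k \<omega>))}" for Y and k :: nat
  proof -
    have "eighth_moment M (Y k) \<le> (SUP k\<in>{1..}. eighth_moment M (Y k))"
      using that(1) by (intro SUP_upper) auto
    also have "\<dots> \<le> moment_bound M X p"
      unfolding moment_bound_def using that(2) by (intro Max_ge) auto
    finally show ?thesis by (simp add: b)
  qed
  have X_borel: "X k \<in> borel_measurable M" if "1 \<le> k" for k
    by (rule stein_density.X_borel[OF sd[OF that]])
  note comp = measurable_compose[OF X_borel]
  have b0: "0 \<le> b" by (simp add: b_def)
  note m1 = eighth_moment_le_imp[OF X_borel le[of _ X] b0]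
    and m2 = eighth_moment_le_imp[OF comp[OF _ stein_density.stein_kernel_borel[OF sd]] le[of _ "\<lambda>k \<omega>. stein_kernel (p k) (X k \<omega>)"] b0]
    and m3 = eighth_moment_le_imp[OF comp[OF _ stein_density.deriv_stein_kernel_borel[OF sd]] le[of _ "\<lambda>k \<omega>. deriv (stein_kernel (p k)) (X k \<omega>)"] b0]
  show ?thesis
    unfolding b_def[symmetric]
  proof (intro stein_sequence.intro stein_sequence_axioms.intro)
    show "prob_space M" by fact
  next
    fix k :: nat assume k: "1 \<le> k"
    show "stein_density M (X k) (p k)" by (rule sd[OF k])
    have mean: "expectation (X k) = 0" and var: "variance (X k) = 1" using X[OF k] by blast+
    from var show "expectation (\<lambda>\<omega>. (X k \<omega>)\<^sup>2) = 1" unfolding mean diff_zero .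
    show "integrable M (\<lambda>\<omega>. \<bar>X k \<omega>\<bar> ^ 8)" "expectation (\<lambda>\<omega>. \<bar>X k \<omega>\<bar> ^ 8) \<le> b"
      using m1[of k] k by auto
    show "integrable M (\<lambda>\<omega>. \<bar>stein_kernel (p k) (X k \<omega>)\<bar> ^ 8)"
      "expectation (\<lambda>\<omega>. \<bar>stein_kernel (p k) (X k \<omega>)\<bar> ^ 8) \<le> b"
      using m2[of k] k by auto
    show "integrable M (\<lambda>\<omega>. \<bar>deriv (stein_kernel (p k)) (X k \<omega>)\<bar> ^ 8)"
      "expectation (\<lambda>\<omega>. \<bar>deriv (stein_kernel (p k)) (X k \<omega>)\<bar> ^ 8) \<le> b"
      using m3[of k] k by auto
  qed (rule indep)
qed

lemma abs_le_sup_norm: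
  assumes "bounded (range f)"
  shows "\<bar>f x\<bar> \<le> sup_norm f"
proof -
  obtain B where "\<And>x. \<bar>f x\<bar> \<le> B" using assms by (auto simp: bounded_iff)
  then have "bdd_above (range (\<lambda>x. \<bar>f x\<bar>))" by (auto intro!: bdd_aboveI[of _ B])
  then show ?thesis unfolding sup_norm_def by (intro cSUP_upper) auto
qed

lemma fisher_information_delta_le:
  assumes seq: "stein_sequence M X p (enn2real (moment_bound M X p))"
    and H: "twice_diff_bounded_derivs H" and m: "0 < (INF x. \<bar>deriv H x\<bar>)"
    and n0: "1 \<le> n\<^sub>0" and fin: "neg_moment_bound M X p n\<^sub>0 < \<infinity>" and n: "n\<^sub>0 \<le> n"
  shows "fisher_information_distance M
           (\<lambda>\<omega>. delta_statistic M H X n \<omega> / sqrt (delta_variance M H X n))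
         \<le> ennreal (delta_constant (enn2real (moment_bound M X p)) (sup_norm (deriv H))
                      (sup_norm (deriv (deriv H))) (INF x. \<bar>deriv H x\<bar>)
                    * sqrt (enn2real (neg_moment_bound M X p n\<^sub>0))
                    / (real n * delta_variance M H X n))"
proof -
  define \<gamma> where "\<gamma> = enn2real (neg_moment_bound M X p n\<^sub>0)"
  interpret stein_sequence M X p "enn2real (moment_bound M X p)" by (rule seq)
  have n1: "1 \<le> n" using n0 n by simp
  have "of_nat n ^ 8 * neg_eighth_moment M (T n) \<le> neg_moment_bound M X p n\<^sub>0"
    unfolding neg_moment_bound_def using n by (intro SUP_upper) auto
  also have "\<dots> = ennreal \<gamma>" using fin by (simp add: \<gamma>_def)
  finally have "of_nat n ^ 8 * neg_eighth_moment M (T n) \<le> ennreal \<gamma>" .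
  note ratio = ratio_moment[OF n1 this]
  have bdd: "bdd_below (range (\<lambda>x. \<bar>deriv H x\<bar>))" by (auto intro: bdd_belowI[of _ 0])
  interpret DM: delta_method M X p "enn2real (moment_bound M X p)" H "sup_norm (deriv H)"
      "sup_norm (deriv (deriv H))" "INF x. \<bar>deriv H x\<bar>" \<gamma> n
  proof
    show "(H has_real_derivative deriv H x) (at x)" "(deriv H has_real_derivative deriv (deriv H) x) (at x)" for x
      using H by (auto simp: twice_diff_bounded_derivs_def DERIV_deriv_iff_real_differentiable)
    show "\<bar>deriv H x\<bar> \<le> sup_norm (deriv H)" "\<bar>deriv (deriv H) x\<bar> \<le> sup_norm (deriv (deriv H))" for x
      using H by (auto simp: twice_diff_bounded_derivs_def intro!: abs_le_sup_norm)
    show "(INF x. \<bar>deriv H x\<bar>) \<le> \<bar>deriv H x\<bar>" for x by (rule cINF_lower[OF bdd]) simp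
  qed (use m n1 ratio in \<open>auto simp: \<gamma>_def\<close>)
  have "fisher_information_distance M (\<lambda>\<omega>. DM.F \<omega> / sqrt DM.\<sigma>2)
    \<le> ennreal (DM.discrepancy_const\<^sup>2 * (DM.v4_const + 8) * sqrt \<gamma> / (real n * DM.\<sigma>2))"
    by (rule DM.fisher_information_bound)
  also have "\<dots> \<le> ennreal (delta_constant (enn2real (moment_bound M X p)) (sup_norm (deriv H))
                      (sup_norm (deriv (deriv H))) (INF x. \<bar>deriv H x\<bar>) * sqrt \<gamma> / (real n * DM.\<sigma>2))"
    using DM.\<sigma>2_pos DM.gamma_ge_1
    by (intro ennreal_leI divide_right_mono mult_right_mono) (auto simp: delta_constant_def)
  finally show ?thesis by (simp add: DM.F_def DM.\<sigma>2_def \<gamma>_def)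
qed

theorem corollary4p4:
  shows "\<exists>C :: real \<Rightarrow> real \<Rightarrow> real \<Rightarrow> real \<Rightarrow> real.
    (\<forall>b h\<^sub>1 h\<^sub>2 m. 0 < C b h\<^sub>1 h\<^sub>2 m) \<and>
    (\<forall>(M :: 'a measure) (X :: nat \<Rightarrow> 'a \<Rightarrow> real) (p :: nat \<Rightarrow> real \<Rightarrow> real) (H :: real \<Rightarrow> real) (n\<^sub>0 :: nat).
      prob_space M \<longrightarrow>
      prob_space.indep_vars M (\<lambda>_. borel) X {1..} \<longrightarrow>
      (\<forall>k\<ge>1. integrable M (X k) \<and> prob_space.expectation M (X k) = 0 \<and>
             prob_space.variance M (X k) = 1) \<longrightarrow>
      (\<forall>k\<ge>1. differentiable_density_on_interval M (X k) (p k)) \<longrightarrow>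
      twice_diff_bounded_derivs H \<longrightarrow>
      deriv H 0 \<noteq> 0 \<longrightarrow>
      moment_bound M X p < \<infinity> \<longrightarrow>
      0 < (INF x. \<bar>deriv H x\<bar>) \<longrightarrow>
      1 \<le> n\<^sub>0 \<longrightarrow>
      neg_eighth_moment M (stein_kernel_sum X p n\<^sub>0) < \<infinity> \<longrightarrow>
      neg_moment_bound M X p n\<^sub>0 < \<infinity> \<and>
      (\<forall>n\<ge>n\<^sub>0.
         fisher_information_distance M
           (\<lambda>\<omega>. delta_statistic M H X n \<omega> / sqrt (delta_variance M H X n))
         \<le> ennreal (C (enn2real (moment_bound M X p)) (sup_norm (deriv H))
                      (sup_norm (deriv (deriv H))) (INF x. \<bar>deriv H x\<bar>)
                    * sqrt (enn2real (neg_moment_bound M X p n\<^sub>0))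
                    / (real n * delta_variance M H X n))))"
proof (intro exI conjI allI impI)
  show "0 < delta_constant b h\<^sub>1 h\<^sub>2 m" for b h\<^sub>1 h\<^sub>2 m
    by (simp add: delta_constant_def)
next
  fix M :: "'a measure" and X :: "nat \<Rightarrow> 'a \<Rightarrow> real" and p :: "nat \<Rightarrow> real \<Rightarrow> real"
    and H :: "real \<Rightarrow> real" and n\<^sub>0 :: nat
  assume "prob_space M" "prob_space.indep_vars M (\<lambda>_. borel) X {1..}"
    "\<forall>k\<ge>1. integrable M (X k) \<and> prob_space.expectation M (X k) = 0 \<and>
             prob_space.variance M (X k) = 1"
    "\<forall>k\<ge>1. differentiable_density_on_interval M (X k) (p k)"
    "moment_bound M X p < \<infinity>"
  then have seq: "stein_sequence M X p (enn2real (moment_bound M X p))"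
    by (intro stein_sequence_of_moment_bound) auto
  assume "neg_eighth_moment M (stein_kernel_sum X p n\<^sub>0) < \<infinity>"
  then show fin: "neg_moment_bound M X p n\<^sub>0 < \<infinity>"
    by (rule stein_sequence.neg_moment_bound_finite[OF seq])
  assume H: "twice_diff_bounded_derivs H" "0 < (INF x. \<bar>deriv H x\<bar>)" and n: "1 \<le> n\<^sub>0"
  show "fisher_information_distance M
           (\<lambda>\<omega>. delta_statistic M H X n \<omega> / sqrt (delta_variance M H X n))
         \<le> ennreal (delta_constant (enn2real (moment_bound M X p)) (sup_norm (deriv H))
                      (sup_norm (deriv (deriv H))) (INF x. \<bar>deriv H x\<bar>)
                    * sqrt (enn2real (neg_moment_bound M X p n\<^sub>0))
                    / (real n * delta_variance M H X n))" if "n\<^sub>0 \<le> n" for n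
    by (rule fisher_information_delta_le[OF seq H n fin that])
qed

end
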